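(* Let $\mu_0=N(m_0,C_0)$ be a Gaussian measure on $\mathcal H$ with mean $m_0\in\mathcal H$ and (strictly positive, trace-class) covariance operator $C_0$, and let $\mu$ be given by $\frac{d\mu}{d\mu_0}(x)=\frac1{Z_\mu}\exp(-\Phi(x))$. Let $$\mathcal A=\{N_{P,0}(m,\Gamma): m\in\mathcal H,\ \Gamma\in\mathcal{HS}(\mathcal H^1,\mathcal H^{-1})\ \text{symmetric}\}.$$ Let $\nu_n=N_{P,0}(m_n,\Gamma_n)$ be a sequence of Gaussian measures in $\mathcal A$ that converge weakly to $\nu_\star$ with $$D_{\rm KL}(\nu_n\|\mu)\to D_{\rm KL}(\nu_\star\|\mu).$$ Then $\nu_\star=N_{P,0}(m_\star,\Gamma_\star)$ and $$\|m_n-m_\star\|_{\mathcal H^1}+\|\Gamma_n-\Gamma_\star\|_{\mathcal{HS}(\mathcal H^1,\mathcal H^{-1})}\to 0 .$$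
   Context: $\mathcal H$ is a separable Hilbert space with its Borel $\sigma$-algebra. $N(m,C)$ denotes the Gaussian measure with mean $m$ and covariance operator $C$; Dirac measures count as Gaussian. $X\subseteq\mathcal H$ is a separable Banach space continuously embedded in $\mathcal H$, Borel measurable as a subset of $\mathcal H$, with $\mu_0(X)=1$; $\Phi:X\to\mathbb R$ is continuous in the topology of $X$, $\exp(-\Phi)$ is $\mu_0$-integrable, $Z_\mu=\int\exp(-\Phi)\,d\mu_0$. $D_{\rm KL}(\nu\|\mu)=\int \log\big(\frac{d\nu}{d\mu}\big)\,d\nu$ if $\nu\ll\mu$ and $+\infty$ otherwise. $\mathcal H^1=C_0^{1/2}\mathcal H$ with scalar product $\langle C_0^{-1/2}\cdot,C_0^{-1/2}\cdot\rangle$ (the Cameron–Martin space of $\mu_0$), and $\mathcal H^{-1}$ is its dual (via the pairing extending the scalar product of $\mathcal H$, so $\mathcal H^1\subset\mathcal H\subset\mathcal H^{-1}$). $\mathcal{HS}(\mathcal H^1,\mathcal H^{-1})$ is the space of Hilbert–Schmidt operators $\mathcal H^1\to\mathcal H^{-1}$, with norm $\|\Gamma\|_{\mathcal{HS}(\mathcal H^1,\mathcal H^{-1})}=\|C_0^{1/2}\Gamma C_0^{1/2}\|_{\mathcal{HS}(\mathcal H)}$, where $\mathcal{HS}(\mathcal H)$ denotes the Hilbert–Schmidt operators on $\mathcal H$. $\Gamma$ is symmetric if $\langle u,\Gamma v\rangle=\langle v,\Gamma u\rangle$ for $u,v\in\mathcal H^1$. For symmetric $\Gamma\in\mathcal{HS}(\mathcal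 H^1,\mathcal H^{-1})$ the quadratic form $Q_\Gamma(u,v)=\langle C_0^{-1/2}u,C_0^{-1/2}v\rangle+\langle u,\Gamma v\rangle$ on $\mathcal H^1$ is closed and bounded below, and $C_0^{-1}+\Gamma$ denotes the associated self-adjoint operator on $\mathcal H$. $N_{P,0}(m,\Gamma)$ is the Gaussian measure with mean $m$ and covariance operator $(C_0^{-1}+\Gamma)^{-1}$ if $C_0^{-1}+\Gamma$ is strictly positive, and $N_{P,0}(m,\Gamma)=\delta_m$ otherwise.
   Formalization: The limit D_KL(ν⋆‖μ) is assumed finite; if +∞ is allowed the claim fails, e.g. for ν_n = δ_m with C_0^{-1}+Γ_n not strictly positive and Γ_n divergent, where D_KL is +∞ throughout. *)

theory Defs
  imports "HOL-Probability.Probability"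
begin

text \<open>
  A separable Hilbert space is a type of class real_inner, banach and second_countable_topology.
  A linear functional on the Cameron--Martin space is represented by a function on the whole
  type, of which only the values on the Cameron--Martin space matter.
\<close>

section \<open>Operators\<close>

definition orthonormal_basis :: "'h::real_inner set \<Rightarrow> bool" where
  "orthonormal_basis E \<longleftrightarrow>
     (\<forall>e\<in>E. norm e = 1) \<and> pairwise orthogonal E \<and> closure (span E) = UNIV"

definition hilbert_schmidt :: "('h::real_inner \<Rightarrow> 'h) \<Rightarrow> bool" where
  "hilbert_schmidt T \<longleftrightarrow>
     bounded_linear T \<and> (\<exists>E. orthonormal_basis E \<and> (\<lambda>e. (norm (T e))\<^sup>2) summable_on E)"

text \<open>The norm does not depend on the orthonormal basis that is selected.\<close>

definition hs_norm :: "('h::real_inner \<Rightarrow> 'h) \<Rightarrow> real" where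
  "hs_norm T = sqrt (\<Sum>\<^sub>\<infinity>e\<in>(SOME E. orthonormal_basis E). (norm (T e))\<^sup>2)"

definition self_adjoint :: "('h::real_inner \<Rightarrow>\<^sub>L 'h) \<Rightarrow> bool" where
  "self_adjoint C \<longleftrightarrow> (\<forall>x y. blinfun_apply C x \<bullet> y = x \<bullet> blinfun_apply C y)"

definition nonneg_operator :: "('h::real_inner \<Rightarrow>\<^sub>L 'h) \<Rightarrow> bool" where
  "nonneg_operator C \<longleftrightarrow> self_adjoint C \<and> (\<forall>x. 0 \<le> x \<bullet> blinfun_apply C x)"

definition strictly_positive_operator :: "('h::real_inner \<Rightarrow>\<^sub>L 'h) \<Rightarrow> bool" where
  "strictly_positive_operator C \<longleftrightarrow> self_adjoint C \<and> (\<forall>x. x \<noteq> 0 \<longrightarrow> 0 < x \<bullet> blinfun_apply C x)"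

text \<open>For a nonnegative operator, which equals its own absolute value, being trace class means
  that the following sum is finite.\<close>

definition nonneg_trace_class :: "('h::real_inner \<Rightarrow>\<^sub>L 'h) \<Rightarrow> bool" where
  "nonneg_trace_class C \<longleftrightarrow> nonneg_operator C \<and>
     (\<exists>E. orthonormal_basis E \<and> (\<lambda>e. e \<bullet> blinfun_apply C e) summable_on E)"

definition op_sqrt :: "('h::real_inner \<Rightarrow>\<^sub>L 'h) \<Rightarrow> ('h \<Rightarrow>\<^sub>L 'h)" where
  "op_sqrt C = (THE S. nonneg_operator S \<and> S o\<^sub>L S = C)"

section \<open>The Cameron--Martin space and its dual\<close>

definition cm_space :: "('h::real_inner \<Rightarrow>\<^sub>L 'h) \<Rightarrow> 'h set" where
  "cm_space C = range (blinfun_apply (op_sqrt C))"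

text \<open>\<open>C\<^sup>-\<^sup>1\<^sup>/\<^sup>2\<close> on the Cameron--Martin space, for strictly positive C.\<close>

definition inv_sqrt :: "('h::real_inner \<Rightarrow>\<^sub>L 'h) \<Rightarrow> 'h \<Rightarrow> 'h" where
  "inv_sqrt C = inv (blinfun_apply (op_sqrt C))"

definition cm_inner :: "('h::real_inner \<Rightarrow>\<^sub>L 'h) \<Rightarrow> 'h \<Rightarrow> 'h \<Rightarrow> real" where
  "cm_inner C u v = inv_sqrt C u \<bullet> inv_sqrt C v"

text \<open>The norm takes the value \<open>\<infinity>\<close> outside the Cameron--Martin space.\<close>

definition cm_norm :: "('h::real_inner \<Rightarrow>\<^sub>L 'h) \<Rightarrow> 'h \<Rightarrow> ereal" where
  "cm_norm C u = (if u \<in> cm_space C then ereal (sqrt (cm_inner C u u)) else \<infinity>)"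

text \<open>A vector h of the Hilbert space is the element \<open>\<lambda>u. h \<bullet> u\<close> of the dual.\<close>

definition cm_dual :: "('h::real_inner \<Rightarrow>\<^sub>L 'h) \<Rightarrow> ('h \<Rightarrow> real) set" where
  "cm_dual C = {\<phi>.
     (\<forall>u\<in>cm_space C. \<forall>v\<in>cm_space C. \<forall>a b. \<phi> (a *\<^sub>R u + b *\<^sub>R v) = a * \<phi> u + b * \<phi> v) \<and>
     (\<exists>K. \<forall>u\<in>cm_space C. \<bar>\<phi> u\<bar> \<le> K * sqrt (cm_inner C u u))}"

text \<open>The extension of \<open>C\<^sup>1\<^sup>/\<^sup>2\<close> to an operator from the dual of the Cameron--Martin space into the
  Hilbert space: \<open>\<langle>x, C\<^sup>1\<^sup>/\<^sup>2 \<phi>\<rangle> = \<langle>C\<^sup>1\<^sup>/\<^sup>2 x, \<phi>\<rangle>\<close>.\<close>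

definition sqrt_on_dual :: "('h::real_inner \<Rightarrow>\<^sub>L 'h) \<Rightarrow> ('h \<Rightarrow> real) \<Rightarrow> 'h" where
  "sqrt_on_dual C \<phi> = (THE y. \<forall>x. x \<bullet> y = \<phi> (blinfun_apply (op_sqrt C) x))"

text \<open>An operator \<open>\<Gamma>\<close> from the Cameron--Martin space into its dual is a function with
  \<open>\<Gamma> v u = \<langle>u, \<Gamma> v\<rangle>\<close>. The following is \<open>C\<^sup>1\<^sup>/\<^sup>2 \<Gamma> C\<^sup>1\<^sup>/\<^sup>2\<close>.\<close>

definition sqrt_conj :: "('h::real_inner \<Rightarrow>\<^sub>L 'h) \<Rightarrow> ('h \<Rightarrow> 'h \<Rightarrow> real) \<Rightarrow> 'h \<Rightarrow> 'h" where
  "sqrt_conj C \<Gamma> x = sqrt_on_dual C (\<Gamma> (blinfun_apply (op_sqrt C) x))"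

definition cm_hs :: "('h::real_inner \<Rightarrow>\<^sub>L 'h) \<Rightarrow> ('h \<Rightarrow> 'h \<Rightarrow> real) set" where
  "cm_hs C = {\<Gamma>.
     (\<forall>v\<in>cm_space C. \<Gamma> v \<in> cm_dual C) \<and>
     (\<forall>v\<in>cm_space C. \<forall>w\<in>cm_space C. \<forall>a b. \<forall>u\<in>cm_space C.
        \<Gamma> (a *\<^sub>R v + b *\<^sub>R w) u = a * \<Gamma> v u + b * \<Gamma> w u) \<and>
     hilbert_schmidt (sqrt_conj C \<Gamma>)}"

definition cm_hs_norm :: "('h::real_inner \<Rightarrow>\<^sub>L 'h) \<Rightarrow> ('h \<Rightarrow> 'h \<Rightarrow> real) \<Rightarrow> real" where
  "cm_hs_norm C \<Gamma> = hs_norm (sqrt_conj C \<Gamma>)"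

definition cm_symmetric :: "('h::real_inner \<Rightarrow>\<^sub>L 'h) \<Rightarrow> ('h \<Rightarrow> 'h \<Rightarrow> real) \<Rightarrow> bool" where
  "cm_symmetric C \<Gamma> \<longleftrightarrow> (\<forall>u\<in>cm_space C. \<forall>v\<in>cm_space C. \<Gamma> v u = \<Gamma> u v)"

section \<open>The self-adjoint operator \<open>C\<^sup>-\<^sup>1 + \<Gamma>\<close>\<close>

definition quad_form :: "('h::real_inner \<Rightarrow>\<^sub>L 'h) \<Rightarrow> ('h \<Rightarrow> 'h \<Rightarrow> real) \<Rightarrow> 'h \<Rightarrow> 'h \<Rightarrow> real" where
  "quad_form C \<Gamma> u v = cm_inner C u v + \<Gamma> v u"

text \<open>The operator associated with a closed form Q on a dense form domain: u belongs to the
  operator domain and is mapped to f iff \<open>Q u v = \<langle>f, v\<rangle>\<close> for all v in the form domain.\<close>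

definition precision_domain :: "('h::real_inner \<Rightarrow>\<^sub>L 'h) \<Rightarrow> ('h \<Rightarrow> 'h \<Rightarrow> real) \<Rightarrow> 'h set" where
  "precision_domain C \<Gamma> = {u \<in> cm_space C. \<exists>f. \<forall>v\<in>cm_space C. quad_form C \<Gamma> u v = f \<bullet> v}"

definition precision_op :: "('h::real_inner \<Rightarrow>\<^sub>L 'h) \<Rightarrow> ('h \<Rightarrow> 'h \<Rightarrow> real) \<Rightarrow> 'h \<Rightarrow> 'h" where
  "precision_op C \<Gamma> u = (THE f. \<forall>v\<in>cm_space C. quad_form C \<Gamma> u v = f \<bullet> v)"

definition precision_strictly_positive ::
    "('h::real_inner \<Rightarrow>\<^sub>L 'h) \<Rightarrow> ('h \<Rightarrow> 'h \<Rightarrow> real) \<Rightarrow> bool" where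
  "precision_strictly_positive C \<Gamma> \<longleftrightarrow>
     (\<forall>u\<in>precision_domain C \<Gamma>. u \<noteq> 0 \<longrightarrow> 0 < u \<bullet> precision_op C \<Gamma> u)"

text \<open>D is the bounded inverse of \<open>C\<^sup>-\<^sup>1 + \<Gamma>\<close>.\<close>

definition is_precision_inverse ::
    "('h::real_inner \<Rightarrow>\<^sub>L 'h) \<Rightarrow> ('h \<Rightarrow> 'h \<Rightarrow> real) \<Rightarrow> ('h \<Rightarrow>\<^sub>L 'h) \<Rightarrow> bool" where
  "is_precision_inverse C \<Gamma> D \<longleftrightarrow>
     (\<forall>f. blinfun_apply D f \<in> precision_domain C \<Gamma> \<and> precision_op C \<Gamma> (blinfun_apply D f) = f) \<and>
     (\<forall>u\<in>precision_domain C \<Gamma>. blinfun_apply D (precision_op C \<Gamma> u) = u)"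

section \<open>Gaussian measures\<close>

text \<open>One-dimensional normal laws, where the standard deviation 0 gives a Dirac measure.\<close>

definition normal_law :: "real \<Rightarrow> real \<Rightarrow> real measure" where
  "normal_law a s =
     (if s = 0 then return borel a else density lborel (\<lambda>x. ennreal (normal_density a s x)))"

definition gaussian_measure :: "'h::real_inner measure \<Rightarrow> bool" where
  "gaussian_measure \<nu> \<longleftrightarrow> prob_space \<nu> \<and> sets \<nu> = sets borel \<and>
     (\<forall>h. \<exists>a s. 0 \<le> s \<and> distr \<nu> borel (\<lambda>x. h \<bullet> x) = normal_law a s)"

text \<open>The property that characterises \<open>\<nu>\<close> as \<open>N(m, C)\<close>. The integrands are
  integrable because all one-dimensional marginals are normal.\<close>

definition is_gaussian :: "'h::real_inner measure \<Rightarrow> 'h \<Rightarrow> ('h \<Rightarrow>\<^sub>L 'h) \<Rightarrow> bool" where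
  "is_gaussian \<nu> m C \<longleftrightarrow> gaussian_measure \<nu> \<and>
     (\<forall>h. h \<bullet> m = (\<integral>x. h \<bullet> x \<partial>\<nu>)) \<and>
     (\<forall>h k. h \<bullet> blinfun_apply C k = (\<integral>x. (h \<bullet> (x - m)) * (k \<bullet> (x - m)) \<partial>\<nu>))"

text \<open>The property that characterises \<open>\<nu>\<close> as \<open>N\<^sub>P\<^sub>,\<^sub>0(m, \<Gamma>)\<close>.\<close>

definition is_NP0 ::
    "('h::real_inner \<Rightarrow>\<^sub>L 'h) \<Rightarrow> 'h measure \<Rightarrow> 'h \<Rightarrow> ('h \<Rightarrow> 'h \<Rightarrow> real) \<Rightarrow> bool" where
  "is_NP0 C \<nu> m \<Gamma> \<longleftrightarrow>
     (if precision_strictly_positive C \<Gamma>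
      then \<exists>D. is_precision_inverse C \<Gamma> D \<and> is_gaussian \<nu> m D
      else \<nu> = return borel m)"

section \<open>Weak convergence, relative entropy, the target measure\<close>

definition weakly_converges :: "(nat \<Rightarrow> 'h::topological_space measure) \<Rightarrow> 'h measure \<Rightarrow> bool" where
  "weakly_converges \<nu> \<nu>s \<longleftrightarrow>
     (\<forall>f::'h \<Rightarrow> real. continuous_on UNIV f \<and> bounded (range f) \<longrightarrow>
        (\<lambda>n. \<integral>x. f x \<partial>\<nu> n) \<longlonglongrightarrow> (\<integral>x. f x \<partial>\<nu>s))"

text \<open>For probability measures with \<open>\<nu> \<lless> \<mu>\<close> the negative part of
  \<open>log (d\<nu>/d\<mu>)\<close> is always \<open>\<nu>\<close>-integrable, so a non-integrable log-density means that the
  integral is \<open>\<infinity>\<close>. The library function takes the reference measure first.\<close>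

definition D_KL :: "'a measure \<Rightarrow> 'a measure \<Rightarrow> ereal" where
  "D_KL \<nu> \<mu> =
     (if absolutely_continuous \<mu> \<nu> \<and> integrable \<nu> (entropy_density (exp 1) \<mu> \<nu>)
      then ereal (KL_divergence (exp 1) \<mu> \<nu>) else \<infinity>)"

text \<open>The subspace X is a Banach space type with an injection \<open>\<iota>\<close> into the Hilbert space. The
  function \<open>exp (- \<Phi>)\<close> is extended by 0 from X to the Hilbert space.\<close>

definition exp_neg :: "('x \<Rightarrow> 'h) \<Rightarrow> ('x \<Rightarrow> real) \<Rightarrow> 'h \<Rightarrow> real" where
  "exp_neg \<iota> \<Phi> h = indicator (range \<iota>) h * exp (- \<Phi> (inv \<iota> h))"

end

theory Submission
  imports Defs
begin

text \<open>
  Let g be a bounded continuous function, bounded away from 0, whose Bregman divergence from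
  \<open>d\<nu>\<^sub>\<star>/d\<mu>\<close> for \<open>s \<mapsto> s * ln s\<close> is small. This divergence dominates the squared Hellinger distance, and
  its value at \<open>d\<nu>\<^sub>n/d\<mu>\<close> involves \<open>\<nu>\<^sub>n\<close> only through the relative entropy and the integral of
  \<open>ln g\<close>, both of which converge. Hence the \<open>\<nu>\<^sub>n\<close> are a Cauchy sequence in Hellinger distance, and the
  expectations of a function q under \<open>\<nu>\<^sub>n\<close> and \<open>\<nu>\<^sub>k\<close> differ by at most that distance times the
  \<open>L\<^sup>2\<close> norms of q.

  Write \<open>C\<^sub>n = L R\<^sub>n L\<close> with \<open>L = C\<^sub>0\<^sup>1\<^sup>/\<^sup>2\<close> and \<open>R\<^sub>n = (I + L \<Gamma>\<^sub>n L)\<^sup>-\<^sup>1\<close>. Linear q show that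
  \<open>m\<^sub>n - m\<^sub>k\<close> is small in \<open>H\<^sup>1\<close>. For a quadratic q whose coefficients are those of a compression
  of \<open>R\<^sub>n - R\<^sub>k\<close> the difference of the expectations is the square of the Hilbert--Schmidt norm of the
  compression, while by Isserlis' formula the \<open>L\<^sup>2\<close> norms of q are bounded by a multiple of that
  norm, uniformly in the dimension. So \<open>R\<^sub>n\<close>, and with it the inverse \<open>I + L \<Gamma>\<^sub>n L\<close>, is a
  Cauchy sequence in Hilbert--Schmidt norm, and the limits are the parameters of \<open>\<nu>\<^sub>\<star>\<close>.
\<close>

section \<open>Projections and nonnegative operators in Hilbert space\<close>

text \<open>The estimates by test functions need a common bound M of the norms of
  \<open>R\<^sub>n\<close>. It comes from a single member of the tail: absolute continuity with
  respect to \<mu>0 bounds its covariance by a multiple of \<open>C0\<close>, and a one-dimensional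
  quadratic test function, effective once the squared Hellinger distance is at most 1/100, passes
  the bound on to the other members with a factor 2. The same comparison in the opposite direction
  bounds \<open>R\<^sub>n\<close> from below, hence its inverse \<open>S\<^sub>n\<close> from above,
  so that \<open>S\<^sub>n - S\<^sub>k = S\<^sub>n (R\<^sub>k - R\<^sub>n) S\<^sub>k\<close> carries
  the Hilbert--Schmidt estimate over to the precisions.

  The means are compared before the covariances: a quadratic form centred at one mean has at the
  other mean an extra linear part and a rank-one shift, both controlled by the
  \<open>H\<^sup>1\<close> distance of the means.

  Dirac measures cannot occur in the tail: finite entropy forces absolute continuity, and \<mu>0
  charges no point of a nontrivial space.\<close>

lemma quadratic_nonneg_imp_linear_zero:
  fixes a b :: real
  assumes "\<And>t. 0 \<le> t * a + t\<^sup>2 * b"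
  shows "a = 0"
proof (rule ccontr)
  assume a: "a \<noteq> 0"
  \<comment> \<open>A t of sign opposite to a, small enough for the linear term to win. The
    denominator \<open>\<bar>b\<bar> + 1\<close> covers every sign of b, including b = 0.\<close>
  define t where "t = - a / (\<bar>b\<bar> + 1)"
  have pos: "\<bar>b\<bar> + 1 > 0" by simp
  have "t * a + t\<^sup>2 * b = a\<^sup>2 / (\<bar>b\<bar> + 1)\<^sup>2 * (b - (\<bar>b\<bar> + 1))"
    unfolding t_def using pos by (simp add: power2_eq_square divide_simps) (simp add: algebra_simps)
  moreover have "a\<^sup>2 / (\<bar>b\<bar> + 1)\<^sup>2 > 0" "b - (\<bar>b\<bar> + 1) < 0"
    using a pos by simp_all
  ultimately have "t * a + t\<^sup>2 * b < 0"
    by (metis mult_pos_neg)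
  then show False
    using assms[of t] by simp
qed

text \<open>The parallelogram law in the form that makes a minimizing sequence Cauchy: if u and v
  are almost optimal for x and their midpoint cannot beat the infimum, the right-hand side is
  small.\<close>

lemma parallelogram_midpoint:
  fixes x u v :: "'h::real_inner"
  shows "(norm (u - v))\<^sup>2 =
    2 * (norm (x - u))\<^sup>2 + 2 * (norm (x - v))\<^sup>2 - 4 * (norm (x - (1 / 2) *\<^sub>R (u + v)))\<^sup>2"
  unfolding power2_norm_eq_inner by (simp add: inner_simps algebra_simps inner_commute)

text \<open>Stated for subspaces that may fail to be closed, such as the range of an injective
  operator or a graph; the nearest point is then found in the closure. Orthogonality is the
  vanishing of the first variation of the distance at p.\<close>

lemma hilbert_projection:
  fixes V :: "'h::{real_inner, banach} set"
  assumes V: "subspace V"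
  obtains p where "p \<in> closure V" and "\<And>v. v \<in> V \<Longrightarrow> (x - p) \<bullet> v = 0"
proof -
  define d where "d = (INF v\<in>V. (norm (x - v))\<^sup>2)"
  have V0: "0 \<in> V" using V by (rule subspace_0)
  have bdd: "bdd_below ((\<lambda>v. (norm (x - v))\<^sup>2) ` V)"
    by (rule bdd_belowI[of _ 0]) auto
  have d_le: "d \<le> (norm (x - v))\<^sup>2" if "v \<in> V" for v
    unfolding d_def using bdd that by (rule cINF_lower)
  have "\<exists>v\<in>V. (norm (x - v))\<^sup>2 < d + inverse (real (Suc n))" for n
    using cINF_less_iff[OF _ bdd, of "d + inverse (real (Suc n))"] V0
    unfolding d_def[symmetric] by auto
  then obtain v where v: "\<And>n. v n \<in> V" "\<And>n. (norm (x - v n))\<^sup>2 < d + inverse (real (Suc n))"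
    by metis
  have diff: "(norm (v i - v j))\<^sup>2 \<le> 2 * inverse (real (Suc i)) + 2 * inverse (real (Suc j))" for i j
  proof -
    have "(1 / 2) *\<^sub>R (v i + v j) \<in> V"
      using V v(1) by (intro subspace_scale subspace_add)
    from d_le[OF this] show ?thesis
      using parallelogram_midpoint[of "v i" "v j" x] v(2)[of i] v(2)[of j] by linarith
  qed
  have "Cauchy v"
  proof (rule metric_CauchyI)
    fix e :: real assume e: "e > 0"
    obtain N where N: "inverse (real (Suc N)) < e\<^sup>2 / 4"
      using reals_Archimedean[of "e\<^sup>2 / 4"] e by auto
    have "dist (v i) (v j) < e" if "i \<ge> N" "j \<ge> N" for i j
    proof -
      have "inverse (real (Suc i)) \<le> inverse (real (Suc N))"
        "inverse (real (Suc j)) \<le> inverse (real (Suc N))"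
        using that by (auto intro!: le_imp_inverse_le)
      then have "(norm (v i - v j))\<^sup>2 < e\<^sup>2"
        using diff[of i j] N by linarith
      then show ?thesis
        using e by (simp add: dist_norm power2_less_imp_less)
    qed
    then show "\<exists>M. \<forall>i\<ge>M. \<forall>j\<ge>M. dist (v i) (v j) < e" by blast
  qed
  then obtain p where p: "v \<longlonglongrightarrow> p"
    using convergent_eq_Cauchy by blast
  have "p \<in> closure V"
    using v(1) p closure_sequential by blast
  have norm_p: "(norm (x - p))\<^sup>2 \<le> d"
  proof (rule LIMSEQ_le)
    show "(\<lambda>n. (norm (x - v n))\<^sup>2) \<longlonglongrightarrow> (norm (x - p))\<^sup>2"
      by (intro tendsto_intros p)
    show "(\<lambda>n. d + inverse (real (Suc n))) \<longlonglongrightarrow> d"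
      using tendsto_add[OF tendsto_const[of d] LIMSEQ_inverse_real_of_nat] by simp
    show "\<exists>N. \<forall>n\<ge>N. (norm (x - v n))\<^sup>2 \<le> d + inverse (real (Suc n))"
      using v(2) less_imp_le by blast
  qed
  have "(x - p) \<bullet> w = 0" if w: "w \<in> V" for w
  proof -
    have "0 \<le> t * (- 2 * ((x - p) \<bullet> w)) + t\<^sup>2 * (norm w)\<^sup>2" for t :: real
    proof -
      have "(\<lambda>n. (norm (x - (v n + t *\<^sub>R w)))\<^sup>2) \<longlonglongrightarrow> (norm (x - (p + t *\<^sub>R w)))\<^sup>2"
        by (intro tendsto_intros p)
      moreover have "d \<le> (norm (x - (v n + t *\<^sub>R w)))\<^sup>2" for n
        using V v(1) w by (intro d_le subspace_add subspace_scale)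
      ultimately have "d \<le> (norm (x - (p + t *\<^sub>R w)))\<^sup>2"
        by (intro LIMSEQ_le_const) auto
      also have "\<dots> = (norm (x - p))\<^sup>2 + t * (- 2 * ((x - p) \<bullet> w)) + t\<^sup>2 * (norm w)\<^sup>2"
        unfolding power2_norm_eq_inner
        by (simp add: inner_simps algebra_simps inner_commute power2_eq_square)
      finally show ?thesis using norm_p by linarith
    qed
    from quadratic_nonneg_imp_linear_zero[OF this] show ?thesis by simp
  qed
  with \<open>p \<in> closure V\<close> show thesis by (rule that)
qed

lemma riesz_representation:
  fixes \<phi> :: "'h::{real_inner, banach} \<Rightarrow> real"
  assumes "bounded_linear \<phi>"
  obtains y where "\<And>x. \<phi> x = x \<bullet> y"
proof (cases "\<forall>x. \<phi> x = 0")
  case True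
  then show ?thesis using that[of 0] by simp
next
  case False
  then obtain x where x: "\<phi> x \<noteq> 0" by blast
  interpret bounded_linear \<phi> by fact
  define V where "V = {v. \<phi> v = 0}"
  have "subspace V"
    unfolding V_def subspace_def by (auto simp: add scaleR)
  have "closed V"
    unfolding V_def using continuous_on by (intro closed_Collect_eq) (auto intro: continuous_intros)
  obtain p where p: "p \<in> closure V" "\<And>v. v \<in> V \<Longrightarrow> (x - p) \<bullet> v = 0"
    using hilbert_projection[OF \<open>subspace V\<close>, of x] by blast
  have "\<phi> p = 0"
    using p(1) \<open>closed V\<close> by (simp add: closure_closed V_def)
  define z where "z = x - p"
  have z: "\<phi> z \<noteq> 0"
    using x \<open>\<phi> p = 0\<close> by (simp add: z_def diff)
  then have z0: "z \<noteq> 0" using zero by auto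
  define y where "y = (\<phi> z / (z \<bullet> z)) *\<^sub>R z"
  have "\<phi> u = u \<bullet> y" for u
  proof -
    have "u - (\<phi> u / \<phi> z) *\<^sub>R z \<in> V"
      using z by (simp add: V_def diff scaleR)
    then have "z \<bullet> u = (\<phi> u / \<phi> z) * (z \<bullet> z)"
      using p(2) by (fastforce simp: z_def[symmetric] inner_simps)
    then show ?thesis
      unfolding y_def using z z0 by (simp add: inner_commute)
  qed
  then show ?thesis by (rule that)
qed

lemma self_adjointD: "self_adjoint T \<Longrightarrow> T x \<bullet> y = x \<bullet> T y"
  unfolding self_adjoint_def by blast

lemma nonneg_operator_self_adjoint: "nonneg_operator T \<Longrightarrow> self_adjoint T"
  unfolding nonneg_operator_def by blast

lemma nonneg_operatorD: "nonneg_operator T \<Longrightarrow> 0 \<le> x \<bullet> T x"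
  unfolding nonneg_operator_def by blast

text \<open>The residual x - p is orthogonal to the range. Testing it against
  \<open>T (T (x - p))\<close> and moving one T across gives \<open>T (x - p) = 0\<close>.\<close>

lemma closure_range_self_adjoint:
  fixes T :: "'h::{real_inner, banach} \<Rightarrow>\<^sub>L 'h"
  assumes T: "self_adjoint T" and inj: "\<And>x. T x = 0 \<Longrightarrow> x = 0"
  shows "closure (range T) = UNIV"
proof -
  have "x \<in> closure (range T)" for x
  proof -
    have "subspace (range T)"
      by (intro linear_subspace_image bounded_linear.linear blinfun.bounded_linear_right) auto
    then obtain p where p: "p \<in> closure (range T)"
        "\<And>v. v \<in> range T \<Longrightarrow> (x - p) \<bullet> v = 0"
      using hilbert_projection[of _ x] by blast
    have "T (x - p) \<bullet> T (x - p) = 0"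
      using p(2)[OF rangeI[of _ "T (x - p)"]] self_adjointD[OF T, of "x - p" "T (x - p)"]
      by simp
    then have "x = p" using inj[of "x - p"] by simp
    with p(1) show ?thesis by simp
  qed
  then show ?thesis by blast
qed

lemma nonneg_quadratic_discriminant:
  fixes a b c :: real
  assumes c: "0 \<le> c" and "\<And>t. 0 \<le> a + 2 * t * b + t\<^sup>2 * c"
  shows "b\<^sup>2 \<le> a * c"
proof (cases "c = 0")
  case True
  have "b = 0"
  proof (rule ccontr)
    assume "b \<noteq> 0"
    then show False
      \<comment> \<open>For c = 0 the expression is affine in t; at this t it takes the value
        -1.\<close>
      using assms(2)[of "- (a + 1) / (2 * b)"] assms(2)[of 0] True by (simp add: field_simps)
  qed
  then show ?thesis using True by simp
next
  case False
  with c have pos: "c > 0" by simp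
  have "0 \<le> a - b\<^sup>2 / c"
    using assms(2)[of "- b / c"] pos by (simp add: power2_eq_square divide_simps)
  then show ?thesis using pos by (simp add: divide_simps)
qed

lemma psd_Cauchy_Schwarz:
  fixes B :: "'v::real_vector \<Rightarrow> 'v \<Rightarrow> real"
  assumes add: "\<And>x y z. B (x + y) z = B x z + B y z"
    and scale: "\<And>a x z. B (a *\<^sub>R x) z = a * B x z"
    and sym: "\<And>x y. B x y = B y x" and nonneg: "\<And>x. 0 \<le> B x x"
  shows "(B x y)\<^sup>2 \<le> B x x * B y y"
proof (rule nonneg_quadratic_discriminant)
  show "0 \<le> B y y" by (rule nonneg)
  fix t
  have add2: "B z (x + y) = B z x + B z y" for x y z
    using add sym by metis
  have scale2: "B z (a *\<^sub>R x) = a * B z x" for a x z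
    using scale sym by metis
  show "0 \<le> B x x + 2 * t * B x y + t\<^sup>2 * B y y"
    using nonneg[of "x + t *\<^sub>R y"] sym[of y x]
    by (simp add: add scale add2 scale2 power2_eq_square algebra_simps)
qed

lemma nonneg_operator_Cauchy_Schwarz:
  assumes "nonneg_operator T"
  shows "(x \<bullet> T y)\<^sup>2 \<le> (x \<bullet> T x) * (y \<bullet> T y)"
proof (rule psd_Cauchy_Schwarz[where B = "\<lambda>x y. x \<bullet> T y"])
  show "x \<bullet> T y = y \<bullet> T x" for x y
    using assms self_adjointD nonneg_operator_self_adjoint by (metis inner_commute)
qed (use assms in \<open>auto simp: inner_simps nonneg_operatorD\<close>)

lemma nonneg_operator_form_zero:
  assumes "nonneg_operator T" "x \<bullet> T x = 0"
  shows "T x = 0"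
  using nonneg_operator_Cauchy_Schwarz[OF assms(1), of "T x" x] assms(2) by simp

lemma inner_eq_imp_eq:
  fixes a b :: "'h::real_inner"
  assumes "\<And>x. x \<bullet> a = x \<bullet> b"
  shows "a = b"
  using assms[of "a - b"] by (metis inner_diff_right inner_eq_zero_iff right_minus_eq)

lemma dense_inner_eq:
  fixes a b :: "'h::real_inner"
  assumes "closure D = UNIV" and "\<And>v. v \<in> D \<Longrightarrow> a \<bullet> v = b \<bullet> v"
  shows "a = b"
proof (rule inner_eq_imp_eq)
  fix x
  obtain u where u: "\<And>n. u n \<in> D" "u \<longlonglongrightarrow> x"
    using assms(1) closure_sequential[of x D] by auto
  have "(\<lambda>n. u n \<bullet> a) \<longlonglongrightarrow> x \<bullet> a" "(\<lambda>n. u n \<bullet> b) \<longlonglongrightarrow> x \<bullet> b"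
    by (intro tendsto_intros u(2))+
  moreover have "u n \<bullet> a = u n \<bullet> b" for n
    using assms(2)[OF u(1)] by (simp add: inner_commute)
  ultimately show "x \<bullet> a = x \<bullet> b"
    using LIMSEQ_unique by fastforce
qed

section \<open>The square root of a nonnegative operator\<close>

text \<open>A fixed point Y of this iteration satisfies (I - Y)^2 = I - B, so I - Y is a square root
  of I - B.\<close>

primrec sqrt_iter :: "('h::real_inner \<Rightarrow>\<^sub>L 'h) \<Rightarrow> nat \<Rightarrow> ('h \<Rightarrow>\<^sub>L 'h)" where
  "sqrt_iter B 0 = 0"
| "sqrt_iter B (Suc n) = (1 / 2) *\<^sub>R (B + (sqrt_iter B n o\<^sub>L sqrt_iter B n))"

text \<open>The iteration for the number 1 in place of B. It is the norm majorant of the operator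
  iteration when \<open>norm B \<le> 1\<close>, both for the iterates and for their
  increments.\<close>

primrec scalar_sqrt_iter :: "nat \<Rightarrow> real" where
  "scalar_sqrt_iter 0 = 0"
| "scalar_sqrt_iter (Suc n) = (1 + (scalar_sqrt_iter n)\<^sup>2) / 2"

lemma scalar_sqrt_iter_bounds: "0 \<le> scalar_sqrt_iter n \<and> scalar_sqrt_iter n \<le> 1"
proof (induction n)
  case (Suc n)
  then have "(scalar_sqrt_iter n)\<^sup>2 \<le> 1" by (simp add: power_le_one)
  then show ?case by simp
qed simp

lemma scalar_sqrt_iter_mono: "scalar_sqrt_iter n \<le> scalar_sqrt_iter (Suc n)"
  using zero_le_power2[of "scalar_sqrt_iter n - 1"] by (simp add: power2_eq_square algebra_simps)

lemmas blinfun_compose_simps =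
  bounded_bilinear.add_left[OF bounded_bilinear_blinfun_compose]
  bounded_bilinear.add_right[OF bounded_bilinear_blinfun_compose]
  bounded_bilinear.diff_left[OF bounded_bilinear_blinfun_compose]
  bounded_bilinear.diff_right[OF bounded_bilinear_blinfun_compose]
  bounded_bilinear.scaleR_left[OF bounded_bilinear_blinfun_compose]
  bounded_bilinear.scaleR_right[OF bounded_bilinear_blinfun_compose]

lemma blinfun_compose_assoc_apply: "(a o\<^sub>L b) o\<^sub>L c = a o\<^sub>L (b o\<^sub>L c)"
  by (rule blinfun_eqI) simp

text \<open>Applied to the iterates themselves, which then commute with each other, and to an
  arbitrary T, in order to carry its commutation with A over to the limit.\<close>

lemma sqrt_iter_commute:
  assumes "T o\<^sub>L B = B o\<^sub>L T"
  shows "T o\<^sub>L sqrt_iter B n = sqrt_iter B n o\<^sub>L T"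
proof (induction n)
  case (Suc n)
  have "T o\<^sub>L (sqrt_iter B n o\<^sub>L sqrt_iter B n) = (T o\<^sub>L sqrt_iter B n) o\<^sub>L sqrt_iter B n"
    by (simp add: blinfun_compose_assoc_apply)
  also have "\<dots> = sqrt_iter B n o\<^sub>L (T o\<^sub>L sqrt_iter B n)"
    by (simp add: Suc blinfun_compose_assoc_apply)
  also have "\<dots> = (sqrt_iter B n o\<^sub>L sqrt_iter B n) o\<^sub>L T"
    by (simp add: Suc blinfun_compose_assoc_apply)
  finally show ?case using assms
    by (simp add: blinfun_compose_simps blinfun_compose_assoc_apply)
qed simp

lemma sqrt_iter_self_adjoint:
  assumes "self_adjoint B"
  shows "self_adjoint (sqrt_iter B n)"
proof (induction n)
  case 0
  then show ?case by (simp add: self_adjoint_def)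
next
  case (Suc n)
  show ?case
    using self_adjointD[OF assms] self_adjointD[OF Suc]
    by (simp add: self_adjoint_def blinfun.bilinear_simps inner_simps)
qed

lemma sqrt_iter_norm:
  assumes "norm B \<le> 1"
  shows "norm (sqrt_iter B n) \<le> scalar_sqrt_iter n"
proof (induction n)
  case (Suc n)
  have "norm (sqrt_iter B n o\<^sub>L sqrt_iter B n) \<le> norm (sqrt_iter B n) * norm (sqrt_iter B n)"
    by (rule norm_blinfun_compose)
  also have "\<dots> \<le> scalar_sqrt_iter n * scalar_sqrt_iter n"
    using Suc scalar_sqrt_iter_bounds[of n] by (intro mult_mono) auto
  finally have "norm (B + (sqrt_iter B n o\<^sub>L sqrt_iter B n)) \<le> 1 + (scalar_sqrt_iter n)\<^sup>2"
    using assms norm_triangle_ineq[of B "sqrt_iter B n o\<^sub>L sqrt_iter B n"]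
    by (simp add: power2_eq_square)
  then show ?case by simp
qed simp

text \<open>The iterates of the operator are polynomials in B, hence commute, and the increments
  factor as in the scalar case.\<close>

lemma sqrt_iter_increment:
  assumes "norm B \<le> 1"
  shows "norm (sqrt_iter B (Suc n) - sqrt_iter B n) \<le> scalar_sqrt_iter (Suc n) - scalar_sqrt_iter n"
proof (induction n)
  case 0
  then show ?case using assms by simp
next
  case (Suc n)
  let ?Y = "sqrt_iter B" and ?y = "scalar_sqrt_iter"
  have comm: "?Y (Suc n) o\<^sub>L ?Y n = ?Y n o\<^sub>L ?Y (Suc n)"
    by (intro sqrt_iter_commute sqrt_iter_commute[symmetric] refl)
  have "?Y (Suc (Suc n)) - ?Y (Suc n)
      = (1 / 2) *\<^sub>R ((?Y (Suc n) o\<^sub>L ?Y (Suc n)) - (?Y n o\<^sub>L ?Y n))"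
    unfolding sqrt_iter.simps(2)[of B "Suc n"] by (simp add: scaleR_diff_right scaleR_add_right)
  also have "(?Y (Suc n) o\<^sub>L ?Y (Suc n)) - (?Y n o\<^sub>L ?Y n)
      = (?Y (Suc n) - ?Y n) o\<^sub>L (?Y (Suc n) + ?Y n)"
    using comm by (simp add: blinfun_compose_simps algebra_simps del: sqrt_iter.simps)
  finally have "norm (?Y (Suc (Suc n)) - ?Y (Suc n))
      \<le> (1 / 2) * (norm (?Y (Suc n) - ?Y n) * norm (?Y (Suc n) + ?Y n))"
    using norm_blinfun_compose[of "?Y (Suc n) - ?Y n" "?Y (Suc n) + ?Y n"]
    by (simp del: sqrt_iter.simps)
  also have "\<dots> \<le> (1 / 2) * ((?y (Suc n) - ?y n) * (?y (Suc n) + ?y n))"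
  proof (intro mult_left_mono mult_mono Suc.IH)
    show "norm (?Y (Suc n) + ?Y n) \<le> ?y (Suc n) + ?y n"
      using sqrt_iter_norm[OF assms] by (intro norm_triangle_mono)
    show "0 \<le> ?y (Suc n) - ?y n"
      using scalar_sqrt_iter_mono[of n] by simp
  qed auto
  also have "\<dots> = ?y (Suc (Suc n)) - ?y (Suc n)"
    unfolding scalar_sqrt_iter.simps(2)[of "Suc n"] scalar_sqrt_iter.simps(2)[of n]
    by (simp add: power2_eq_square field_simps)
  finally show ?case .
qed

lemma sqrt_iter_diff:
  assumes "norm B \<le> 1"
  shows "norm (sqrt_iter B (n + k) - sqrt_iter B n) \<le> scalar_sqrt_iter (n + k) - scalar_sqrt_iter n"
proof (induction k)
  case (Suc k)
  have "norm (sqrt_iter B (n + Suc k) - sqrt_iter B n)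
      \<le> norm (sqrt_iter B (Suc (n + k)) - sqrt_iter B (n + k)) + norm (sqrt_iter B (n + k) - sqrt_iter B n)"
    using norm_triangle_ineq[of "sqrt_iter B (Suc (n + k)) - sqrt_iter B (n + k)"
        "sqrt_iter B (n + k) - sqrt_iter B n"]
    by (simp del: sqrt_iter.simps)
  then show ?case
    using Suc sqrt_iter_increment[OF assms, of "n + k"]
    by (simp del: sqrt_iter.simps scalar_sqrt_iter.simps)
qed simp

lemma sqrt_iter_convergent:
  fixes B :: "'h::{real_inner, banach} \<Rightarrow>\<^sub>L 'h"
  assumes "norm B \<le> 1"
  shows "convergent (sqrt_iter B)"
proof -
  have "convergent scalar_sqrt_iter"
  proof (rule Bseq_mono_convergent)
    show "Bseq scalar_sqrt_iter"
      using scalar_sqrt_iter_bounds by (intro BseqI'[of _ 1]) auto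
    show "\<forall>m n. m \<le> n \<longrightarrow> scalar_sqrt_iter m \<le> scalar_sqrt_iter n"
      using lift_Suc_mono_le[of scalar_sqrt_iter, OF scalar_sqrt_iter_mono] by blast
  qed
  then have C: "Cauchy scalar_sqrt_iter" by (rule convergent_Cauchy)
  have "Cauchy (sqrt_iter B)"
  proof (rule CauchyI')
    fix e :: real assume "e > 0"
    then obtain M where M: "\<And>i j. i \<ge> M \<Longrightarrow> j \<ge> M \<Longrightarrow> norm (scalar_sqrt_iter i - scalar_sqrt_iter j) < e"
      using C Cauchy_iff by metis
    have "norm (sqrt_iter B i - sqrt_iter B j) < e" if "i \<ge> M" "j > i" for i j
    proof -
      obtain k where k: "j = i + k" using \<open>j > i\<close> less_imp_add_positive by blast
      have "norm (sqrt_iter B i - sqrt_iter B j) \<le> scalar_sqrt_iter j - scalar_sqrt_iter i"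
        using sqrt_iter_diff[OF assms, of i k] by (simp add: k norm_minus_commute)
      also have "\<dots> < e" using M[of j i] that by auto
      finally show ?thesis .
    qed
    then show "\<exists>M. \<forall>m\<ge>M. \<forall>n>m. dist (sqrt_iter B m) (sqrt_iter B n) < e" unfolding dist_norm by blast
  qed
  then show ?thesis by (simp add: Cauchy_convergent_iff)
qed

lemma self_adjoint_limit:
  assumes "\<And>n. self_adjoint (T n)" "T \<longlonglongrightarrow> T'"
  shows "self_adjoint T'"
  unfolding self_adjoint_def
proof (intro allI)
  fix x y
  have "(\<lambda>n. (T n) x \<bullet> y) \<longlonglongrightarrow> T' x \<bullet> y"
    "(\<lambda>n. x \<bullet> (T n) y) \<longlonglongrightarrow> x \<bullet> T' y"
    by (intro tendsto_intros assms)+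
  moreover have "(T n) x \<bullet> y = x \<bullet> (T n) y" for n
    using assms(1) self_adjointD by blast
  ultimately show "T' x \<bullet> y = x \<bullet> T' y"
    using LIMSEQ_unique by fastforce
qed

text \<open>With B = I - A the iteration converges to some Y, and S = I - Y. The commutation
  property in the third conclusion is what makes the root unique later on.\<close>

lemma nonneg_contraction_sqrt_exists:
  fixes A :: "'h::{real_inner, banach} \<Rightarrow>\<^sub>L 'h"
  assumes A: "nonneg_operator A" and le: "norm A \<le> 1"
  obtains S where "nonneg_operator S" "S o\<^sub>L S = A"
    "\<And>T. T o\<^sub>L A = A o\<^sub>L T \<Longrightarrow> T o\<^sub>L S = S o\<^sub>L T"
proof -
  define B where "B = id_blinfun - A"
  have saA: "self_adjoint A" using A by (rule nonneg_operator_self_adjoint)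
  have saB: "self_adjoint B"
    using saA by (auto simp: B_def self_adjoint_def blinfun.bilinear_simps inner_simps)
  have formA: "x \<bullet> A x \<le> (norm x)\<^sup>2" for x
  proof -
    have "x \<bullet> A x \<le> norm x * (norm A * norm x)"
      by (meson norm_cauchy_schwarz norm_blinfun order_trans mult_left_mono norm_ge_zero)
    also have "\<dots> \<le> (norm x)\<^sup>2"
      using le by (simp add: power2_eq_square mult_left_le_one_le mult_left_mono)
    finally show ?thesis .
  qed
  have nnB: "nonneg_operator B"
    using saB formA by (auto simp: nonneg_operator_def B_def blinfun.bilinear_simps inner_simps power2_norm_eq_inner)
  \<comment> \<open>As forms, 0 \<le> B \<le> I. Cauchy--Schwarz for the form of B at the pair
    \<open>B x\<close>, x turns this into a bound of the norm.\<close>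
  have "norm (B x) \<le> 1 * norm x" for x
  proof -
    have le1: "z \<bullet> B z \<le> (norm z)\<^sup>2" for z
      using nonneg_operatorD[OF A, of z] by (simp add: B_def blinfun.bilinear_simps inner_simps power2_norm_eq_inner)
    let ?y = "B x"
    have "((norm ?y)\<^sup>2)\<^sup>2 \<le> (?y \<bullet> B ?y) * (x \<bullet> B x)"
      using nonneg_operator_Cauchy_Schwarz[OF nnB, of ?y x] by (simp add: power2_norm_eq_inner)
    also have "\<dots> \<le> (norm ?y)\<^sup>2 * (norm x)\<^sup>2"
      using le1 nonneg_operatorD[OF nnB] by (intro mult_mono) auto
    finally have "(norm ?y)\<^sup>2 * (norm ?y)\<^sup>2 \<le> (norm ?y)\<^sup>2 * (norm x)\<^sup>2"
      by (simp add: power2_eq_square)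
    then have "(norm ?y)\<^sup>2 \<le> (norm x)\<^sup>2 \<or> ?y = 0"
      by (metis mult_le_cancel_left_pos norm_eq_zero zero_less_power2)
    then show ?thesis by (auto intro: power2_le_imp_le)
  qed
  then have nB: "norm B \<le> 1" by (intro norm_blinfun_bound) auto
  obtain Y where Y: "sqrt_iter B \<longlonglongrightarrow> Y"
    using sqrt_iter_convergent[OF nB] by (auto simp: convergent_def)
  note [tendsto_intros] = bounded_bilinear.tendsto[OF bounded_bilinear_blinfun_compose]
  have "(\<lambda>n. sqrt_iter B (Suc n)) \<longlonglongrightarrow> (1 / 2) *\<^sub>R (B + (Y o\<^sub>L Y))"
    unfolding sqrt_iter.simps by (intro tendsto_intros Y)
  then have fix_Y: "Y = (1 / 2) *\<^sub>R (B + (Y o\<^sub>L Y))"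
    using LIMSEQ_Suc[OF Y] LIMSEQ_unique by blast
  have normY: "norm Y \<le> 1"
  proof (rule LIMSEQ_le_const2[OF tendsto_norm[OF Y]])
    show "\<exists>N. \<forall>n\<ge>N. norm (sqrt_iter B n) \<le> 1"
      using sqrt_iter_norm[OF nB] scalar_sqrt_iter_bounds order_trans by blast
  qed
  have saY: "self_adjoint Y"
    by (rule self_adjoint_limit[OF sqrt_iter_self_adjoint[OF saB] Y])
  define S where "S = id_blinfun - Y"
  have "x \<bullet> Y x \<le> x \<bullet> x" for x
  proof -
    have "x \<bullet> Y x \<le> norm x * (norm Y * norm x)"
      by (meson norm_cauchy_schwarz norm_blinfun order_trans mult_left_mono norm_ge_zero)
    also have "\<dots> \<le> x \<bullet> x"
      using normY by (simp add: power2_eq_square mult_left_le_one_le mult_left_mono flip: power2_norm_eq_inner)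
    finally show ?thesis .
  qed
  then have "nonneg_operator S"
    using saY by (auto simp: nonneg_operator_def self_adjoint_def S_def blinfun.bilinear_simps inner_simps)
  moreover have "S o\<^sub>L S = A"
  proof (rule blinfun_eqI)
    fix x
    have "2 *\<^sub>R Y x = B x + Y (Y x)"
      by (subst fix_Y) (simp add: blinfun.bilinear_simps)
    then show "(S o\<^sub>L S) x = A x"
      by (simp add: S_def B_def blinfun.bilinear_simps scaleR_2 algebra_simps)
  qed
  moreover have "T o\<^sub>L S = S o\<^sub>L T" if "T o\<^sub>L A = A o\<^sub>L T" for T
  proof -
    have id: "T o\<^sub>L id_blinfun = id_blinfun o\<^sub>L T" by (rule blinfun_eqI) simp
    have "T o\<^sub>L B = B o\<^sub>L T"
      using that id by (simp add: B_def blinfun_compose_simps)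
    then have "T o\<^sub>L sqrt_iter B n = sqrt_iter B n o\<^sub>L T" for n
      by (rule sqrt_iter_commute)
    moreover have "(\<lambda>n. T o\<^sub>L sqrt_iter B n) \<longlonglongrightarrow> (T o\<^sub>L Y)" "(\<lambda>n. sqrt_iter B n o\<^sub>L T) \<longlonglongrightarrow> (Y o\<^sub>L T)"
      by (intro tendsto_intros Y)+
    ultimately have "T o\<^sub>L Y = Y o\<^sub>L T" using LIMSEQ_unique by fastforce
    then show ?thesis using id by (simp add: S_def blinfun_compose_simps)
  qed
  ultimately show ?thesis by (rule that)
qed

lemma nonneg_operator_scaleR:
  "nonneg_operator T \<Longrightarrow> 0 \<le> c \<Longrightarrow> nonneg_operator (c *\<^sub>R T)"
  by (auto simp: nonneg_operator_def self_adjoint_def blinfun.bilinear_simps)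

lemma nonneg_sqrt_exists:
  fixes A :: "'h::{real_inner, banach} \<Rightarrow>\<^sub>L 'h"
  assumes A: "nonneg_operator A"
  obtains S where "nonneg_operator S" "S o\<^sub>L S = A"
    "\<And>T. T o\<^sub>L A = A o\<^sub>L T \<Longrightarrow> T o\<^sub>L S = S o\<^sub>L T"
proof -
  define c where "c = norm A + 1"
  have c: "c > 0" by (simp add: c_def add_nonneg_pos)
  have "nonneg_operator ((1 / c) *\<^sub>R A)"
    using A c by (intro nonneg_operator_scaleR) auto
  moreover have "norm ((1 / c) *\<^sub>R A) \<le> 1"
    using c by (simp add: c_def)
  ultimately obtain S where S: "nonneg_operator S" "S o\<^sub>L S = (1 / c) *\<^sub>R A"
    "\<And>T. T o\<^sub>L ((1 / c) *\<^sub>R A) = ((1 / c) *\<^sub>R A) o\<^sub>L T \<Longrightarrow> T o\<^sub>L S = S o\<^sub>L T"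
    by (rule nonneg_contraction_sqrt_exists) blast
  show ?thesis
  proof (rule that[of "sqrt c *\<^sub>R S"])
    show "nonneg_operator (sqrt c *\<^sub>R S)"
      using S(1) c by (intro nonneg_operator_scaleR) auto
    show "(sqrt c *\<^sub>R S) o\<^sub>L (sqrt c *\<^sub>R S) = A"
      using S(2) c by (simp add: blinfun_compose_simps)
    show "T o\<^sub>L sqrt c *\<^sub>R S = sqrt c *\<^sub>R S o\<^sub>L T" if "T o\<^sub>L A = A o\<^sub>L T" for T
      using S(3)[of T] that by (simp add: blinfun_compose_simps)
  qed
qed

text \<open>By commutation (S + T)(S - T) = 0. At y = (S - T) x the two nonnegative forms therefore
  add up to 0, so S y = T y = 0. Hence (S - T)^2 x = 0, and self-adjointness gives (S - T) x =
  0.\<close>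

lemma nonneg_sqrt_unique:
  fixes S T :: "'h::{real_inner, banach} \<Rightarrow>\<^sub>L 'h"
  assumes S: "nonneg_operator S" and T: "nonneg_operator T"
    and eq: "S o\<^sub>L S = T o\<^sub>L T" and comm: "T o\<^sub>L S = S o\<^sub>L T"
  shows "S = T"
proof -
  define D where "D = S - T"
  have saD: "self_adjoint D"
    using S T by (auto simp: D_def self_adjoint_def nonneg_operator_def blinfun.bilinear_simps inner_simps)
  have "D x = 0" for x
  proof -
    let ?y = "D x"
    have "(S + T) o\<^sub>L D = 0"
      using eq comm by (simp add: D_def blinfun_compose_simps)
    then have "(S + T) ?y = 0"
      by (metis blinfun_apply_blinfun_compose zero_blinfun.rep_eq)
    then have "?y \<bullet> S ?y + ?y \<bullet> T ?y = 0"
      by (metis inner_add_right inner_zero_right plus_blinfun.rep_eq)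
    then have "?y \<bullet> S ?y = 0" "?y \<bullet> T ?y = 0"
      using nonneg_operatorD[OF S, of ?y] nonneg_operatorD[OF T, of ?y] by linarith+
    then have "D ?y = 0"
      using nonneg_operator_form_zero[OF S, of ?y] nonneg_operator_form_zero[OF T, of ?y]
      unfolding D_def minus_blinfun.rep_eq by simp
    then have "?y \<bullet> ?y = 0"
      using self_adjointD[OF saD, of ?y x] by simp
    then show ?thesis by simp
  qed
  then show ?thesis
    by (intro blinfun_eqI) (simp add: D_def blinfun.bilinear_simps)
qed

lemma op_sqrt_props:
  fixes C :: "'h::{real_inner, banach} \<Rightarrow>\<^sub>L 'h"
  assumes C: "nonneg_operator C"
  shows "nonneg_operator (op_sqrt C)" "op_sqrt C o\<^sub>L op_sqrt C = C"
proof -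
  obtain S where S: "nonneg_operator S" "S o\<^sub>L S = C"
    "\<And>T. T o\<^sub>L C = C o\<^sub>L T \<Longrightarrow> T o\<^sub>L S = S o\<^sub>L T"
    using nonneg_sqrt_exists[OF C] by blast
  have "nonneg_operator (op_sqrt C) \<and> op_sqrt C o\<^sub>L op_sqrt C = C"
    unfolding op_sqrt_def
  proof (rule theI[where a = S])
    show "nonneg_operator S \<and> S o\<^sub>L S = C" using S by blast
    fix T assume T: "nonneg_operator T \<and> T o\<^sub>L T = C"
    \<comment> \<open>Any root T commutes with its own square C, hence with the root S constructed
      above.\<close>
    then have "T o\<^sub>L C = C o\<^sub>L T"
      using blinfun_compose_assoc_apply[of T T T] by simp
    then have "T o\<^sub>L S = S o\<^sub>L T" by (rule S(3))
    then show "T = S"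
      using nonneg_sqrt_unique[of S T] S T by metis
  qed
  then show "nonneg_operator (op_sqrt C)" "op_sqrt C o\<^sub>L op_sqrt C = C" by auto
qed

section \<open>Gaussian measures\<close>

text \<open>As an image of the standard normal law, the Dirac case s = 0 needs no separate treatment
  in moments and limits.\<close>

lemma normal_law_eq_distr:
  assumes "0 \<le> s"
  shows "normal_law a s = distr std_normal_distribution borel (\<lambda>y. a + s * y)"
proof (cases "s = 0")
  case True
  interpret real_distribution std_normal_distribution by (rule real_dist_normal_dist)
  have "distr std_normal_distribution borel (\<lambda>y. a) = return borel a"
  proof (rule measure_eqI)
    fix A :: "real set" assume "A \<in> sets (distr std_normal_distribution borel (\<lambda>y. a))"
    then show "emeasure (distr std_normal_distribution borel (\<lambda>y. a)) A = emeasure (return borel a) A"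
      using emeasure_space_1 by (auto simp: emeasure_distr split: split_indicator)
  qed simp
  then show ?thesis using True by (simp add: normal_law_def)
next
  case False
  interpret real_distribution std_normal_distribution by (rule real_dist_normal_dist)
  have "distributed std_normal_distribution lborel (\<lambda>x. x) std_normal_density"
    by (auto simp: distributed_def distr_id2)
  then have "distributed std_normal_distribution lborel (\<lambda>y. a + s * y) (normal_density (a + s * 0) (\<bar>s\<bar> * 1))"
    by (rule normal_density_affine) (use False in auto)
  then have "distr std_normal_distribution lborel (\<lambda>y. a + s * y) = density lborel (\<lambda>x. ennreal (normal_density a s x))"
    using assms by (simp add: distributed_def)
  moreover have "distr std_normal_distribution lborel (\<lambda>y. a + s * y) = distr std_normal_distribution borel (\<lambda>y. a + s * y)"
    by (rule distr_cong) auto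
  ultimately show ?thesis using False by (simp add: normal_law_def)
qed

lemma std_normal_moment_values:
  "(LINT y|std_normal_distribution. y) = 0" "(LINT y|std_normal_distribution. y^2) = 1"
  "(LINT y|std_normal_distribution. y^3) = 0" "(LINT y|std_normal_distribution. y^4) = 3"
  using integral_std_normal_distribution_moment_odd[of 1, simplified]
    integral_std_normal_distribution_moment_odd[of 3, simplified]
    std_normal_distribution_even_moments(1)[of 1] std_normal_distribution_even_moments(1)[of 2]
  by (simp_all add: fact_numeral)

section \<open>Marginals and moments up to order four\<close>

lemma inner_measurable_of_sets:
  assumes "sets \<nu> = sets (borel :: 'h::real_inner measure)"
  shows "(\<lambda>x. h \<bullet> x) \<in> borel_measurable \<nu>" "(\<lambda>x. h \<bullet> (x - m)) \<in> borel_measurable \<nu>"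
proof -
  have "(\<lambda>x. h \<bullet> x) \<in> borel_measurable borel" "(\<lambda>x. h \<bullet> (x - m)) \<in> borel_measurable borel"
    by (intro borel_measurable_continuous_onI continuous_intros)+
  then show "(\<lambda>x. h \<bullet> x) \<in> borel_measurable \<nu>" "(\<lambda>x. h \<bullet> (x - m)) \<in> borel_measurable \<nu>"
    using measurable_cong_sets[OF assms refl] by blast+
qed

lemma is_gaussianD:
  assumes "is_gaussian \<nu> m C"
  shows "prob_space \<nu>" "sets \<nu> = sets borel" "h \<bullet> m = (\<integral>x. h \<bullet> x \<partial>\<nu>)"
    "h \<bullet> C k = (\<integral>x. (h \<bullet> (x - m)) * (k \<bullet> (x - m)) \<partial>\<nu>)"
  using assms unfolding is_gaussian_def gaussian_measure_def by auto

text \<open>The definition of a Gaussian measure only asserts that some parameters a and s of the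
  marginal exist. The first two moments identify them with \<open>h \<bullet> m\<close> and
  \<open>sqrt (h \<bullet> C h)\<close>.\<close>

lemma gaussian_marginal:
  assumes G: "is_gaussian \<nu> m C"
  shows "0 \<le> h \<bullet> C h"
    and "distr \<nu> borel (\<lambda>x. h \<bullet> x) =
      distr std_normal_distribution borel (\<lambda>y. h \<bullet> m + sqrt (h \<bullet> C h) * y)"
proof -
  note sets = is_gaussianD(2)[OF G]
  note [measurable] = inner_measurable_of_sets[OF sets]
  interpret S: real_distribution std_normal_distribution by (rule real_dist_normal_dist)
  obtain a s where s: "0 \<le> s" and eq: "distr \<nu> borel (\<lambda>x. h \<bullet> x) = normal_law a s"
    using G unfolding is_gaussian_def gaussian_measure_def by blast
  then have eq: "distr \<nu> borel (\<lambda>x. h \<bullet> x) = distr std_normal_distribution borel (\<lambda>y. a + s * y)"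
    by (simp add: normal_law_eq_distr)
  have int: "(\<integral>x. F (h \<bullet> x) \<partial>\<nu>) = (\<integral>y. F (a + s * y) \<partial>std_normal_distribution)"
    if [measurable]: "F \<in> borel_measurable borel" for F :: "real \<Rightarrow> real"
    using arg_cong[OF eq, of "\<lambda>M. integral\<^sup>L M F"] by (simp add: integral_distr)
  have i1: "integrable std_normal_distribution (\<lambda>y. y)" and i2: "integrable std_normal_distribution (\<lambda>y. y^2)"
    using integrable_std_normal_distribution_moment[of 1] integrable_std_normal_distribution_moment[of 2] by simp_all
  have "h \<bullet> m = (\<integral>y. a + s * y \<partial>std_normal_distribution)"
    using is_gaussianD(3)[OF G, of h] int[of "\<lambda>x. x"] by simp
  also have "\<dots> = a"
    using i1 S.prob_space by (simp add: std_normal_moment_values)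
  finally have a: "a = h \<bullet> m" by simp
  have "h \<bullet> C h = (\<integral>x. (h \<bullet> x - a)\<^sup>2 \<partial>\<nu>)"
    using is_gaussianD(4)[OF G, of h h] by (simp add: a inner_simps power2_eq_square)
  also have "\<dots> = (\<integral>y. s\<^sup>2 * y\<^sup>2 \<partial>std_normal_distribution)"
    by (subst int) (auto simp: power_mult_distrib)
  also have "\<dots> = s\<^sup>2"
    using i2 by (simp add: std_normal_moment_values)
  finally have C: "h \<bullet> C h = s\<^sup>2" .
  then show "0 \<le> h \<bullet> C h" by simp
  show "distr \<nu> borel (\<lambda>x. h \<bullet> x) =
      distr std_normal_distribution borel (\<lambda>y. h \<bullet> m + sqrt (h \<bullet> C h) * y)"
    using eq s by (simp add: a C)
qed

lemma gaussian_integral_marginal: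
  fixes F :: "real \<Rightarrow> real"
  assumes G: "is_gaussian \<nu> m C" and F: "F \<in> borel_measurable borel"
  shows "(\<integral>x. F (h \<bullet> x) \<partial>\<nu>) =
    (\<integral>y. F (h \<bullet> m + sqrt (h \<bullet> C h) * y) \<partial>std_normal_distribution)"
proof -
  note [measurable] = inner_measurable_of_sets[OF is_gaussianD(2)[OF G]] F
  show ?thesis
    using arg_cong[OF gaussian_marginal(2)[OF G, of h], of "\<lambda>M. integral\<^sup>L M F"]
    by (simp add: integral_distr)
qed

lemma gaussian_power_moment:
  assumes G: "is_gaussian \<nu> m C"
  shows "has_bochner_integral \<nu> (\<lambda>x. (h \<bullet> (x - m))^k)
    (sqrt (h \<bullet> C h)^k * (LINT y|std_normal_distribution. y^k))"
proof -
  note [measurable] = inner_measurable_of_sets[OF is_gaussianD(2)[OF G]]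
  let ?s = "sqrt (h \<bullet> C h)"
  have eq: "(h \<bullet> (x - m))^k = (h \<bullet> x - h \<bullet> m)^k" for x by (simp add: inner_simps)
  have "integrable std_normal_distribution (\<lambda>y. ?s^k * y^k)"
    by (intro integrable_mult_right integrable_std_normal_distribution_moment)
  then have "integrable (distr std_normal_distribution borel (\<lambda>y. h \<bullet> m + ?s * y)) (\<lambda>x. (x - h \<bullet> m)^k)"
    by (subst integrable_distr_eq) (auto simp: power_mult_distrib)
  then have "integrable (distr \<nu> borel (\<lambda>x. h \<bullet> x)) (\<lambda>x. (x - h \<bullet> m)^k)"
    by (simp add: gaussian_marginal(2)[OF G])
  then have "integrable \<nu> (\<lambda>x. (h \<bullet> x - h \<bullet> m)^k)"
    by (subst (asm) integrable_distr_eq) auto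
  moreover have "(\<integral>x. (h \<bullet> x - h \<bullet> m)^k \<partial>\<nu>) = ?s^k * (LINT y|std_normal_distribution. y^k)"
    by (subst gaussian_integral_marginal[OF G]) (auto simp: power_mult_distrib)
  ultimately show ?thesis by (simp add: has_bochner_integral_iff eq)
qed

lemma gaussian_moments:
  assumes G: "is_gaussian \<nu> m C"
  shows "has_bochner_integral \<nu> (\<lambda>x. h \<bullet> (x - m)) 0"
    "has_bochner_integral \<nu> (\<lambda>x. (h \<bullet> (x - m))\<^sup>2) (h \<bullet> C h)"
    "has_bochner_integral \<nu> (\<lambda>x. (h \<bullet> (x - m))^3) 0"
    "has_bochner_integral \<nu> (\<lambda>x. (h \<bullet> (x - m))^4) (3 * (h \<bullet> C h)\<^sup>2)"
proof -
  have p4: "sqrt a ^ 4 = a\<^sup>2" if "0 \<le> a" for a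
    using that power_mult[of "sqrt a" 2 2] by simp
  show "has_bochner_integral \<nu> (\<lambda>x. h \<bullet> (x - m)) 0"
    "has_bochner_integral \<nu> (\<lambda>x. (h \<bullet> (x - m))\<^sup>2) (h \<bullet> C h)"
    "has_bochner_integral \<nu> (\<lambda>x. (h \<bullet> (x - m))^3) 0"
    "has_bochner_integral \<nu> (\<lambda>x. (h \<bullet> (x - m))^4) (3 * (h \<bullet> C h)\<^sup>2)"
    using gaussian_power_moment[OF G, of h 1] gaussian_power_moment[OF G, of h 2]
      gaussian_power_moment[OF G, of h 3] gaussian_power_moment[OF G, of h 4]
      gaussian_marginal(1)[OF G, of h]
    by (simp_all add: std_normal_moment_values p4 mult.commute)
qed

lemma gaussian_covariance_self_adjoint:
  assumes "is_gaussian \<nu> m C"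
  shows "h \<bullet> C k = k \<bullet> C h"
  using is_gaussianD(4)[OF assms, of h k] is_gaussianD(4)[OF assms, of k h] by (simp add: mult.commute)

lemma gaussian_covariance_nonneg:
  assumes "is_gaussian \<nu> m C"
  shows "nonneg_operator C"
  unfolding nonneg_operator_def self_adjoint_def
  using gaussian_covariance_self_adjoint[OF assms] gaussian_marginal(1)[OF assms]
  by (metis inner_commute)

text \<open>\<open>is_gaussian\<close> prescribes the value of the integral, which would default to
  0 for a nonintegrable function. Polarization of the variances gives integrability together with
  the value.\<close>

lemma gaussian_moment_2:
  assumes G: "is_gaussian \<nu> m C"
  shows "has_bochner_integral \<nu> (\<lambda>x. (f \<bullet> (x - m)) * (g \<bullet> (x - m))) (f \<bullet> C g)"
proof -
  let ?q = "\<lambda>h. h \<bullet> C h"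
  have "has_bochner_integral \<nu> (\<lambda>x. (1 / 4) * (((f + g) \<bullet> (x - m))\<^sup>2 - ((f - g) \<bullet> (x - m))\<^sup>2))
      ((1 / 4) * (?q (f + g) - ?q (f - g)))"
    by (intro has_bochner_integral_diff has_bochner_integral_mult_right gaussian_moments(2)[OF G])
  moreover have "(1 / 4) * (((f + g) \<bullet> (x - m))\<^sup>2 - ((f - g) \<bullet> (x - m))\<^sup>2)
      = (f \<bullet> (x - m)) * (g \<bullet> (x - m))" for x
    unfolding inner_add_left inner_diff_left by algebra
  moreover have "(1 / 4) * (?q (f + g) - ?q (f - g)) = f \<bullet> C g"
    using gaussian_covariance_self_adjoint[OF G, of g f]
    by (simp add: blinfun.bilinear_simps inner_add_left inner_add_right inner_diff_left inner_diff_right)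
  ultimately show ?thesis by simp
qed

text \<open>Polarization of the vanishing third moments; 24 is the polarization constant
  \<open>2\<^sup>2 * 3!\<close> of cubic forms.\<close>

lemma gaussian_moment_3:
  assumes G: "is_gaussian \<nu> m C"
  shows "has_bochner_integral \<nu> (\<lambda>x. (f \<bullet> (x - m)) * (g \<bullet> (x - m)) * (h \<bullet> (x - m))) 0"
proof -
  have "has_bochner_integral \<nu> (\<lambda>x. (1 / 24) * (((f + g + h) \<bullet> (x - m))^3 - ((f + g - h) \<bullet> (x - m))^3
      - ((f - g + h) \<bullet> (x - m))^3 + ((f - g - h) \<bullet> (x - m))^3)) ((1 / 24) * (0 - 0 - 0 + 0))"
    by (intro has_bochner_integral_add has_bochner_integral_diff has_bochner_integral_mult_right
        gaussian_moments(3)[OF G])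
  moreover have "(1 / 24) * (((f + g + h) \<bullet> (x - m))^3 - ((f + g - h) \<bullet> (x - m))^3
      - ((f - g + h) \<bullet> (x - m))^3 + ((f - g - h) \<bullet> (x - m))^3)
      = (f \<bullet> (x - m)) * (g \<bullet> (x - m)) * (h \<bullet> (x - m))" for x
    unfolding inner_add_left inner_diff_left by algebra
  ultimately show ?thesis by simp
qed

text \<open>Isserlis' formula; 192 is the polarization constant \<open>2\<^sup>3 * 4!\<close> of quartic forms.\<close>

lemma gaussian_moment_4:
  assumes G: "is_gaussian \<nu> m C"
  shows "has_bochner_integral \<nu>
    (\<lambda>x. (f \<bullet> (x - m)) * (g \<bullet> (x - m)) * (h \<bullet> (x - m)) * (k \<bullet> (x - m)))
    ((f \<bullet> C g) * (h \<bullet> C k) + (f \<bullet> C h) * (g \<bullet> C k)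
      + (f \<bullet> C k) * (g \<bullet> C h))"
proof -
  let ?z = "\<lambda>h x. (h \<bullet> (x - m))^4"
  let ?q = "\<lambda>h. 3 * (h \<bullet> C h)\<^sup>2"
  have "has_bochner_integral \<nu> (\<lambda>x. (1 / 192) * (?z (f + g + h + k) x - ?z (f + g + h - k) x
        - ?z (f + g - h + k) x + ?z (f + g - h - k) x - ?z (f - g + h + k) x + ?z (f - g + h - k) x
        + ?z (f - g - h + k) x - ?z (f - g - h - k) x))
      ((1 / 192) * (?q (f + g + h + k) - ?q (f + g + h - k)
        - ?q (f + g - h + k) + ?q (f + g - h - k) - ?q (f - g + h + k) + ?q (f - g + h - k)
        + ?q (f - g - h + k) - ?q (f - g - h - k)))"
    by (intro has_bochner_integral_add has_bochner_integral_diff has_bochner_integral_mult_right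
        gaussian_moments(4)[OF G])
  moreover have "(1 / 192) * (?z (f + g + h + k) x - ?z (f + g + h - k) x
        - ?z (f + g - h + k) x + ?z (f + g - h - k) x - ?z (f - g + h + k) x + ?z (f - g + h - k) x
        + ?z (f - g - h + k) x - ?z (f - g - h - k) x)
      = (f \<bullet> (x - m)) * (g \<bullet> (x - m)) * (h \<bullet> (x - m)) * (k \<bullet> (x - m))" for x
    unfolding inner_add_left inner_diff_left by algebra
  moreover have "(1 / 192) * (?q (f + g + h + k) - ?q (f + g + h - k)
        - ?q (f + g - h + k) + ?q (f + g - h - k) - ?q (f - g + h + k) + ?q (f - g + h - k)
        + ?q (f - g - h + k) - ?q (f - g - h - k))
    = (f \<bullet> C g) * (h \<bullet> C k) + (f \<bullet> C h) * (g \<bullet> C k)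
      + (f \<bullet> C k) * (g \<bullet> C h)"
    unfolding blinfun.add_right blinfun.diff_right inner_add_left inner_diff_left inner_add_right inner_diff_right
      gaussian_covariance_self_adjoint[OF G, of g f] gaussian_covariance_self_adjoint[OF G, of h f]
      gaussian_covariance_self_adjoint[OF G, of k f] gaussian_covariance_self_adjoint[OF G, of h g]
      gaussian_covariance_self_adjoint[OF G, of k g] gaussian_covariance_self_adjoint[OF G, of k h]
    by algebra
  ultimately show ?thesis by (simp only:)
qed

text \<open>In the expansion of the square, the products of the quadratic and the linear part are
  third moments and vanish. Of the three Isserlis pairings, the one that joins \<open>f i\<close>
  with \<open>g i\<close> and \<open>f j\<close> with \<open>g j\<close> combines with c to
  \<open>E\<^sup>2\<close>; the other two, with the variance of l, form the variance of q.\<close>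

lemma gaussian_quadratic_moments:
  fixes f g :: "'i \<Rightarrow> 'h::real_inner" and l :: 'h and J :: "'i set" and c :: real
  assumes G: "is_gaussian \<nu> m C"
  defines "q \<equiv> \<lambda>x. (\<Sum>j\<in>J. (f j \<bullet> (x - m)) * (g j \<bullet> (x - m))) + l \<bullet> (x - m) + c"
    and "E \<equiv> (\<Sum>j\<in>J. f j \<bullet> C (g j)) + c"
  shows "has_bochner_integral \<nu> q E"
    and "has_bochner_integral \<nu> (\<lambda>x. (q x)\<^sup>2)
      ((\<Sum>i\<in>J. \<Sum>j\<in>J. (f i \<bullet> C (f j)) * (g i \<bullet> C (g j))
          + (f i \<bullet> C (g j)) * (g i \<bullet> C (f j)))
        + l \<bullet> C l + E\<^sup>2)"
proof -
  interpret prob_space \<nu> by (rule is_gaussianD(1)[OF G])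
  have const: "has_bochner_integral \<nu> (\<lambda>x. c) c" for c :: real
    using prob_space by (simp add: has_bochner_integral_iff)
  let ?z = "\<lambda>h x. h \<bullet> (x - m)"
  let ?C = "\<lambda>h k. h \<bullet> C k"
  have "has_bochner_integral \<nu> q ((\<Sum>j\<in>J. ?C (f j) (g j)) + 0 + c)"
    unfolding q_def by (intro has_bochner_integral_add has_bochner_integral_sum gaussian_moment_2[OF G]
        gaussian_moments(1)[OF G] const)
  then show "has_bochner_integral \<nu> q E" by (simp add: E_def)
  have "has_bochner_integral \<nu> (\<lambda>x. (\<Sum>i\<in>J. \<Sum>j\<in>J. ?z (f i) x * ?z (g i) x * ?z (f j) x * ?z (g j) x)
        + (2 * (\<Sum>j\<in>J. ?z (f j) x * ?z (g j) x * ?z l x) + (2 * c * (\<Sum>j\<in>J. ?z (f j) x * ?z (g j) x)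
        + ((?z l x)\<^sup>2 + (2 * c * ?z l x + c\<^sup>2)))))
      ((\<Sum>i\<in>J. \<Sum>j\<in>J. ?C (f i) (g i) * ?C (f j) (g j) + ?C (f i) (f j) * ?C (g i) (g j)
          + ?C (f i) (g j) * ?C (g i) (f j))
        + (2 * (\<Sum>j\<in>J. 0) + (2 * c * (\<Sum>j\<in>J. ?C (f j) (g j)) + (?C l l + (2 * c * 0 + c\<^sup>2)))))"
    by (intro has_bochner_integral_add has_bochner_integral_sum has_bochner_integral_mult_right
        gaussian_moment_4[OF G] gaussian_moment_3[OF G] gaussian_moment_2[OF G]
        gaussian_moments(1,2)[OF G] const)
  moreover have "(\<Sum>i\<in>J. \<Sum>j\<in>J. ?z (f i) x * ?z (g i) x * ?z (f j) x * ?z (g j) x)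
        + (2 * (\<Sum>j\<in>J. ?z (f j) x * ?z (g j) x * ?z l x) + (2 * c * (\<Sum>j\<in>J. ?z (f j) x * ?z (g j) x)
        + ((?z l x)\<^sup>2 + (2 * c * ?z l x + c\<^sup>2)))) = (q x)\<^sup>2" for x
  proof -
    have "(\<Sum>i\<in>J. \<Sum>j\<in>J. ?z (f i) x * ?z (g i) x * ?z (f j) x * ?z (g j) x)
        = (\<Sum>j\<in>J. ?z (f j) x * ?z (g j) x) * (\<Sum>j\<in>J. ?z (f j) x * ?z (g j) x)"
      by (simp add: sum_product mult.assoc)
    moreover have "(\<Sum>j\<in>J. ?z (f j) x * ?z (g j) x * ?z l x) = (\<Sum>j\<in>J. ?z (f j) x * ?z (g j) x) * ?z l x"
      by (simp add: sum_distrib_right)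
    ultimately show ?thesis unfolding q_def by algebra
  qed
  moreover have "(\<Sum>i\<in>J. \<Sum>j\<in>J. ?C (f i) (g i) * ?C (f j) (g j) + ?C (f i) (f j) * ?C (g i) (g j)
          + ?C (f i) (g j) * ?C (g i) (f j))
        + (2 * (\<Sum>j\<in>J. 0) + (2 * c * (\<Sum>j\<in>J. ?C (f j) (g j)) + (?C l l + (2 * c * 0 + c\<^sup>2))))
      = (\<Sum>i\<in>J. \<Sum>j\<in>J. ?C (f i) (f j) * ?C (g i) (g j) + ?C (f i) (g j) * ?C (g i) (f j)) + ?C l l + E\<^sup>2"
  proof -
    have "(\<Sum>i\<in>J. \<Sum>j\<in>J. ?C (f i) (g i) * ?C (f j) (g j)) = (\<Sum>j\<in>J. ?C (f j) (g j))\<^sup>2"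
      by (simp add: sum_product power2_eq_square)
    then show ?thesis
      by (simp add: E_def sum.distrib power2_sum add.assoc)
  qed
  ultimately show "has_bochner_integral \<nu> (\<lambda>x. (q x)\<^sup>2)
      ((\<Sum>i\<in>J. \<Sum>j\<in>J. (f i \<bullet> C (f j)) * (g i \<bullet> C (g j))
          + (f i \<bullet> C (g j)) * (g i \<bullet> C (f j)))
        + l \<bullet> C l + E\<^sup>2)"
    by (simp only:)
qed

subsection \<open>Absolute continuity bounds the covariance\<close>

text \<open>The set is an interval of length \<open>2 * r / s\<close>, and the density is at most
  1/2 because \<open>sqrt (2 * pi) \<ge> 2\<close>.\<close>

lemma std_normal_anticoncentration:
  assumes "s > 0" "0 \<le> r"
  shows "measure std_normal_distribution {y. \<bar>a + s * y\<bar> \<le> r} \<le> r / s"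
proof -
  let ?A = "{y. \<bar>a + s * y\<bar> \<le> r}"
  have A: "?A = {(- r - a) / s .. (r - a) / s}"
    using assms by (auto simp: abs_le_iff field_simps)
  have le: "std_normal_density y \<le> 1 / 2" for y
  proof -
    have "2 \<le> sqrt (2 * pi)"
      using pi_gt3 by (intro real_le_rsqrt) auto
    then have "1 / sqrt (2 * pi) \<le> 1 / 2" by (intro divide_left_mono) auto
    moreover have "exp (- y\<^sup>2 / 2) \<le> 1" by simp
    ultimately have "1 / sqrt (2 * pi) * exp (- y\<^sup>2 / 2) \<le> 1 / 2 * 1"
      by (intro mult_mono) auto
    then show ?thesis by (simp add: std_normal_density_def)
  qed
  have "emeasure std_normal_distribution ?A = (\<integral>\<^sup>+y. ennreal (std_normal_density y) * indicator ?A y \<partial>lborel)"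
    unfolding A by (rule emeasure_density) auto
  also have "\<dots> \<le> (\<integral>\<^sup>+y. ennreal (1 / 2) * indicator ?A y \<partial>lborel)"
    using le by (intro nn_integral_mono mult_right_mono ennreal_leI) auto
  also have "\<dots> = ennreal (1 / 2) * emeasure lborel ?A"
    unfolding A by (rule nn_integral_cmult_indicator) auto
  also have "emeasure lborel ?A = ennreal ((r - a) / s - (- r - a) / s)"
    unfolding A using assms by (intro emeasure_lborel_Icc) (simp add: divide_right_mono)
  also have "ennreal (1 / 2) * ennreal ((r - a) / s - (- r - a) / s) = ennreal (r / s)"
    using assms by (subst ennreal_mult'[symmetric]) (auto simp: field_simps)
  finally show ?thesis
    using assms by (simp add: measure_def enn2real_leI)
qed

lemma gaussian_anticoncentration:
  assumes G: "is_gaussian \<nu> m C" and pos: "0 < h \<bullet> C h" and "0 \<le> r"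
  shows "measure \<nu> {x\<in>space \<nu>. \<bar>h \<bullet> x - b\<bar> \<le> r} \<le> r / sqrt (h \<bullet> C h)"
proof -
  note [measurable] = inner_measurable_of_sets[OF is_gaussianD(2)[OF G]]
  let ?A = "{y. \<bar>y - b\<bar> \<le> r}" and ?s = "sqrt (h \<bullet> C h)"
  have "measure \<nu> {x\<in>space \<nu>. \<bar>h \<bullet> x - b\<bar> \<le> r} = measure (distr \<nu> borel (\<lambda>x. h \<bullet> x)) ?A"
    by (subst measure_distr) (auto simp: vimage_def Int_def conj_commute)
  also have "\<dots> = measure std_normal_distribution {y. \<bar>(h \<bullet> m - b) + ?s * y\<bar> \<le> r}"
    unfolding gaussian_marginal(2)[OF G] by (subst measure_distr) (auto simp: vimage_def algebra_simps)
  also have "\<dots> \<le> r / ?s"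
    using assms by (intro std_normal_anticoncentration) auto
  finally show ?thesis .
qed

lemma gaussian_Chebyshev:
  assumes G: "is_gaussian \<nu> m C" and "0 < r"
  shows "measure \<nu> {x\<in>space \<nu>. r < \<bar>h \<bullet> x - h \<bullet> m\<bar>} \<le> (h \<bullet> C h) / r\<^sup>2"
proof -
  interpret prob_space \<nu> by (rule is_gaussianD(1)[OF G])
  note [measurable] = inner_measurable_of_sets[OF is_gaussianD(2)[OF G]]
  have "measure \<nu> {x\<in>space \<nu>. r < \<bar>h \<bullet> x - h \<bullet> m\<bar>} \<le> measure \<nu> {x\<in>space \<nu>. r\<^sup>2 \<le> (h \<bullet> (x - m))\<^sup>2}"
    using assms by (intro finite_measure_mono) (auto simp: inner_diff_right abs_le_square_iff[symmetric])
  also have "\<dots> \<le> (\<integral>x. (h \<bullet> (x - m))\<^sup>2 \<partial>\<nu>) / r\<^sup>2"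
    using gaussian_moments(2)[OF G, of h] assms
    by (intro integral_Markov_inequality_measure[where A = "{}"]) (auto simp: has_bochner_integral_iff)
  also have "(\<integral>x. (h \<bullet> (x - m))\<^sup>2 \<partial>\<nu>) = h \<bullet> C h"
    using gaussian_moments(2)[OF G, of h] by (simp add: has_bochner_integral_iff)
  finally show ?thesis .
qed

text \<open>If the covariance of \<open>\<nu>\<close> is not bounded by that of \<open>\<mu>0\<close>, there are functionals that are almost
  surely eventually small under \<open>\<mu>0\<close> and almost surely eventually large under \<open>\<nu>\<close>.\<close>

lemma gaussian_covariance_bounded:
  assumes G0: "is_gaussian \<mu>0 m0 C0" and G: "is_gaussian \<nu> m C"
    and ac: "absolutely_continuous \<mu>0 \<nu>"
    and pos: "\<And>h. h \<noteq> 0 \<Longrightarrow> 0 < h \<bullet> C0 h"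
  obtains M where "M > 0" "\<And>h. h \<bullet> C h \<le> M * (h \<bullet> C0 h)"
proof (rule ccontr)
  assume contr: "\<not> thesis"
  interpret M0: prob_space \<mu>0 by (rule is_gaussianD(1)[OF G0])
  interpret N: prob_space \<nu> by (rule is_gaussianD(1)[OF G])
  note s0 = is_gaussianD(2)[OF G0] and s1 = is_gaussianD(2)[OF G]
  note [measurable] = inner_measurable_of_sets[OF s0] inner_measurable_of_sets[OF s1]
  have sp: "space \<nu> = space \<mu>0" using s0 s1 by (metis sets_eq_imp_space_eq)
  \<comment> \<open>Since 16 = 4^2, the standard deviation under \<nu> exceeds \<open>4 ^ k\<close>
    times the one under \<mu>0. The threshold \<open>2 ^ k * s k\<close> lies between the two
    scales: Chebyshev bounds the first event by \<open>(1 / 4) ^ k\<close>, anticoncentration the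
    second by \<open>(1 / 2) ^ k\<close>, and both are summable.\<close>
  have "\<exists>h. (16 ^ k) * (h \<bullet> C0 h) < h \<bullet> C h" for k :: nat
    using contr that[of "16 ^ k"] by (meson not_le zero_less_numeral zero_less_power)
  then obtain h where h: "\<And>k. (16 ^ k) * (h k \<bullet> C0 (h k)) < h k \<bullet> C (h k)"
    by metis
  have h0: "h k \<noteq> 0" for k using h[of k] by (auto simp: blinfun.bilinear_simps)
  define s where "s k = sqrt (h k \<bullet> C0 (h k))" for k
  have spos: "s k > 0" for k using pos[OF h0] by (simp add: s_def)
  define A where "A k = {x\<in>space \<mu>0. 2 ^ k * s k < \<bar>h k \<bullet> x - h k \<bullet> m0\<bar>}" for k
  \<comment> \<open>The centre is that of \<mu>0 here too: anticoncentration holds around every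
    centre. Thus A and B are defined by complementary conditions.\<close>
  define B where "B k = {x\<in>space \<nu>. \<bar>h k \<bullet> x - h k \<bullet> m0\<bar> \<le> 2 ^ k * s k}" for k
  have A_meas: "A k \<in> sets \<mu>0" and B_meas: "B k \<in> sets \<nu>" for k
    unfolding A_def B_def by measurable
  have mA: "measure \<mu>0 (A k) \<le> (1 / 4) ^ k" for k
  proof -
    have "measure \<mu>0 (A k) \<le> (h k \<bullet> C0 (h k)) / (2 ^ k * s k)\<^sup>2"
      unfolding A_def using spos by (intro gaussian_Chebyshev[OF G0]) auto
    also have "\<dots> = (s k)\<^sup>2 / (2 ^ k * s k)\<^sup>2"
      using gaussian_marginal(1)[OF G0] by (simp add: s_def)
    also have "\<dots> = 1 / (2 ^ k)\<^sup>2"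
      using spos[of k] by (simp add: power_mult_distrib)
    also have "(2 ^ k)\<^sup>2 = (4::real) ^ k"
      by (simp add: power2_eq_square flip: power_mult_distrib)
    finally show ?thesis by (simp add: power_one_over)
  qed
  have mB: "measure \<nu> (B k) \<le> (1 / 2) ^ k" for k
  proof -
    have "(4 ^ k * s k) \<le> sqrt (h k \<bullet> C (h k))"
    proof (rule real_le_rsqrt)
      have "(4 ^ k)\<^sup>2 = (16::real) ^ k"
        by (simp add: power2_eq_square flip: power_mult_distrib)
      then have "(4 ^ k * s k)\<^sup>2 = 16 ^ k * (h k \<bullet> C0 (h k))"
        using gaussian_marginal(1)[OF G0, of "h k"] by (simp add: s_def power_mult_distrib)
      then show "(4 ^ k * s k)\<^sup>2 \<le> h k \<bullet> C (h k)" using h[of k] by simp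
    qed
    moreover have "0 < 4 ^ k * s k" using spos by simp
    moreover have "measure \<nu> (B k) \<le> (2 ^ k * s k) / sqrt (h k \<bullet> C (h k))"
      unfolding B_def
    proof (rule gaussian_anticoncentration[OF G])
      have "0 \<le> 16 ^ k * (h k \<bullet> C0 (h k))"
        using gaussian_marginal(1)[OF G0] by simp
      then show "0 < h k \<bullet> C (h k)" using h[of k] by linarith
    qed (use spos[of k] in auto)
    moreover have "2 ^ k * s k / sqrt (h k \<bullet> C (h k)) \<le> (2 ^ k * s k) / (4 ^ k * s k)"
      using calculation(1,2) spos[of k] less_le_trans[OF calculation(2,1)] by (intro divide_left_mono mult_pos_pos) auto
    ultimately have "measure \<nu> (B k) \<le> (2 ^ k * s k) / (4 ^ k * s k)"
      by linarith
    also have "\<dots> = (2 / 4) ^ k" using spos[of k] unfolding power_divide by simp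
    finally show ?thesis by simp
  qed
  have "AE x in \<mu>0. eventually (\<lambda>k. x \<in> space \<mu>0 - A k) sequentially"
  proof (rule borel_cantelli_AE1)
    show "summable (\<lambda>k. measure \<mu>0 (A k))"
      by (rule summable_comparison_test'[where g = "\<lambda>k. (1 / 4) ^ k" and N = 0])
        (use mA in \<open>auto intro: summable_geometric\<close>)
  qed (use A_meas M0.emeasure_finite in \<open>auto simp: less_top[symmetric]\<close>)
  then have "AE x in \<nu>. eventually (\<lambda>k. x \<in> space \<mu>0 - A k) sequentially"
    by (rule absolutely_continuous_AE[rotated 2]) (use ac s0 s1 in auto)
  moreover have "AE x in \<nu>. eventually (\<lambda>k. x \<in> space \<nu> - B k) sequentially"
  proof (rule borel_cantelli_AE1)
    show "summable (\<lambda>k. measure \<nu> (B k))"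
      by (rule summable_comparison_test'[where g = "\<lambda>k. (1 / 2) ^ k" and N = 0])
        (use mB in \<open>auto intro: summable_geometric\<close>)
  qed (use B_meas N.emeasure_finite in \<open>auto simp: less_top[symmetric]\<close>)
  ultimately have "AE x in \<nu>. False"
  proof eventually_elim
    case (elim x)
    then have "eventually (\<lambda>k. False) sequentially"
      by eventually_elim (auto simp: A_def B_def sp)
    then show ?case by simp
  qed
  then show False by (simp add: N.AE_False)
qed

section \<open>Convergence of relative entropies\<close>

lemma integral_Cauchy_Schwarz:
  fixes f g :: "'a \<Rightarrow> real"
  assumes [measurable]: "f \<in> borel_measurable M" "g \<in> borel_measurable M"
    and f: "integrable M (\<lambda>x. (f x)\<^sup>2)" and g: "integrable M (\<lambda>x. (g x)\<^sup>2)"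
  shows "integrable M (\<lambda>x. f x * g x)"
    and "(\<integral>x. f x * g x \<partial>M)\<^sup>2 \<le> (\<integral>x. (f x)\<^sup>2 \<partial>M) * (\<integral>x. (g x)\<^sup>2 \<partial>M)"
proof -
  have le: "2 * \<bar>a * b\<bar> \<le> a\<^sup>2 + b\<^sup>2" for a b :: real
    using zero_le_power2[of "\<bar>a\<bar> - \<bar>b\<bar>"] by (simp add: power2_diff abs_mult)
  show fg: "integrable M (\<lambda>x. f x * g x)"
  proof (rule Bochner_Integration.integrable_bound)
    show "integrable M (\<lambda>x. (f x)\<^sup>2 + (g x)\<^sup>2)" using f g by simp
    have "norm (f x * g x) \<le> norm ((f x)\<^sup>2 + (g x)\<^sup>2)" for x
      using le[of "f x" "g x"] zero_le_power2[of "f x"] zero_le_power2[of "g x"] by simp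
    then show "AE x in M. norm (f x * g x) \<le> norm ((f x)\<^sup>2 + (g x)\<^sup>2)" by simp
  qed simp
  show "(\<integral>x. f x * g x \<partial>M)\<^sup>2 \<le> (\<integral>x. (f x)\<^sup>2 \<partial>M) * (\<integral>x. (g x)\<^sup>2 \<partial>M)"
  proof (rule nonneg_quadratic_discriminant)
    fix t
    have "0 \<le> (\<integral>x. (f x + t * g x)\<^sup>2 \<partial>M)" by simp
    also have "\<dots> = (\<integral>x. (f x)\<^sup>2 + (2 * t) * (f x * g x) + t\<^sup>2 * (g x)\<^sup>2 \<partial>M)"
      by (intro Bochner_Integration.integral_cong refl) (simp add: power2_eq_square algebra_simps)
    also have "\<dots> = (\<integral>x. (f x)\<^sup>2 \<partial>M) + 2 * t * (\<integral>x. f x * g x \<partial>M) + t\<^sup>2 * (\<integral>x. (g x)\<^sup>2 \<partial>M)"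
      using f g fg by simp
    finally show "0 \<le> \<dots>" .
  qed simp
qed

section \<open>Approximation of densities by continuous functions\<close>

lemma open_indicator_approx:
  fixes U :: "'a::metric_space set"
  assumes "open U"
  obtains g :: "nat \<Rightarrow> 'a \<Rightarrow> real" where "\<And>n. continuous_on UNIV (g n)" "\<And>n x. 0 \<le> g n x" "\<And>n x. g n x \<le> 1"
    "\<And>x. (\<lambda>n. g n x) \<longlonglongrightarrow> indicator U x"
\<comment> \<open>For U = UNIV the complement is empty and \<open>infdist\<close> to it is 0 by
  convention, so the formula used below would yield the zero function.\<close>
proof (cases "U = UNIV")
  case True
  show ?thesis by (rule that[of "\<lambda>n x. 1"]) (auto simp: True)
next
  case False
  define g where "g n x = min 1 (real n * infdist x (- U))" for n x
  show ?thesis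
  proof (rule that[of g])
    show "continuous_on UNIV (g n)" for n
      unfolding g_def by (intro continuous_intros)
    show "0 \<le> g n x" "g n x \<le> 1" for n x
      by (auto simp: g_def infdist_nonneg)
    show "(\<lambda>n. g n x) \<longlonglongrightarrow> indicator U x" for x
    proof (cases "x \<in> U")
      case True
      have d: "infdist x (- U) > 0"
        using True False assms in_closed_iff_infdist_zero[of "- U" x] infdist_nonneg[of x "- U"]
        by (force simp: closed_Compl less_le)
      obtain N where N: "1 < real N * infdist x (- U)"
        using reals_Archimedean3[OF d] by blast
      have "eventually (\<lambda>n. g n x = indicator U x) sequentially"
        using eventually_ge_at_top[of N]
      proof eventually_elim
        case (elim n)
        then have "real N * infdist x (- U) \<le> real n * infdist x (- U)"
          using d by (intro mult_right_mono) auto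
        then show ?case using N True by (simp add: g_def)
      qed
      then show ?thesis by (rule tendsto_eventually)
    next
      case outside: False
      then show ?thesis by (simp add: g_def)
    qed
  qed
qed

text \<open>The property P of being approximable in L^1 is closed under L^1 limits
  (\<open>approx\<close>). It holds for indicators of open sets by the distance functions, then for
  Borel sets by outer regularity, and the induction over integrable functions finishes.\<close>

lemma integrable_continuous_approx:
  fixes f :: "'a::{second_countable_topology, complete_space} \<Rightarrow> real"
  assumes M: "finite_measure M" "sets M = sets borel" and f: "integrable M f" and e: "e > 0"
  obtains g where "continuous_on UNIV g" "bounded (range g)" "(\<integral>x. \<bar>f x - g x\<bar> \<partial>M) < e"
proof -
  interpret finite_measure M by fact
  have sp: "space M = UNIV" using sets_eq_imp_space_eq[OF M(2)] by simp
  have meas: "g \<in> borel_measurable M" if "continuous_on UNIV g" for g :: "'a \<Rightarrow> real"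
    using borel_measurable_continuous_onI[OF that] measurable_cong_sets[OF M(2) refl] by blast
  define P where "P f \<longleftrightarrow> (\<forall>e>0. \<exists>g. continuous_on UNIV g \<and> bounded (range g) \<and> (\<integral>x. \<bar>f x - g x\<bar> \<partial>M) < e)"
    for f :: "'a \<Rightarrow> real"
  have int: "integrable M g" if g: "continuous_on UNIV g" "bounded (range g)" for g :: "'a \<Rightarrow> real"
  proof -
    obtain B where "\<And>x. \<bar>g x\<bar> \<le> B" using g(2) by (auto simp: bounded_iff)
    then show ?thesis
      using meas[OF g(1)] by (intro integrable_const_bound[where B = B]) auto
  qed
  have approx: "P f" if f: "integrable M f" and ex: "\<And>e. e > 0 \<Longrightarrow> \<exists>h. integrable M h \<and> P h \<and> (\<integral>x. \<bar>f x - h x\<bar> \<partial>M) < e" for f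
    unfolding P_def
  proof (intro allI impI)
    fix e :: real assume "e > 0"
    then obtain h where h: "integrable M h" "P h" "(\<integral>x. \<bar>f x - h x\<bar> \<partial>M) < e / 2"
      using ex[of "e / 2"] by auto
    then obtain g where g: "continuous_on UNIV g" "bounded (range g)" "(\<integral>x. \<bar>h x - g x\<bar> \<partial>M) < e / 2"
      using \<open>e > 0\<close> unfolding P_def by (meson half_gt_zero)
    note ig = int[OF g(1,2)]
    have "(\<integral>x. \<bar>f x - g x\<bar> \<partial>M) \<le> (\<integral>x. \<bar>f x - h x\<bar> + \<bar>h x - g x\<bar> \<partial>M)"
      using f h(1) ig by (intro integral_mono) auto
    also have "\<dots> = (\<integral>x. \<bar>f x - h x\<bar> \<partial>M) + (\<integral>x. \<bar>h x - g x\<bar> \<partial>M)"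
      using f h(1) ig by (intro Bochner_Integration.integral_add) auto
    finally show "\<exists>g. continuous_on UNIV g \<and> bounded (range g) \<and> (\<integral>x. \<bar>f x - g x\<bar> \<partial>M) < e"
      using g h(3) by (intro exI[of _ g]) auto
  qed
  have P_lim: "P f" if s: "\<And>i. integrable M (s i)" "\<And>i. P (s i)" "\<And>x. (\<lambda>i. s i x) \<longlonglongrightarrow> f x"
      "\<And>i x. \<bar>s i x\<bar> \<le> w x" "integrable M w" "integrable M f" for s f w
  proof (rule approx)
    have "(\<lambda>i. \<integral>x. \<bar>f x - s i x\<bar> \<partial>M) \<longlonglongrightarrow> (\<integral>x. 0 \<partial>M)"
    proof (rule integral_dominated_convergence[where w = "\<lambda>x. \<bar>f x\<bar> + w x"])
      have "(\<lambda>i. \<bar>f x - s i x\<bar>) \<longlonglongrightarrow> \<bar>f x - f x\<bar>" for x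
        by (intro tendsto_intros s(3))
      then show "AE x in M. (\<lambda>i. \<bar>f x - s i x\<bar>) \<longlonglongrightarrow> 0" by simp
      show "AE x in M. norm \<bar>f x - s i x\<bar> \<le> \<bar>f x\<bar> + w x" for i
      proof (rule AE_I2)
        show "norm \<bar>f x - s i x\<bar> \<le> \<bar>f x\<bar> + w x" for x
          using s(4)[of i x] by simp
      qed
    qed (use s in auto)
    then have lim: "(\<lambda>i. \<integral>x. \<bar>f x - s i x\<bar> \<partial>M) \<longlonglongrightarrow> 0" by simp
    show "\<exists>h. integrable M h \<and> P h \<and> (\<integral>x. \<bar>f x - h x\<bar> \<partial>M) < e" if "e > 0" for e
    proof -
      have "eventually (\<lambda>i. (\<integral>x. \<bar>f x - s i x\<bar> \<partial>M) < e) sequentially"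
        using order_tendstoD(2)[OF lim that] .
      then obtain i where "(\<integral>x. \<bar>f x - s i x\<bar> \<partial>M) < e"
        unfolding eventually_sequentially by blast
      then show ?thesis using s(1,2) by blast
    qed
  qed (rule s(6))
  have P_cont: "P g" if "continuous_on UNIV g" "bounded (range g)" for g
    unfolding P_def using that by (intro allI impI exI[of _ g]) auto
  have P_open: "P (indicator U)" if U: "open U" for U
  proof -
    obtain g :: "nat \<Rightarrow> 'a \<Rightarrow> real" where g: "\<And>n. continuous_on UNIV (g n)" "\<And>n x. 0 \<le> g n x" "\<And>n x. g n x \<le> 1"
      "\<And>x. (\<lambda>n. g n x) \<longlonglongrightarrow> indicator U x"
      using open_indicator_approx[OF U] by blast
    have b: "bounded (range (g n))" for n
      using g(2,3) by (auto simp: bounded_iff intro!: exI[of _ 1])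
    show ?thesis
    proof (rule P_lim[where s = g and w = "\<lambda>_. 1"])
      show "\<bar>g i x\<bar> \<le> 1" for i x using g(2,3)[of i x] by simp
      show "integrable M (indicator U :: 'a \<Rightarrow> real)"
        using U M(2) by (auto simp: less_top[symmetric])
    qed (use g int P_cont b in auto)
  qed
  have P_borel: "P (indicator A)" if A: "A \<in> sets M" for A
  proof (rule approx)
    show "integrable M (indicator A :: 'a \<Rightarrow> real)"
      using A by (auto simp: less_top[symmetric])
    fix e :: real assume e: "e > 0"
    have "emeasure M A = (INF U \<in> {U. A \<subseteq> U \<and> open U}. emeasure M U)"
      using A M(2) by (intro outer_regular) auto
    moreover have "emeasure M A < emeasure M A + ennreal e"
      using e by (simp add: emeasure_eq_measure ennreal_less_iff flip: ennreal_plus)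
    ultimately obtain U where U: "A \<subseteq> U" "open U" "emeasure M U < emeasure M A + ennreal e"
      by (metis (no_types, lifting) INF_less_iff mem_Collect_eq)
    have Um: "U \<in> sets M" using U(2) M(2) by simp
    have "(\<integral>x. \<bar>indicat_real A x - indicat_real U x\<bar> \<partial>M) = (\<integral>x. indicator (U - A) x \<partial>M)"
    proof -
      have "\<bar>indicator A x - indicator U x\<bar> = (indicator (U - A) x :: real)" for x
        using U(1) by (cases "x \<in> A"; cases "x \<in> U") auto
      then show ?thesis by simp
    qed
    also have "\<dots> = measure M U - measure M A"
      using Um A U(1) by (simp add: finite_measure_Diff sp)
    also have "\<dots> < e"
      using U(3) e by (simp add: emeasure_eq_measure ennreal_less_iff flip: ennreal_plus)
    finally show "\<exists>h. integrable M h \<and> P h \<and> (\<integral>x. \<bar>indicator A x - h x\<bar> \<partial>M) < e"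
      using P_open[OF U(2)] Um by (intro exI[of _ "indicator U"]) (auto simp: less_top[symmetric])
  qed
  have P_scale: "P (\<lambda>x. h x * c)" if h: "P h" "integrable M h" for h c
    unfolding P_def
  proof (intro allI impI)
    fix e :: real assume "e > 0"
    then obtain g where g: "continuous_on UNIV g" "bounded (range g)" "(\<integral>x. \<bar>h x - g x\<bar> \<partial>M) < e / (\<bar>c\<bar> + 1)"
      using h(1) unfolding P_def by (metis abs_ge_zero add_nonneg_pos divide_pos_pos zero_less_one)
    have "(\<integral>x. \<bar>h x * c - g x * c\<bar> \<partial>M) = \<bar>c\<bar> * (\<integral>x. \<bar>h x - g x\<bar> \<partial>M)"
      by (subst integral_mult_right_zero[symmetric], intro Bochner_Integration.integral_cong)
        (auto simp: abs_mult[symmetric] algebra_simps)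
    also have "\<dots> \<le> (\<bar>c\<bar> + 1) * (\<integral>x. \<bar>h x - g x\<bar> \<partial>M)"
      by (intro mult_right_mono) auto
    also have "\<dots> < e" using g(3) by (simp add: field_simps)
    finally have "(\<integral>x. \<bar>h x * c - g x * c\<bar> \<partial>M) < e" .
    moreover have "continuous_on UNIV (\<lambda>x. g x * c)" by (intro continuous_intros g(1))
    moreover have "bounded (range (\<lambda>x. g x * c))"
    proof -
      obtain B where "\<And>x. \<bar>g x\<bar> \<le> B" using g(2) by (auto simp: bounded_iff)
      then have "\<And>x. \<bar>g x * c\<bar> \<le> B * \<bar>c\<bar>" by (simp add: abs_mult mult_right_mono)
      then show ?thesis by (auto simp: bounded_iff)
    qed
    ultimately show "\<exists>g. continuous_on UNIV g \<and> bounded (range g) \<and> (\<integral>x. \<bar>h x * c - g x\<bar> \<partial>M) < e" by blast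
  qed
  have "P f" using f
  proof (induction rule: integrable_induct)
    case (base A c)
    then show ?case
      using P_scale[OF P_borel[of A], of c] by simp
  next
    case (add f g)
    show ?case
      unfolding P_def
    proof (intro allI impI)
      fix e :: real assume "e > 0"
      then obtain a b where a: "continuous_on UNIV a" "bounded (range a)" "(\<integral>x. \<bar>f x - a x\<bar> \<partial>M) < e / 2"
        and b: "continuous_on UNIV b" "bounded (range b)" "(\<integral>x. \<bar>g x - b x\<bar> \<partial>M) < e / 2"
        using add(3,4) unfolding P_def by (meson half_gt_zero)
      have "(\<integral>x. \<bar>f x + g x - (a x + b x)\<bar> \<partial>M) \<le> (\<integral>x. \<bar>f x - a x\<bar> + \<bar>g x - b x\<bar> \<partial>M)"
        using add(1,2) int[OF a(1,2)] int[OF b(1,2)] by (intro integral_mono) auto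
      also have "\<dots> = (\<integral>x. \<bar>f x - a x\<bar> \<partial>M) + (\<integral>x. \<bar>g x - b x\<bar> \<partial>M)"
        using add(1,2) int[OF a(1,2)] int[OF b(1,2)] by (intro Bochner_Integration.integral_add) auto
      finally show "\<exists>h. continuous_on UNIV h \<and> bounded (range h) \<and> (\<integral>x. \<bar>f x + g x - h x\<bar> \<partial>M) < e"
        using a b by (intro exI[of _ "\<lambda>x. a x + b x"] conjI continuous_intros bounded_plus_comp) auto
    qed
  next
    case (lim f s)
    show ?case
      by (rule P_lim[where s = s and w = "\<lambda>x. 2 * \<bar>f x\<bar>"]) (use lim sp in auto)
  qed
  then show ?thesis using that e unfolding P_def by blast
qed

text \<open>For s > 0 the right side minus the left side is 2 s (r - 1 - ln r) with r = sqrt (t /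
  s). Applying \<open>ln r \<le> r - 1\<close> to the square root of the quotient is what brings out
  the Hellinger distance.\<close>

lemma entropy_Bregman_ge:
  fixes s t :: real
  assumes "0 \<le> s" "0 < t"
  shows "(sqrt s - sqrt t)\<^sup>2 \<le> s * ln s - s * ln t - s + t"
proof (cases "s = 0")
  case True
  then show ?thesis using assms by simp
next
  case False
  then have s: "s > 0" using assms by simp
  define r where "r = sqrt t / sqrt s"
  have "ln r \<le> r - 1" using s assms unfolding r_def by (intro ln_le_minus_one) auto
  moreover have "ln r = (ln t - ln s) / 2"
    using s assms by (simp add: r_def ln_div ln_sqrt diff_divide_distrib)
  ultimately have "ln t - ln s \<le> 2 * (r - 1)" by simp
  then have "s * (ln t - ln s) \<le> s * (2 * (r - 1))" using s by (intro mult_left_mono) auto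
  also have "\<dots> = 2 * sqrt s * sqrt t - 2 * s"
    using s real_sqrt_mult_self[of s] by (simp add: r_def field_simps)
  finally show ?thesis
    using s assms by (simp add: power2_diff algebra_simps)
qed

text \<open>The density is truncated to values between two positive constants, and the truncation is
  replaced by a continuous function. Such a g has a bounded continuous logarithm, which can be
  tested against weak convergence.\<close>

lemma entropy_continuous_approx:
  fixes p :: "'a::{second_countable_topology, complete_space} \<Rightarrow> real"
  assumes M: "finite_measure \<mu>" "sets \<mu> = sets borel"
    and [measurable]: "p \<in> borel_measurable \<mu>" and nn: "\<And>x. 0 \<le> p x"
    and p: "integrable \<mu> p" "integrable \<mu> (\<lambda>x. p x * ln (p x))" and eta: "\<eta> > 0"
  obtains g a b where "continuous_on UNIV g" "0 < a" "\<And>x. a \<le> g x" "\<And>x. g x \<le> b"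
    "(\<integral>x. p x * ln (p x) - p x * ln (g x) - p x + g x \<partial>\<mu>) < \<eta>"
proof -
  interpret finite_measure \<mu> by fact
  have sp: "space \<mu> = UNIV" using sets_eq_imp_space_eq[OF M(2)] by simp
  define c where "c i x = max (1 / real (i + 1)) (min (real (i + 1)) (p x))" for i x
  have c_bounds: "1 / real (i + 1) \<le> c i x" "c i x \<le> real (i + 1)" for i x
    by (auto simp: c_def field_simps)
  have c_pos: "c i x > 0" for i x
    using c_bounds(1)[of i x] by (rule less_le_trans[rotated]) simp
  have [measurable]: "c i \<in> borel_measurable \<mu>" for i unfolding c_def by measurable
  define F where "F i x = p x * ln (p x) - p x * ln (c i x) - p x + c i x" for i x
  have "(\<lambda>i. \<integral>x. F i x \<partial>\<mu>) \<longlonglongrightarrow> (\<integral>x. 0 \<partial>\<mu>)"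
  \<comment> \<open>Where the truncation cuts from above, \<open>ln (c i x) \<ge> 0\<close> and
    \<open>c i x \<le> p x\<close>; where it cuts from below,
    \<open>p x * ln (p x) \<le> p x * ln (c i x)\<close> and \<open>c i x \<le> 1\<close>. This
    yields the dominating function.\<close>
  proof (rule integral_dominated_convergence[where w = "\<lambda>x. \<bar>p x * ln (p x)\<bar> + 1"])
    show "AE x in \<mu>. (\<lambda>i. F i x) \<longlonglongrightarrow> 0"
    proof (rule AE_I2)
      fix x
      show "(\<lambda>i. F i x) \<longlonglongrightarrow> 0"
      proof (cases "p x = 0")
        case True
        then have "F i x = inverse (real (Suc i))" for i
          by (simp add: F_def c_def field_simps)
        then show ?thesis using LIMSEQ_inverse_real_of_nat by simp
      next
        case False
        then have px: "p x > 0" using nn[of x] by simp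
        obtain N1 where N1: "p x < real N1" using reals_Archimedean2 by blast
        obtain N2 where N2: "1 / p x < real N2" using reals_Archimedean2 by blast
        have "eventually (\<lambda>i. F i x = 0) sequentially"
          using eventually_ge_at_top[of "max N1 N2"]
        proof eventually_elim
          case (elim i)
          then have "p x \<le> real (i + 1)" "1 / p x \<le> real (i + 1)" using N1 N2 by auto
          then have "c i x = p x"
            using px by (simp add: c_def field_simps)
          then show ?case by (simp add: F_def)
        qed
        then show ?thesis by (rule tendsto_eventually)
      qed
    qed
    show "AE x in \<mu>. norm (F i x) \<le> \<bar>p x * ln (p x)\<bar> + 1" for i
    proof (rule AE_I2)
      fix x
      have "0 \<le> F i x"
        using entropy_Bregman_ge[OF nn[of x] c_pos[of i x]] zero_le_power2[of "sqrt (p x) - sqrt (c i x)"]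
        unfolding F_def by linarith
      moreover have "F i x \<le> \<bar>p x * ln (p x)\<bar> + 1"
      proof -
        consider "p x > real (i + 1)" | "p x < 1 / real (i + 1)" | "c i x = p x"
          unfolding c_def by linarith
        then show ?thesis
        proof cases
          case 1
          moreover have "1 / real (i + 1) \<le> real (i + 1)"
            by (rule order_trans[of _ 1]) auto
          ultimately have c: "c i x = real (i + 1)" unfolding c_def by linarith
          have "0 \<le> p x * ln (c i x)" using nn unfolding c by simp
          then show ?thesis using 1 c unfolding F_def by linarith
        next
          case 2
          moreover have "1 / real (i + 1) \<le> 1" by simp
          moreover have "1 / real (i + 1) \<le> real (i + 1)"
            by (rule order_trans[of _ 1]) auto
          ultimately have c: "c i x = 1 / real (i + 1)" unfolding c_def by linarith
          have "p x * ln (p x) \<le> p x * ln (c i x)"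
          proof (cases "p x = 0")
            case False
            then show ?thesis using 2 nn[of x] unfolding c by (intro mult_left_mono) auto
          qed simp
          then show ?thesis using \<open>1 / real (i + 1) \<le> 1\<close> nn[of x] c unfolding F_def by linarith
        next
          case 3
          then show ?thesis by (simp add: F_def)
        qed
      qed
      ultimately show "norm (F i x) \<le> \<bar>p x * ln (p x)\<bar> + 1" by simp
    qed
    show "F i \<in> borel_measurable \<mu>" for i unfolding F_def by measurable
  qed (use p in auto)
  then have "eventually (\<lambda>i. (\<integral>x. F i x \<partial>\<mu>) < \<eta> / 2) sequentially"
    using eta by (intro order_tendstoD(2)) auto
  then obtain i where i: "(\<integral>x. F i x \<partial>\<mu>) < \<eta> / 2"
    unfolding eventually_sequentially by blast
  define a b where "a = 1 / real (i + 1)" and "b = real (i + 1)"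
  have a: "0 < a" "a \<le> 1" and b: "0 < b" "a \<le> b" by (auto simp: a_def b_def field_simps)
  have cb: "a \<le> c i x" "c i x \<le> b" for x using c_bounds[of i x] by (auto simp: a_def b_def)
  have int_cp: "integrable \<mu> (\<lambda>x. h x * (1 + p x))"
    if "h \<in> borel_measurable \<mu>" "\<And>x. \<bar>h x\<bar> \<le> B" for h B
  proof (rule Bochner_Integration.integrable_bound[where f = "\<lambda>x. B * (1 + p x)"])
    show "AE x in \<mu>. norm (h x * (1 + p x)) \<le> norm (B * (1 + p x))"
      using that(2) nn by (intro AE_I2) (auto simp: abs_mult intro!: mult_right_mono order_trans[OF that(2)])
  qed (use that p in auto)
  \<comment> \<open>The weight 1 + p controls both errors at once: that of the integral of g under
    \<mu>, and that of \<open>ln g\<close> under the measure with density p.\<close>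
  define \<rho> where "\<rho> = density \<mu> (\<lambda>x. ennreal (1 + p x))"
  have "finite_measure \<rho>"
  proof (rule finite_measureI)
    have "emeasure \<rho> (space \<rho>) = (\<integral>\<^sup>+x. ennreal (1 + p x) \<partial>\<mu>)"
      by (simp add: \<rho>_def emeasure_density cong: nn_integral_cong)
    also have "\<dots> = ennreal (\<integral>x. 1 + p x \<partial>\<mu>)"
      using p nn by (intro nn_integral_eq_integral) (auto intro!: AE_I2 add_nonneg_nonneg)
    finally show "emeasure \<rho> (space \<rho>) \<noteq> \<infinity>" by simp
  qed
  moreover have "sets \<rho> = sets borel" by (simp add: \<rho>_def M(2))
  moreover have "integrable \<rho> (c i)"
  proof -
    have "\<bar>c i x\<bar> \<le> b" for x using cb[of x] a by linarith
    then have "integrable \<mu> (\<lambda>x. c i x * (1 + p x))" by (intro int_cp[where B = b]) auto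
    then show ?thesis
      unfolding \<rho>_def using nn
      by (subst integrable_density) (auto simp: mult.commute intro!: AE_I2 add_nonneg_nonneg)
  qed
  \<comment> \<open>The factor a cancels the Lipschitz constant 1 / a of the logarithm on values at
    least a.\<close>
  moreover have "a * \<eta> / 2 > 0" using a eta by simp
  ultimately obtain g0 where g0: "continuous_on UNIV g0" "bounded (range g0)" "(\<integral>x. \<bar>c i x - g0 x\<bar> \<partial>\<rho>) < a * \<eta> / 2"
    by (rule integrable_continuous_approx)
  \<comment> \<open>Clamping keeps continuity and does not increase the distance to
    \<open>c i\<close>, whose values lie between a and b already.\<close>
  define g where "g x = max a (min b (g0 x))" for x
  have g_cont: "continuous_on UNIV g"
    unfolding g_def by (intro continuous_intros g0(1))
  have [measurable]: "g0 \<in> borel_measurable \<mu>" "g \<in> borel_measurable \<mu>"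
    using borel_measurable_continuous_onI[OF g_cont] borel_measurable_continuous_onI[OF g0(1)]
      measurable_cong_sets[OF M(2) refl] by blast+
  have gb: "a \<le> g x" "g x \<le> b" for x using b by (auto simp: g_def)
  have cg: "\<bar>c i x - g x\<bar> \<le> \<bar>c i x - g0 x\<bar>" for x
    using cb[of x] unfolding g_def by linarith
  obtain B where B: "\<And>x. \<bar>g0 x\<bar> \<le> B" using g0(2) by (auto simp: bounded_iff)
  have i0: "integrable \<mu> (\<lambda>x. \<bar>c i x - g0 x\<bar> * (1 + p x))"
  proof (rule int_cp[where B = "b + B"])
    show "\<bar>\<bar>c i x - g0 x\<bar>\<bar> \<le> b + B" for x using cb[of x] B[of x] a by linarith
  qed simp
  have i1: "integrable \<mu> (\<lambda>x. \<bar>c i x - g x\<bar> * (1 + p x))"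
  proof (rule int_cp[where B = "b"])
    show "\<bar>\<bar>c i x - g x\<bar>\<bar> \<le> b" for x using cb[of x] gb[of x] a by linarith
  qed simp
  have int_ln: "integrable \<mu> (\<lambda>x. p x * ln (h x))"
    if [measurable]: "h \<in> borel_measurable \<mu>" and h: "\<And>x. a \<le> h x" "\<And>x. h x \<le> b" for h
  proof (rule Bochner_Integration.integrable_bound[where f = "\<lambda>x. (\<bar>ln a\<bar> + \<bar>ln b\<bar>) * p x"])
    have "\<bar>ln (h x)\<bar> \<le> \<bar>ln a\<bar> + \<bar>ln b\<bar>" for x
    proof -
      have "ln a \<le> ln (h x)" "ln (h x) \<le> ln b" using h[of x] a by auto
      then show ?thesis by linarith
    qed
    then show "AE x in \<mu>. norm (p x * ln (h x)) \<le> norm ((\<bar>ln a\<bar> + \<bar>ln b\<bar>) * p x)"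
      using nn by (intro AE_I2) (auto simp: abs_mult mult.commute intro!: mult_left_mono)
  qed (use p in auto)
  have int_h: "integrable \<mu> h"
    if "h \<in> borel_measurable \<mu>" and h: "\<And>x. a \<le> h x" "\<And>x. h x \<le> b" for h
  proof (rule integrable_const_bound[where B = b])
    show "AE x in \<mu>. norm (h x) \<le> b"
    proof (rule AE_I2)
      show "norm (h x) \<le> b" for x using h[of x] a by simp
    qed
  qed (use that in auto)
  have il: "integrable \<mu> (\<lambda>x. p x * ln (g x))" "integrable \<mu> (\<lambda>x. p x * ln (c i x))"
    by (rule int_ln; use gb cb in simp)+
  have ih: "integrable \<mu> g" "integrable \<mu> (c i)"
    by (rule int_h; use gb cb in simp)+
  have "(\<integral>x. p x * ln (p x) - p x * ln (g x) - p x + g x \<partial>\<mu>) - (\<integral>x. F i x \<partial>\<mu>)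
      = (\<integral>x. (p x * ln (p x) - p x * ln (g x) - p x + g x) - F i x \<partial>\<mu>)"
  proof (rule Bochner_Integration.integral_diff[symmetric])
    show "integrable \<mu> (\<lambda>x. p x * ln (p x) - p x * ln (g x) - p x + g x)"
      by (intro Bochner_Integration.integrable_add Bochner_Integration.integrable_diff p il ih)
    show "integrable \<mu> (F i)"
      unfolding F_def by (intro Bochner_Integration.integrable_add Bochner_Integration.integrable_diff p il ih)
  qed
  also have "\<dots> = (\<integral>x. p x * ln (c i x) - p x * ln (g x) + (g x - c i x) \<partial>\<mu>)"
    unfolding F_def by (intro Bochner_Integration.integral_cong) auto
  also have "\<dots> \<le> (\<integral>x. (1 / a) * (\<bar>c i x - g x\<bar> * (1 + p x)) \<partial>\<mu>)"
  proof (rule integral_mono)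
    show "integrable \<mu> (\<lambda>x. p x * ln (c i x) - p x * ln (g x) + (g x - c i x))"
      by (intro Bochner_Integration.integrable_add Bochner_Integration.integrable_diff il ih)
    show "integrable \<mu> (\<lambda>x. (1 / a) * (\<bar>c i x - g x\<bar> * (1 + p x)))" using i1 by simp
    fix x
    have gx: "g x > 0" "c i x > 0" using gb(1)[of x] cb(1)[of x] a by auto
    have "ln (c i x) - ln (g x) = ln (c i x / g x)" using gx by (simp add: ln_div)
    also have "\<dots> \<le> c i x / g x - 1" using gx by (intro ln_le_minus_one) simp
    also have "\<dots> = (c i x - g x) / g x" using gx by (simp add: field_simps)
    also have "\<dots> \<le> \<bar>c i x - g x\<bar> / g x" using gx by (intro divide_right_mono) auto
    also have "\<dots> \<le> \<bar>c i x - g x\<bar> / a" using gb(1)[of x] a gx by (intro divide_left_mono) auto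
    finally have "p x * (ln (c i x) - ln (g x)) \<le> p x * (\<bar>c i x - g x\<bar> / a)"
      using nn by (intro mult_left_mono) auto
    moreover have "g x - c i x \<le> \<bar>c i x - g x\<bar> / a"
    proof -
      have "\<bar>c i x - g x\<bar> * 1 \<le> \<bar>c i x - g x\<bar> * (1 / a)" using a by (intro mult_left_mono) auto
      then show ?thesis by simp
    qed
    ultimately show "p x * ln (c i x) - p x * ln (g x) + (g x - c i x) \<le> (1 / a) * (\<bar>c i x - g x\<bar> * (1 + p x))"
      by (simp add: algebra_simps add_divide_distrib)
  qed
  also have "\<dots> \<le> (1 / a) * (\<integral>x. \<bar>c i x - g0 x\<bar> * (1 + p x) \<partial>\<mu>)"
    unfolding integral_mult_right_zero using a nn i0 i1 cg
    by (intro mult_left_mono integral_mono mult_right_mono) (auto intro: add_nonneg_nonneg)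
  also have "(\<integral>x. \<bar>c i x - g0 x\<bar> * (1 + p x) \<partial>\<mu>) = (\<integral>x. \<bar>c i x - g0 x\<bar> \<partial>\<rho>)"
    unfolding \<rho>_def using nn by (subst integral_density) (auto simp: mult.commute intro!: AE_I2 add_nonneg_nonneg)
  also have "(1 / a) * \<dots> < \<eta> / 2"
    using g0(3) a by (simp add: field_simps)
  finally have "(\<integral>x. p x * ln (p x) - p x * ln (g x) - p x + g x \<partial>\<mu>) < \<eta>"
    using i by linarith
  then show ?thesis using that[OF g_cont a(1) gb] by blast
qed

section \<open>From finite entropy to Hellinger distance\<close>

lemma D_KL_density_obtain:
  assumes M: "finite_measure \<mu>" and N: "prob_space \<nu>" "sets \<nu> = sets \<mu>" and fin: "D_KL \<nu> \<mu> < \<infinity>"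
  obtains p where "p \<in> borel_measurable \<mu>" "\<And>x. 0 \<le> p x" "\<nu> = density \<mu> (\<lambda>x. ennreal (p x))"
    "integrable \<mu> p" "integrable \<mu> (\<lambda>x. p x * ln (p x))" "D_KL \<nu> \<mu> = ereal (\<integral>x. p x * ln (p x) \<partial>\<mu>)"
proof -
  interpret M: finite_measure \<mu> by fact
  interpret N: prob_space \<nu> by fact
  have ac: "absolutely_continuous \<mu> \<nu>" and int: "integrable \<nu> (entropy_density (exp 1) \<mu> \<nu>)"
    and KL: "D_KL \<nu> \<mu> = ereal (KL_divergence (exp 1) \<mu> \<nu>)"
    using fin unfolding D_KL_def by (auto split: if_splits)
  define p where "p x = enn2real (RN_deriv \<mu> \<nu> x)" for x
  have [measurable]: "p \<in> borel_measurable \<mu>" unfolding p_def by measurable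
  have nn: "0 \<le> p x" for x by (simp add: p_def)
  have fin: "AE x in \<mu>. RN_deriv \<mu> \<nu> x \<noteq> \<infinity>"
    using N.sigma_finite_measure_axioms ac N(2) by (rule M.RN_deriv_finite)
  have "\<nu> = density \<mu> (RN_deriv \<mu> \<nu>)"
    using M.density_RN_deriv[OF ac N(2)] by simp
  also have "\<dots> = density \<mu> (\<lambda>x. ennreal (p x))"
    using fin by (intro density_cong) (auto simp: p_def less_top elim!: eventually_mono)
  finally have dens: "\<nu> = density \<mu> (\<lambda>x. ennreal (p x))" .
  have ed: "entropy_density (exp 1) \<mu> \<nu> = (\<lambda>x. ln (p x))"
    by (auto simp: entropy_density_def p_def log_def)
  have "integrable (density \<mu> (\<lambda>x. ennreal (p x))) (\<lambda>x. ln (p x))"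
    using int dens ed by simp
  then have i1: "integrable \<mu> (\<lambda>x. p x * ln (p x))"
    by (subst (asm) integrable_density) (auto simp: nn)
  have "integrable (density \<mu> (\<lambda>x. ennreal (p x))) (\<lambda>x. 1 :: real)"
    using dens N.integrable_const by metis
  then have i2: "integrable \<mu> p"
    by (subst (asm) integrable_density) (auto simp: nn)
  have "KL_divergence (exp 1) \<mu> \<nu> = (\<integral>x. ln (p x) \<partial>density \<mu> (\<lambda>x. ennreal (p x)))"
    using dens ed by (simp add: KL_divergence_def)
  also have "\<dots> = (\<integral>x. p x * ln (p x) \<partial>\<mu>)"
    by (subst integral_density) (auto simp: nn)
  finally have "D_KL \<nu> \<mu> = ereal (\<integral>x. p x * ln (p x) \<partial>\<mu>)" using KL by simp
  then show ?thesis using that dens nn i1 i2 by blast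
qed

text \<open>Comparing every density with one bounded continuous function avoids the lower semicontinuity
  of the relative entropy: the divergence from such a function passes to the weak limit.\<close>

lemma weak_entropy_convergence_imp_Hellinger_Cauchy:
  fixes \<mu> :: "'a::{second_countable_topology, complete_space} measure"
  assumes M: "finite_measure \<mu>" "sets \<mu> = sets borel"
    and p: "\<And>n. p n \<in> borel_measurable \<mu>" "\<And>n x. 0 \<le> p n x" "\<And>n. integrable \<mu> (p n)"
      "\<And>n. integrable \<mu> (\<lambda>x. p n x * ln (p n x))" "\<And>n. \<nu> n = density \<mu> (\<lambda>x. ennreal (p n x))"
    and q: "q \<in> borel_measurable \<mu>" "\<And>x. 0 \<le> q x" "integrable \<mu> q"
      "integrable \<mu> (\<lambda>x. q x * ln (q x))" "\<nu>s = density \<mu> (\<lambda>x. ennreal (q x))"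
    and prob: "\<And>n. prob_space (\<nu> n)" "prob_space \<nu>s"
    and weak: "weakly_converges \<nu> \<nu>s"
    and ent: "(\<lambda>n. \<integral>x. p n x * ln (p n x) \<partial>\<mu>) \<longlonglongrightarrow> (\<integral>x. q x * ln (q x) \<partial>\<mu>)"
    and e: "e > 0"
  obtains N where "\<And>n k. n \<ge> N \<Longrightarrow> k \<ge> N \<Longrightarrow> (\<integral>x. (sqrt (p n x) - sqrt (p k x))\<^sup>2 \<partial>\<mu>) < e"
proof -
  interpret finite_measure \<mu> by fact
  note [measurable] = p(1) q(1)
  \<comment> \<open>A quarter of e, because the distances of two members from g both enter with a
    factor 2.\<close>
  obtain g a b where g: "continuous_on UNIV g" "0 < a" "\<And>x. a \<le> g x" "\<And>x. g x \<le> b"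
    "(\<integral>x. q x * ln (q x) - q x * ln (g x) - q x + g x \<partial>\<mu>) < e / 4"
    using entropy_continuous_approx[OF M q(1-4), of "e / 4"] e by auto
  have gpos: "g x > 0" for x using g(2) g(3)[of x] by linarith
  have [measurable]: "g \<in> borel_measurable \<mu>"
    using borel_measurable_continuous_onI[OF g(1)] measurable_cong_sets[OF M(2) refl] by blast
  have ln_cont: "continuous_on UNIV (\<lambda>x. ln (g x))"
    using gpos by (intro continuous_intros g(1)) (auto simp: less_imp_neq[symmetric])
  have ln_b: "\<bar>ln (g x)\<bar> \<le> \<bar>ln a\<bar> + \<bar>ln b\<bar>" for x
  proof -
    have "ln a \<le> ln (g x)" "ln (g x) \<le> ln b" using g(2) g(3)[of x] g(4)[of x] gpos[of x] by auto
    then show ?thesis by linarith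
  qed
  have ln_bounded: "bounded (range (\<lambda>x. ln (g x)))"
    using ln_b by (auto simp: bounded_iff)
  have ig: "integrable \<mu> g"
  proof (rule integrable_const_bound[where B = b])
    show "AE x in \<mu>. norm (g x) \<le> b"
      using g(4) gpos by (intro AE_I2) (simp add: abs_of_pos)
  qed simp
  \<comment> \<open>Only two terms depend on r: the entropy, and the integral of the bounded
    continuous function \<open>ln g\<close> under the measure with density r. The 1 is the mass of
    that measure.\<close>
  have expand: "integrable \<mu> (\<lambda>x. r x * ln (r x) - r x * ln (g x) - r x + g x)"
      "(\<integral>x. r x * ln (r x) - r x * ln (g x) - r x + g x \<partial>\<mu>)
        = (\<integral>x. r x * ln (r x) \<partial>\<mu>) - (\<integral>x. ln (g x) \<partial>density \<mu> (\<lambda>x. ennreal (r x))) - 1 + (\<integral>x. g x \<partial>\<mu>)"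
    if [measurable]: "r \<in> borel_measurable \<mu>" and r: "\<And>x. 0 \<le> r x" "integrable \<mu> r" "integrable \<mu> (\<lambda>x. r x * ln (r x))"
      "prob_space (density \<mu> (\<lambda>x. ennreal (r x)))" for r
  proof -
    interpret R: prob_space "density \<mu> (\<lambda>x. ennreal (r x))" by (rule r(4))
    have irl: "integrable \<mu> (\<lambda>x. r x * ln (g x))"
    proof (rule Bochner_Integration.integrable_bound[where f = "\<lambda>x. (\<bar>ln a\<bar> + \<bar>ln b\<bar>) * r x"])
      show "AE x in \<mu>. norm (r x * ln (g x)) \<le> norm ((\<bar>ln a\<bar> + \<bar>ln b\<bar>) * r x)"
        using r(1) ln_b by (intro AE_I2) (auto simp: abs_mult mult.commute intro!: mult_left_mono)
    qed (use r in auto)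
    show "integrable \<mu> (\<lambda>x. r x * ln (r x) - r x * ln (g x) - r x + g x)"
      using r irl ig by simp
    have "1 = (\<integral>x. (1 :: real) \<partial>density \<mu> (\<lambda>x. ennreal (r x)))"
      using R.prob_space by simp
    also have "\<dots> = (\<integral>x. r x \<partial>\<mu>)" using r(1) by (subst integral_density) auto
    finally have one: "(\<integral>x. r x \<partial>\<mu>) = 1" by simp
    have "(\<integral>x. ln (g x) \<partial>density \<mu> (\<lambda>x. ennreal (r x))) = (\<integral>x. r x * ln (g x) \<partial>\<mu>)"
      using r(1) by (subst integral_density) auto
    then show "(\<integral>x. r x * ln (r x) - r x * ln (g x) - r x + g x \<partial>\<mu>)
        = (\<integral>x. r x * ln (r x) \<partial>\<mu>) - (\<integral>x. ln (g x) \<partial>density \<mu> (\<lambda>x. ennreal (r x))) - 1 + (\<integral>x. g x \<partial>\<mu>)"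
      using r irl ig one by simp
  qed
  have sqrt_int: "integrable \<mu> (\<lambda>x. (sqrt (p n x) - sqrt (g x))\<^sup>2)" for n
  proof (rule Bochner_Integration.integrable_bound)
    show "integrable \<mu> (\<lambda>x. p n x * ln (p n x) - p n x * ln (g x) - p n x + g x)"
      using p prob(1)[of n] by (intro expand) auto
    show "AE x in \<mu>. norm ((sqrt (p n x) - sqrt (g x))\<^sup>2) \<le> norm (p n x * ln (p n x) - p n x * ln (g x) - p n x + g x)"
      using entropy_Bregman_ge[OF p(2) gpos] by (intro AE_I2) (simp add: abs_le_iff order_trans[OF _ abs_ge_self])
  qed simp
  have bound: "(\<integral>x. (sqrt (p n x) - sqrt (g x))\<^sup>2 \<partial>\<mu>)
      \<le> (\<integral>x. p n x * ln (p n x) \<partial>\<mu>) - (\<integral>x. ln (g x) \<partial>\<nu> n) - 1 + (\<integral>x. g x \<partial>\<mu>)" for n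
  proof -
    have "(\<integral>x. (sqrt (p n x) - sqrt (g x))\<^sup>2 \<partial>\<mu>) \<le> (\<integral>x. p n x * ln (p n x) - p n x * ln (g x) - p n x + g x \<partial>\<mu>)"
      using p prob(1)[of n] sqrt_int entropy_Bregman_ge[OF p(2) gpos] by (intro integral_mono expand) auto
    also have "\<dots> = (\<integral>x. p n x * ln (p n x) \<partial>\<mu>) - (\<integral>x. ln (g x) \<partial>\<nu> n) - 1 + (\<integral>x. g x \<partial>\<mu>)"
      unfolding p(5) using p prob(1)[of n] by (intro expand) auto
    finally show ?thesis .
  qed
  have "(\<lambda>n. \<integral>x. ln (g x) \<partial>\<nu> n) \<longlonglongrightarrow> (\<integral>x. ln (g x) \<partial>\<nu>s)"
    using weak ln_cont ln_bounded unfolding weakly_converges_def by blast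
  then have "(\<lambda>n. (\<integral>x. p n x * ln (p n x) \<partial>\<mu>) - (\<integral>x. ln (g x) \<partial>\<nu> n) - 1 + (\<integral>x. g x \<partial>\<mu>))
     \<longlonglongrightarrow> (\<integral>x. q x * ln (q x) \<partial>\<mu>) - (\<integral>x. ln (g x) \<partial>\<nu>s) - 1 + (\<integral>x. g x \<partial>\<mu>)"
    by (intro tendsto_intros ent)
  moreover have "(\<integral>x. q x * ln (q x) \<partial>\<mu>) - (\<integral>x. ln (g x) \<partial>\<nu>s) - 1 + (\<integral>x. g x \<partial>\<mu>) < e / 4"
    using g(5) expand(2)[of q] q prob(2) by simp
  ultimately have "eventually (\<lambda>n. (\<integral>x. p n x * ln (p n x) \<partial>\<mu>) - (\<integral>x. ln (g x) \<partial>\<nu> n) - 1 + (\<integral>x. g x \<partial>\<mu>) < e / 4) sequentially"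
    by (rule order_tendstoD(2))
  then obtain N where "\<And>n. n \<ge> N \<Longrightarrow> (\<integral>x. p n x * ln (p n x) \<partial>\<mu>) - (\<integral>x. ln (g x) \<partial>\<nu> n) - 1 + (\<integral>x. g x \<partial>\<mu>) < e / 4"
    by (auto simp: eventually_sequentially)
  then have N: "(\<integral>x. (sqrt (p n x) - sqrt (g x))\<^sup>2 \<partial>\<mu>) < e / 4" if "n \<ge> N" for n
    using bound[of n] that by force
  have "(\<integral>x. (sqrt (p n x) - sqrt (p k x))\<^sup>2 \<partial>\<mu>) < e" if "n \<ge> N" "k \<ge> N" for n k
  proof -
    have tri: "(u - v)\<^sup>2 \<le> 2 * (u - w)\<^sup>2 + 2 * (v - w)\<^sup>2" for u v w :: real
      using zero_le_power2[of "u + v - 2 * w"] by (simp add: power2_eq_square algebra_simps)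
    have "(\<integral>x. (sqrt (p n x) - sqrt (p k x))\<^sup>2 \<partial>\<mu>)
        \<le> (\<integral>x. 2 * (sqrt (p n x) - sqrt (g x))\<^sup>2 + 2 * (sqrt (p k x) - sqrt (g x))\<^sup>2 \<partial>\<mu>)"
    proof (rule integral_mono')
      show "integrable \<mu> (\<lambda>x. 2 * (sqrt (p n x) - sqrt (g x))\<^sup>2 + 2 * (sqrt (p k x) - sqrt (g x))\<^sup>2)"
        using sqrt_int by simp
    qed (use tri in auto)
    also have "\<dots> = 2 * (\<integral>x. (sqrt (p n x) - sqrt (g x))\<^sup>2 \<partial>\<mu>) + 2 * (\<integral>x. (sqrt (p k x) - sqrt (g x))\<^sup>2 \<partial>\<mu>)"
      using sqrt_int by simp
    also have "\<dots> < e" using N[OF that(1)] N[OF that(2)] by linarith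
    finally show ?thesis .
  qed
  then show ?thesis by (rule that)
qed

text \<open>Factor p - r = (sqrt p - sqrt r) (sqrt p + sqrt r). Cauchy--Schwarz separates the
  Hellinger factor from one that the second moments of q bound.\<close>

lemma Hellinger_expectation_diff:
  assumes [measurable]: "p \<in> borel_measurable \<mu>" "r \<in> borel_measurable \<mu>" "q \<in> borel_measurable \<mu>"
    and nn: "\<And>x. 0 \<le> p x" "\<And>x. 0 \<le> r x" and int: "integrable \<mu> p" "integrable \<mu> r"
    and q1: "integrable (density \<mu> (\<lambda>x. ennreal (p x))) q" "integrable (density \<mu> (\<lambda>x. ennreal (p x))) (\<lambda>x. (q x)\<^sup>2)"
    and q2: "integrable (density \<mu> (\<lambda>x. ennreal (r x))) q" "integrable (density \<mu> (\<lambda>x. ennreal (r x))) (\<lambda>x. (q x)\<^sup>2)"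
  shows "((\<integral>x. q x \<partial>density \<mu> (\<lambda>x. ennreal (p x))) - (\<integral>x. q x \<partial>density \<mu> (\<lambda>x. ennreal (r x))))\<^sup>2
    \<le> 2 * (\<integral>x. (sqrt (p x) - sqrt (r x))\<^sup>2 \<partial>\<mu>) *
      ((\<integral>x. (q x)\<^sup>2 \<partial>density \<mu> (\<lambda>x. ennreal (p x))) + (\<integral>x. (q x)\<^sup>2 \<partial>density \<mu> (\<lambda>x. ennreal (r x))))"
proof -
  note [simp] = nn
  have i: "integrable \<mu> (\<lambda>x. p x * q x)" "integrable \<mu> (\<lambda>x. p x * (q x)\<^sup>2)"
      "integrable \<mu> (\<lambda>x. r x * q x)" "integrable \<mu> (\<lambda>x. r x * (q x)\<^sup>2)"
    using q1 q2 by (auto simp: integrable_density)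
  have d: "(sqrt (p x) - sqrt (r x))\<^sup>2 \<le> 2 * p x + 2 * r x" for x
  proof -
    have "(u - v)\<^sup>2 \<le> 2 * u\<^sup>2 + 2 * v\<^sup>2" for u v :: real
      using zero_le_power2[of "u + v"] by (simp add: power2_eq_square algebra_simps)
    from this[of "sqrt (p x)" "sqrt (r x)"] show ?thesis by simp
  qed
  have s: "(q x * (sqrt (p x) + sqrt (r x)))\<^sup>2 \<le> 2 * (p x * (q x)\<^sup>2) + 2 * (r x * (q x)\<^sup>2)" for x
  proof -
    have "(u + v)\<^sup>2 \<le> 2 * u\<^sup>2 + 2 * v\<^sup>2" for u v :: real
      using zero_le_power2[of "u - v"] by (simp add: power2_eq_square algebra_simps)
    from this[of "sqrt (p x)" "sqrt (r x)"] have "(sqrt (p x) + sqrt (r x))\<^sup>2 \<le> 2 * p x + 2 * r x" by simp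
    then have "(q x)\<^sup>2 * (sqrt (p x) + sqrt (r x))\<^sup>2 \<le> (q x)\<^sup>2 * (2 * p x + 2 * r x)"
      by (intro mult_left_mono) auto
    then show ?thesis unfolding power_mult_distrib by (simp add: algebra_simps)
  qed
  have i1: "integrable \<mu> (\<lambda>x. (sqrt (p x) - sqrt (r x))\<^sup>2)"
  proof (rule Bochner_Integration.integrable_bound)
    show "integrable \<mu> (\<lambda>x. 2 * p x + 2 * r x)" using int by simp
    show "AE x in \<mu>. norm ((sqrt (p x) - sqrt (r x))\<^sup>2) \<le> norm (2 * p x + 2 * r x)"
      using d by (intro AE_I2) (simp add: order_trans[OF _ abs_ge_self])
  qed simp
  have i2: "integrable \<mu> (\<lambda>x. (q x * (sqrt (p x) + sqrt (r x)))\<^sup>2)"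
  proof (rule Bochner_Integration.integrable_bound)
    show "integrable \<mu> (\<lambda>x. 2 * (p x * (q x)\<^sup>2) + 2 * (r x * (q x)\<^sup>2))" using i by simp
    show "AE x in \<mu>. norm ((q x * (sqrt (p x) + sqrt (r x)))\<^sup>2) \<le> norm (2 * (p x * (q x)\<^sup>2) + 2 * (r x * (q x)\<^sup>2))"
      using s by (intro AE_I2) (simp add: order_trans[OF _ abs_ge_self])
  qed simp
  have "(\<integral>x. q x \<partial>density \<mu> (\<lambda>x. ennreal (p x))) - (\<integral>x. q x \<partial>density \<mu> (\<lambda>x. ennreal (r x)))
      = (\<integral>x. p x * q x \<partial>\<mu>) - (\<integral>x. r x * q x \<partial>\<mu>)"
    by (simp add: integral_density)
  also have "\<dots> = (\<integral>x. p x * q x - r x * q x \<partial>\<mu>)"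
    using i by simp
  also have "\<dots> = (\<integral>x. (sqrt (p x) - sqrt (r x)) * (q x * (sqrt (p x) + sqrt (r x))) \<partial>\<mu>)"
  proof (intro Bochner_Integration.integral_cong refl)
    fix x
    have "(sqrt (p x) - sqrt (r x)) * (sqrt (p x) + sqrt (r x)) = p x - r x"
      by (simp add: algebra_simps)
    then show "p x * q x - r x * q x = (sqrt (p x) - sqrt (r x)) * (q x * (sqrt (p x) + sqrt (r x)))"
      by (metis left_diff_distrib mult.commute mult.left_commute)
  qed
  finally have "((\<integral>x. q x \<partial>density \<mu> (\<lambda>x. ennreal (p x))) - (\<integral>x. q x \<partial>density \<mu> (\<lambda>x. ennreal (r x))))\<^sup>2
    \<le> (\<integral>x. (sqrt (p x) - sqrt (r x))\<^sup>2 \<partial>\<mu>) * (\<integral>x. (q x * (sqrt (p x) + sqrt (r x)))\<^sup>2 \<partial>\<mu>)"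
    using integral_Cauchy_Schwarz(2)[OF _ _ i1 i2] by simp
  also have "\<dots> \<le> (\<integral>x. (sqrt (p x) - sqrt (r x))\<^sup>2 \<partial>\<mu>) * (\<integral>x. 2 * (p x * (q x)\<^sup>2) + 2 * (r x * (q x)\<^sup>2) \<partial>\<mu>)"
    using i i2 s by (intro mult_left_mono integral_mono) auto
  also have "(\<integral>x. 2 * (p x * (q x)\<^sup>2) + 2 * (r x * (q x)\<^sup>2) \<partial>\<mu>)
      = 2 * ((\<integral>x. (q x)\<^sup>2 \<partial>density \<mu> (\<lambda>x. ennreal (p x))) + (\<integral>x. (q x)\<^sup>2 \<partial>density \<mu> (\<lambda>x. ennreal (r x))))"
    using i by (simp add: integral_density)
  finally show ?thesis by (simp only: mult.assoc mult.left_commute[of _ 2])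
qed

section \<open>Comparison of Gaussian measures\<close>

text \<open>H stands for the squared Hellinger distance. Recording only its effect on test functions
  keeps densities out of the comparison of Gaussian measures.\<close>

definition second_moment_close :: "'a measure \<Rightarrow> 'a measure \<Rightarrow> real \<Rightarrow> bool" where
  "second_moment_close \<nu> \<nu>' H \<longleftrightarrow> (\<forall>q :: 'a \<Rightarrow> real.
     q \<in> borel_measurable \<nu> \<longrightarrow> integrable \<nu> q \<longrightarrow> integrable \<nu> (\<lambda>x. (q x)\<^sup>2) \<longrightarrow>
     integrable \<nu>' q \<longrightarrow> integrable \<nu>' (\<lambda>x. (q x)\<^sup>2) \<longrightarrow>
     ((\<integral>x. q x \<partial>\<nu>) - (\<integral>x. q x \<partial>\<nu>'))\<^sup>2 \<le> 2 * H * ((\<integral>x. (q x)\<^sup>2 \<partial>\<nu>) + (\<integral>x. (q x)\<^sup>2 \<partial>\<nu>')))"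

lemma second_moment_closeD:
  assumes "second_moment_close \<nu> \<nu>' H"
    and "has_bochner_integral \<nu> q a" "has_bochner_integral \<nu> (\<lambda>x. (q x)\<^sup>2) b"
    and "has_bochner_integral \<nu>' q a'" "has_bochner_integral \<nu>' (\<lambda>x. (q x)\<^sup>2) b'"
  shows "(a - a')\<^sup>2 \<le> 2 * H * (b + b')"
proof -
  have "q \<in> borel_measurable \<nu>" "integrable \<nu> q" "integrable \<nu> (\<lambda>x. (q x)\<^sup>2)"
    "integrable \<nu>' q" "integrable \<nu>' (\<lambda>x. (q x)\<^sup>2)"
    using assms(2-5) by (auto simp: has_bochner_integral_iff)
  then have "((\<integral>x. q x \<partial>\<nu>) - (\<integral>x. q x \<partial>\<nu>'))\<^sup>2 \<le> 2 * H * ((\<integral>x. (q x)\<^sup>2 \<partial>\<nu>) + (\<integral>x. (q x)\<^sup>2 \<partial>\<nu>'))"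
    using assms(1) unfolding second_moment_close_def by blast
  then show ?thesis using assms(2-5) by (simp add: has_bochner_integral_iff)
qed

lemma second_moment_close_Hellinger:
  assumes "p \<in> borel_measurable \<mu>" "r \<in> borel_measurable \<mu>"
    and "\<And>x. 0 \<le> p x" "\<And>x. 0 \<le> r x" and "integrable \<mu> p" "integrable \<mu> r"
  shows "second_moment_close (density \<mu> (\<lambda>x. ennreal (p x))) (density \<mu> (\<lambda>x. ennreal (r x)))
    (\<integral>x. (sqrt (p x) - sqrt (r x))\<^sup>2 \<partial>\<mu>)"
  unfolding second_moment_close_def
  by (intro allI impI Hellinger_expectation_diff assms) (use assms in auto)

text \<open>The constant c makes the test function centred under \<nu>, so s is its expectation
  under \<nu>'. Expanding around m' instead of m creates the linear form l and the terms
  \<open>(f j \<bullet> \<delta>) * (g j \<bullet> \<delta>)\<close>.\<close>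

lemma gaussian_quadratic_close:
  fixes f g :: "'i \<Rightarrow> 'h::real_inner" and J :: "'i set"
  assumes close: "second_moment_close \<nu> \<nu>' H"
    and G: "is_gaussian \<nu> m C" and G': "is_gaussian \<nu>' m' C'"
  defines "\<delta> \<equiv> m' - m"
  defines "s \<equiv> \<Sum>j\<in>J. f j \<bullet> C' (g j) - f j \<bullet> C (g j) + (f j \<bullet> \<delta>) * (g j \<bullet> \<delta>)"
    and "l \<equiv> \<Sum>j\<in>J. (f j \<bullet> \<delta>) *\<^sub>R g j + (g j \<bullet> \<delta>) *\<^sub>R f j"
    and "V \<equiv> \<lambda>D. \<Sum>i\<in>J. \<Sum>j\<in>J. (f i \<bullet> D (f j)) * (g i \<bullet> D (g j))
          + (f i \<bullet> D (g j)) * (g i \<bullet> D (f j))"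
  shows "s\<^sup>2 \<le> 2 * H * (V C + V C' + l \<bullet> C' l + s\<^sup>2)"
proof -
  define c where "c = - (\<Sum>j\<in>J. f j \<bullet> C (g j))"
  define c' where "c' = (\<Sum>j\<in>J. (f j \<bullet> \<delta>) * (g j \<bullet> \<delta>)) + c"
  define q where "q x = (\<Sum>j\<in>J. (f j \<bullet> (x - m)) * (g j \<bullet> (x - m))) + 0 \<bullet> (x - m) + c" for x
  have q': "q = (\<lambda>x. (\<Sum>j\<in>J. (f j \<bullet> (x - m')) * (g j \<bullet> (x - m'))) + l \<bullet> (x - m') + c')"
  proof
    fix x
    have "x - m = (x - m') + \<delta>" by (simp add: \<delta>_def)
    then have "(f j \<bullet> (x - m)) * (g j \<bullet> (x - m)) = (f j \<bullet> (x - m')) * (g j \<bullet> (x - m'))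
        + ((f j \<bullet> \<delta>) *\<^sub>R g j + (g j \<bullet> \<delta>) *\<^sub>R f j) \<bullet> (x - m') + (f j \<bullet> \<delta>) * (g j \<bullet> \<delta>)" for j
      by (simp add: inner_add_right inner_add_left algebra_simps)
    then show "q x = (\<Sum>j\<in>J. (f j \<bullet> (x - m')) * (g j \<bullet> (x - m'))) + l \<bullet> (x - m') + c'"
      by (simp add: q_def l_def c'_def inner_sum_left inner_add_left sum.distrib)
  qed
  have E: "(\<Sum>j\<in>J. f j \<bullet> C (g j)) + c = 0" by (simp add: c_def)
  have E': "(\<Sum>j\<in>J. f j \<bullet> C' (g j)) + c' = s"
    by (simp add: c'_def c_def s_def sum.distrib sum_subtractf)
  have "has_bochner_integral \<nu> q 0" "has_bochner_integral \<nu> (\<lambda>x. (q x)\<^sup>2) (V C)"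
    using gaussian_quadratic_moments[OF G, where f = f and g = g and J = J and l = 0 and c = c]
    unfolding E V_def q_def by auto
  moreover have "has_bochner_integral \<nu>' q s"
      "has_bochner_integral \<nu>' (\<lambda>x. (q x)\<^sup>2) (V C' + l \<bullet> C' l + s\<^sup>2)"
    using gaussian_quadratic_moments[OF G', where f = f and g = g and J = J and l = l and c = c']
    unfolding E' V_def q' by auto
  ultimately have "(0 - s)\<^sup>2 \<le> 2 * H * (V C + (V C' + l \<bullet> C' l + s\<^sup>2))"
    by (rule second_moment_closeD[OF close])
  then show ?thesis by (simp add: add.assoc)
qed

lemma gaussian_mean_close:
  assumes close: "second_moment_close \<nu> \<nu>' H"
    and G: "is_gaussian \<nu> m C" and G': "is_gaussian \<nu>' m' C'"
  shows "(h \<bullet> (m' - m))\<^sup>2 \<le> 2 * H * (h \<bullet> C h + h \<bullet> C' h + (h \<bullet> (m' - m))\<^sup>2)"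
proof -
  define q where "q x = h \<bullet> (x - m)" for x
  \<comment> \<open>A quadratic part over the empty index set, so that
    \<open>gaussian_quadratic_moments\<close> yields the moments under \<nu>'.\<close>
  have q': "q = (\<lambda>x. (\<Sum>j\<in>({}::nat set). (h \<bullet> (x - m')) * (h \<bullet> (x - m'))) + h \<bullet> (x - m') + h \<bullet> (m' - m))"
    by (auto simp: q_def inner_diff_right)
  have "has_bochner_integral \<nu> q 0" "has_bochner_integral \<nu> (\<lambda>x. (q x)\<^sup>2) (h \<bullet> C h)"
    unfolding q_def by (intro gaussian_moments[OF G])+
  moreover have "has_bochner_integral \<nu>' q (h \<bullet> (m' - m))"
      "has_bochner_integral \<nu>' (\<lambda>x. (q x)\<^sup>2) (h \<bullet> C' h + (h \<bullet> (m' - m))\<^sup>2)"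
    using gaussian_quadratic_moments[OF G', where f = "\<lambda>_. h" and g = "\<lambda>_. h" and J = "{} :: nat set" and l = h and c = "h \<bullet> (m' - m)"]
    unfolding q' by auto
  ultimately have "(0 - h \<bullet> (m' - m))\<^sup>2 \<le> 2 * H * (h \<bullet> C h + (h \<bullet> C' h + (h \<bullet> (m' - m))\<^sup>2))"
    by (rule second_moment_closeD[OF close])
  then show ?thesis by (simp add: add.assoc)
qed

text \<open>The quadratic test with the single square of h. For small H its inequality forces
  \<open>s \<le> a\<close>, where s is the change of variance plus the square of the shift of the
  mean; dropping that square leaves the claim. Used in both directions between two members of the
  sequence.\<close>

lemma gaussian_variance_close:
  assumes close: "second_moment_close \<nu> \<nu>' H" and H: "H \<le> 1 / 100"
    and G: "is_gaussian \<nu> m C" and G': "is_gaussian \<nu>' m' C'"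
  shows "h \<bullet> C' h \<le> 2 * (h \<bullet> C h)"
proof -
  define a a' t s where "a = h \<bullet> C h" and "a' = h \<bullet> C' h"
    and "t = h \<bullet> (m' - m)" and "s = a' - a + t\<^sup>2"
  have a: "0 \<le> a" "0 \<le> a'" using gaussian_marginal(1)[OF G] gaussian_marginal(1)[OF G'] by (auto simp: a_def a'_def)
  have l: "(t *\<^sub>R h + t *\<^sub>R h) \<bullet> C' (t *\<^sub>R h + t *\<^sub>R h) = 4 * t\<^sup>2 * a'"
    by (simp add: a'_def blinfun.bilinear_simps inner_add_left inner_add_right power2_eq_square)
  have "s\<^sup>2 \<le> 2 * H * ((a * a + a * a) + (a' * a' + a' * a') + 4 * t\<^sup>2 * a' + s\<^sup>2)"
    using gaussian_quadratic_close[OF close G G', where J = "{0::nat}" and f = "\<lambda>_. h" and g = "\<lambda>_. h"] l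
    by (simp add: a_def a'_def t_def s_def power2_eq_square)
  \<comment> \<open>With 1/100 the s^2 on the right is absorbed: 50 s^2 \<le> 6 a^2 + 5 s^2.\<close>
  also have "\<dots> \<le> 2 * (1 / 100) * (6 * a\<^sup>2 + 5 * s\<^sup>2)"
  proof (rule mult_mono)
    have "(a' + t\<^sup>2)\<^sup>2 = (s + a)\<^sup>2" by (simp add: s_def)
    moreover have "(s + a)\<^sup>2 \<le> 2 * s\<^sup>2 + 2 * a\<^sup>2"
      using zero_le_power2[of "s - a"] by (simp add: power2_eq_square algebra_simps)
    moreover have "(a' * a' + a' * a') + 4 * t\<^sup>2 * a' \<le> 2 * (a' + t\<^sup>2)\<^sup>2"
      using zero_le_power2[of "t\<^sup>2"] by (simp add: power2_eq_square algebra_simps)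
    ultimately show "(a * a + a * a) + (a' * a' + a' * a') + 4 * t\<^sup>2 * a' + s\<^sup>2 \<le> 6 * a\<^sup>2 + 5 * s\<^sup>2"
      by (simp add: power2_eq_square)
    show "0 \<le> (a * a + a * a) + (a' * a' + a' * a') + 4 * t\<^sup>2 * a' + s\<^sup>2" using a by simp
  qed (use H in auto)
  finally have "15 * s\<^sup>2 \<le> 2 * a\<^sup>2" by simp
  then have "s\<^sup>2 \<le> a\<^sup>2" using zero_le_power2[of a] zero_le_power2[of s] by linarith
  then have "s \<le> a" using a(1) by (rule power2_le_imp_le)
  then show ?thesis using zero_le_power2[of t] unfolding s_def a_def a'_def by linarith
qed

section \<open>Hilbert--Schmidt bounds\<close>

lemma orthonormal_basisD:
  assumes "orthonormal_basis E"
  shows "e \<in> E \<Longrightarrow> norm e = 1" "e \<in> E \<Longrightarrow> e' \<in> E \<Longrightarrow> e \<bullet> e' = (if e = e' then 1 else 0)"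
    "closure (span E) = UNIV"
  using assms unfolding orthonormal_basis_def pairwise_def orthogonal_def
  by (auto simp: norm_eq_1)

lemma orthonormal_sum_inner:
  assumes E: "orthonormal_basis E" and J: "finite J" "J \<subseteq> E"
  shows "(\<Sum>j\<in>J. a j *\<^sub>R j) \<bullet> (\<Sum>j\<in>J. b j *\<^sub>R j) = (\<Sum>j\<in>J. a j * b j)"
proof -
  have "(\<Sum>j\<in>J. a j *\<^sub>R j) \<bullet> (\<Sum>j\<in>J. b j *\<^sub>R j) = (\<Sum>i\<in>J. \<Sum>j\<in>J. a i * b j * (i \<bullet> j))"
    unfolding inner_sum_left inner_sum_right by (subst sum.swap) (simp add: mult_ac)
  also have "\<dots> = (\<Sum>i\<in>J. \<Sum>j\<in>J. if i = j then a i * b i else 0)"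
  proof (intro sum.cong refl)
    fix i j assume "i \<in> J" "j \<in> J"
    then have "i \<bullet> j = (if i = j then 1 else 0)"
      using orthonormal_basisD(2)[OF E] J(2) by blast
    then show "a i * b j * (i \<bullet> j) = (if i = j then a i * b i else 0)" by simp
  qed
  also have "\<dots> = (\<Sum>j\<in>J. a j * b j)"
    using J(1) by (simp add: sum.delta)
  finally show ?thesis .
qed

text \<open>Completion of the square. The choice \<open>a j = j \<bullet> x\<close> gives Bessel's
  inequality; nonnegativity of the last sum, for an approximation of x from the span, gives
  Parseval's identity up to an error.\<close>

lemma orthonormal_dist_span:
  assumes E: "orthonormal_basis E" and J: "finite J" "J \<subseteq> E"
  shows "(norm (x - (\<Sum>j\<in>J. a j *\<^sub>R j)))\<^sup>2 = (norm x)\<^sup>2 - (\<Sum>j\<in>J. (j \<bullet> x)\<^sup>2) + (\<Sum>j\<in>J. (a j - j \<bullet> x)\<^sup>2)"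
proof -
  have "(norm (x - (\<Sum>j\<in>J. a j *\<^sub>R j)))\<^sup>2
      = (norm x)\<^sup>2 - 2 * (\<Sum>j\<in>J. a j * (j \<bullet> x)) + (\<Sum>j\<in>J. a j * a j)"
    using orthonormal_sum_inner[OF E J, of a a] unfolding power2_norm_eq_inner
    by (simp add: inner_diff_left inner_diff_right inner_sum_left inner_sum_right inner_commute)
  also have "\<dots> = (norm x)\<^sup>2 - (\<Sum>j\<in>J. (j \<bullet> x)\<^sup>2) + (\<Sum>j\<in>J. (a j - j \<bullet> x)\<^sup>2)"
    by (simp add: sum_distrib_left power2_eq_square algebra_simps flip: sum.distrib sum_subtractf)
  finally show ?thesis .
qed

lemma Bessel_inequality:
  assumes E: "orthonormal_basis E" and J: "finite J" "J \<subseteq> E"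
  shows "(\<Sum>j\<in>J. (j \<bullet> x)\<^sup>2) \<le> (norm x)\<^sup>2"
  using orthonormal_dist_span[OF E J, of x "\<lambda>j. j \<bullet> x"] zero_le_power2[of "norm (x - (\<Sum>j\<in>J. (j \<bullet> x) *\<^sub>R j))"]
  by simp

lemma Parseval_approx:
  assumes E: "orthonormal_basis E" and e: "e > 0"
  obtains J where "finite J" "J \<subseteq> E" "(norm x)\<^sup>2 < (\<Sum>j\<in>J. (j \<bullet> x)\<^sup>2) + e"
proof -
  have "x \<in> closure (span E)" using orthonormal_basisD(3)[OF E] by simp
  then obtain y where y: "y \<in> span E" "dist y x < sqrt e"
    using e closure_approachable[of x "span E"] by (metis real_sqrt_gt_zero)
  then obtain J a where J: "finite J" "J \<subseteq> E" "y = (\<Sum>j\<in>J. a j *\<^sub>R j)"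
    unfolding span_explicit by blast
  have "(norm (x - y))\<^sup>2 < e"
    using y(2) e by (simp add: dist_norm norm_minus_commute real_less_rsqrt power2_eq_square)
      (metis abs_norm_cancel norm_minus_commute power2_eq_square real_sqrt_abs real_sqrt_less_iff)
  moreover have "(norm (x - y))\<^sup>2 \<ge> (norm x)\<^sup>2 - (\<Sum>j\<in>J. (j \<bullet> x)\<^sup>2)"
    using orthonormal_dist_span[OF E J(1,2), of x a] sum_nonneg[of J "\<lambda>j. (a j - j \<bullet> x)\<^sup>2"] J(3) by simp
  ultimately show ?thesis using that[OF J(1,2)] by simp
qed

text \<open>A bound c of the squared Hilbert--Schmidt norm. Finite partial sums presuppose no
  summability and pass to pointwise limits.\<close>

definition hs_bounded :: "'h::real_inner set \<Rightarrow> ('h \<Rightarrow> 'h) \<Rightarrow> real \<Rightarrow> bool" where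
  "hs_bounded E T c \<longleftrightarrow> (\<forall>F. finite F \<longrightarrow> F \<subseteq> E \<longrightarrow> (\<Sum>e\<in>F. (norm (T e))\<^sup>2) \<le> c)"

lemma hs_boundedI_coefficients:
  assumes E: "orthonormal_basis E"
    and c: "\<And>J F. finite J \<Longrightarrow> J \<subseteq> E \<Longrightarrow> finite F \<Longrightarrow> F \<subseteq> E' \<Longrightarrow> (\<Sum>f\<in>F. \<Sum>j\<in>J. (j \<bullet> T f)\<^sup>2) \<le> c"
  shows "hs_bounded E' T c"
  unfolding hs_bounded_def
proof (intro allI impI)
  fix F assume F: "finite F" "F \<subseteq> E'"
  show "(\<Sum>f\<in>F. (norm (T f))\<^sup>2) \<le> c"
  proof (rule field_le_epsilon)
    fix e :: real assume e: "e > 0"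
    define e' where "e' = e / (real (card F) + 1)"
    have e': "e' > 0" using e by (simp add: e'_def add_nonneg_pos)
    have "\<exists>J. finite J \<and> J \<subseteq> E \<and> (norm (T f))\<^sup>2 < (\<Sum>j\<in>J. (j \<bullet> T f)\<^sup>2) + e'" for f
      using Parseval_approx[OF E e', of "T f"] by metis
    then obtain J where J: "\<And>f. finite (J f)" "\<And>f. J f \<subseteq> E" "\<And>f. (norm (T f))\<^sup>2 < (\<Sum>j\<in>J f. (j \<bullet> T f)\<^sup>2) + e'"
      by metis
    \<comment> \<open>One finite set of coordinates that serves all of the finitely many f in
      F.\<close>
    define K where "K = (\<Union>f\<in>F. J f)"
    have K: "finite K" "K \<subseteq> E" using J F by (auto simp: K_def)
    have "(\<Sum>f\<in>F. (norm (T f))\<^sup>2) \<le> (\<Sum>f\<in>F. (\<Sum>j\<in>K. (j \<bullet> T f)\<^sup>2) + e')"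
    proof (rule sum_mono)
      fix f assume "f \<in> F"
      then have "(\<Sum>j\<in>J f. (j \<bullet> T f)\<^sup>2) \<le> (\<Sum>j\<in>K. (j \<bullet> T f)\<^sup>2)"
        using K by (intro sum_mono2) (auto simp: K_def)
      then show "(norm (T f))\<^sup>2 \<le> (\<Sum>j\<in>K. (j \<bullet> T f)\<^sup>2) + e'" using J(3)[of f] by linarith
    qed
    also have "\<dots> = (\<Sum>f\<in>F. \<Sum>j\<in>K. (j \<bullet> T f)\<^sup>2) + real (card F) * e'"
      by (simp add: sum.distrib)
    also have "\<dots> \<le> c + e"
    proof (rule add_mono)
      show "(\<Sum>f\<in>F. \<Sum>j\<in>K. (j \<bullet> T f)\<^sup>2) \<le> c" using c K F by blast
      show "real (card F) * e' \<le> e" using e by (simp add: e'_def field_simps)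
    qed
    finally show "(\<Sum>f\<in>F. (norm (T f))\<^sup>2) \<le> c + e" .
  qed
qed

text \<open>The squares of the matrix entries are summed by rows or by columns. For symmetric T the
  choice T' = T makes this the independence of the basis; for E' = E it exchanges left and right
  factors of a product.\<close>

lemma hs_bounded_adjoint:
  assumes E: "orthonormal_basis E" and E': "orthonormal_basis E'"
    and T: "hs_bounded E T c" and adj: "\<And>x y. T x \<bullet> y = x \<bullet> T' y"
  shows "hs_bounded E' T' c"
proof (rule hs_boundedI_coefficients[OF E])
  fix J F assume J: "finite J" "J \<subseteq> E" and F: "finite F" "F \<subseteq> E'"
  have "(\<Sum>f\<in>F. \<Sum>j\<in>J. (j \<bullet> T' f)\<^sup>2) = (\<Sum>j\<in>J. \<Sum>f\<in>F. (f \<bullet> T j)\<^sup>2)"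
    unfolding adj[symmetric] by (subst sum.swap) (simp add: inner_commute)
  also have "\<dots> \<le> (\<Sum>j\<in>J. (norm (T j))\<^sup>2)"
    by (intro sum_mono Bessel_inequality[OF E' F])
  also have "\<dots> \<le> c" using T J by (simp add: hs_bounded_def)
  finally show "(\<Sum>f\<in>F. \<Sum>j\<in>J. (j \<bullet> T' f)\<^sup>2) \<le> c" .
qed

lemma hs_bounded_compose:
  assumes T: "hs_bounded E T c" and "0 \<le> a" and A: "\<And>x. norm (A x) \<le> a * norm x"
  shows "hs_bounded E (\<lambda>x. A (T x)) (a\<^sup>2 * c)"
  unfolding hs_bounded_def
proof (intro allI impI)
  fix F assume F: "finite F" "F \<subseteq> E"
  have "(\<Sum>e\<in>F. (norm (A (T e)))\<^sup>2) \<le> (\<Sum>e\<in>F. a\<^sup>2 * (norm (T e))\<^sup>2)"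
    using A by (intro sum_mono) (simp add: power_mono flip: power_mult_distrib)
  also have "\<dots> = a\<^sup>2 * (\<Sum>e\<in>F. (norm (T e))\<^sup>2)" by (simp add: sum_distrib_left)
  also have "\<dots> \<le> a\<^sup>2 * c" using T F by (intro mult_left_mono) (auto simp: hs_bounded_def)
  finally show "(\<Sum>e\<in>F. (norm (A (T e)))\<^sup>2) \<le> a\<^sup>2 * c" .
qed

lemma hs_bounded_add:
  assumes "hs_bounded E T a" "hs_bounded E T' b"
  shows "hs_bounded E (\<lambda>x. T x + T' x) (2 * a + 2 * b)"
  unfolding hs_bounded_def
proof (intro allI impI)
  fix F assume F: "finite F" "F \<subseteq> E"
  have "(norm (u + v))\<^sup>2 \<le> 2 * (norm u)\<^sup>2 + 2 * (norm v)\<^sup>2" for u v :: 'a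
    using zero_le_power2[of "norm (u - v)"]
    by (simp add: power2_norm_eq_inner inner_add_left inner_add_right inner_diff_left inner_diff_right inner_commute)
  then have "(\<Sum>e\<in>F. (norm (T e + T' e))\<^sup>2) \<le> (\<Sum>e\<in>F. 2 * (norm (T e))\<^sup>2 + 2 * (norm (T' e))\<^sup>2)"
    by (intro sum_mono)
  also have "\<dots> = 2 * (\<Sum>e\<in>F. (norm (T e))\<^sup>2) + 2 * (\<Sum>e\<in>F. (norm (T' e))\<^sup>2)"
    by (simp add: sum.distrib sum_distrib_left)
  also have "\<dots> \<le> 2 * a + 2 * b"
    using assms F by (intro add_mono mult_left_mono) (auto simp: hs_bounded_def)
  finally show "(\<Sum>e\<in>F. (norm (T e + T' e))\<^sup>2) \<le> 2 * a + 2 * b" .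
qed

lemma hs_bounded_limit:
  assumes "\<And>n. n \<ge> N \<Longrightarrow> hs_bounded E (T n) c" and lim: "\<And>x. (\<lambda>n. T n x) \<longlonglongrightarrow> T' x"
  shows "hs_bounded E T' c"
  unfolding hs_bounded_def
proof (intro allI impI)
  fix F assume F: "finite F" "F \<subseteq> E"
  show "(\<Sum>e\<in>F. (norm (T' e))\<^sup>2) \<le> c"
  proof (rule LIMSEQ_le_const2)
    show "(\<lambda>n. \<Sum>e\<in>F. (norm (T n e))\<^sup>2) \<longlonglongrightarrow> (\<Sum>e\<in>F. (norm (T' e))\<^sup>2)"
      by (intro tendsto_intros lim)
    show "\<exists>N. \<forall>n\<ge>N. (\<Sum>e\<in>F. (norm (T n e))\<^sup>2) \<le> c"
      using assms(1) F unfolding hs_bounded_def by blast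
  qed
qed

lemma hs_bounded_summable:
  assumes "hs_bounded E T c"
  shows "(\<lambda>e. (norm (T e))\<^sup>2) summable_on E" "(\<Sum>\<^sub>\<infinity>e\<in>E. (norm (T e))\<^sup>2) \<le> c"
proof -
  show s: "(\<lambda>e. (norm (T e))\<^sup>2) summable_on E"
    using assms by (intro nonneg_bdd_above_summable_on) (auto simp: hs_bounded_def bdd_above_def)
  show "(\<Sum>\<^sub>\<infinity>e\<in>E. (norm (T e))\<^sup>2) \<le> c"
    using assms s by (intro infsum_le_finite_sums) (auto simp: hs_bounded_def)
qed

lemma hilbert_schmidt_iff_hs_bounded:
  assumes E: "orthonormal_basis E" and sym: "\<And>x y. T x \<bullet> y = x \<bullet> T y"
  shows "hilbert_schmidt T \<longleftrightarrow> bounded_linear T \<and> (\<exists>c. hs_bounded E T c)"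
proof
  assume "hilbert_schmidt T"
  then obtain E' where E': "bounded_linear T" "orthonormal_basis E'" "(\<lambda>e. (norm (T e))\<^sup>2) summable_on E'"
    unfolding hilbert_schmidt_def by blast
  have "hs_bounded E' T (\<Sum>\<^sub>\<infinity>e\<in>E'. (norm (T e))\<^sup>2)"
    using E'(3) unfolding hs_bounded_def by (auto intro!: finite_sum_le_infsum)
  then have "hs_bounded E T (\<Sum>\<^sub>\<infinity>e\<in>E'. (norm (T e))\<^sup>2)"
    by (rule hs_bounded_adjoint[OF E'(2) E]) (rule sym)
  with E'(1) show "bounded_linear T \<and> (\<exists>c. hs_bounded E T c)" by blast
next
  assume "bounded_linear T \<and> (\<exists>c. hs_bounded E T c)"
  then show "hilbert_schmidt T"
    unfolding hilbert_schmidt_def using E hs_bounded_summable(1) by blast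
qed

lemma hs_norm_le:
  assumes E: "orthonormal_basis E" and sym: "\<And>x y. T x \<bullet> y = x \<bullet> T y"
    and T: "hs_bounded E T c"
  shows "hs_norm T \<le> sqrt c"
proof -
  have S: "orthonormal_basis (SOME E. orthonormal_basis (E :: 'a set))"
    using E by (rule someI)
  have "hs_bounded (SOME E. orthonormal_basis E) T c"
    using T sym by (intro hs_bounded_adjoint[OF E S])
  then show ?thesis
    unfolding hs_norm_def by (intro real_sqrt_le_mono hs_bounded_summable(2))
qed

lemma hs_norm_nonneg: "0 \<le> hs_norm T"
  unfolding hs_norm_def by (simp add: infsum_nonneg)

lemma Cauchy_Schwarz_sum_scaleR:
  fixes v :: "'i \<Rightarrow> 'h::real_inner"
  shows "(norm (\<Sum>j\<in>J. a j *\<^sub>R v j))\<^sup>2 \<le> (\<Sum>j\<in>J. (a j)\<^sup>2) * (\<Sum>j\<in>J. (norm (v j))\<^sup>2)"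
proof -
  have "norm (\<Sum>j\<in>J. a j *\<^sub>R v j) \<le> (\<Sum>j\<in>J. \<bar>a j\<bar> * norm (v j))"
    by (rule norm_sum[THEN order_trans]) simp
  then have "(norm (\<Sum>j\<in>J. a j *\<^sub>R v j))\<^sup>2 \<le> (\<Sum>j\<in>J. \<bar>a j\<bar> * norm (v j))\<^sup>2"
    by (intro power_mono) auto
  also have "\<dots> \<le> (\<Sum>j\<in>J. \<bar>a j\<bar>\<^sup>2) * (\<Sum>j\<in>J. (norm (v j))\<^sup>2)"
    by (rule Cauchy_Schwarz_ineq_sum)
  finally show ?thesis by simp
qed

text \<open>The test function for the pair R, R' is the quadratic form whose coefficients are those of
  the compression of \<open>R' - R\<close> to the span of J. Its variance is controlled without any factor
  that depends on J.\<close>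

lemma quadratic_test_bound:
  fixes R R' :: "'h::real_inner \<Rightarrow>\<^sub>L 'h" and d :: 'h
  assumes E: "orthonormal_basis E" and J: "finite J" "J \<subseteq> E"
    and sa: "self_adjoint R" "self_adjoint R'"
    and M: "0 \<le> M" "\<And>x. norm (R x) \<le> M * norm x" "\<And>x. norm (R' x) \<le> M * norm x"
    and H: "0 \<le> H" "H \<le> 1 / 4" and d: "(norm d)\<^sup>2 \<le> 16 * H * M"
    and test: "\<And>w. let s = \<Sum>j\<in>J. j \<bullet> R' (w j) - j \<bullet> R (w j) + (j \<bullet> d) * (w j \<bullet> d);
        l = \<Sum>j\<in>J. (j \<bullet> d) *\<^sub>R w j + (w j \<bullet> d) *\<^sub>R j;
        V = \<lambda>D. \<Sum>i\<in>J. \<Sum>j\<in>J. (i \<bullet> D j) * (w i \<bullet> D (w j))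
          + (i \<bullet> D (w j)) * (w i \<bullet> D j)
        in s\<^sup>2 \<le> 2 * H * (V R + V R' + l \<bullet> R' l + s\<^sup>2)"
  shows "(\<Sum>j\<in>J. \<Sum>i\<in>J. (i \<bullet> (R' - R) j)\<^sup>2) \<le> (17 * M)\<^sup>2 * H"
proof -
  define G where "G = R' - R"
  define w where "w j = (\<Sum>i\<in>J. (i \<bullet> G j) *\<^sub>R i)" for j
  define X where "X = (\<Sum>j\<in>J. \<Sum>i\<in>J. (i \<bullet> G j)\<^sup>2)"
  have X0: "0 \<le> X" unfolding X_def by (intro sum_nonneg) auto
  have symG: "u \<bullet> G v = v \<bullet> G u" for u v
    using sa by (simp add: G_def blinfun.bilinear_simps inner_diff_right self_adjoint_def) (metis inner_commute)
  have norm_w: "(norm (w j))\<^sup>2 = (\<Sum>i\<in>J. (i \<bullet> G j)\<^sup>2)" for j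
    unfolding w_def power2_norm_eq_inner orthonormal_sum_inner[OF E J] by (simp add: power2_eq_square)
  have X: "X = (\<Sum>j\<in>J. (norm (w j))\<^sup>2)" by (simp add: X_def norm_w)
  define s where "s = (\<Sum>j\<in>J. j \<bullet> R' (w j) - j \<bullet> R (w j) + (j \<bullet> d) * (w j \<bullet> d))"
  define l where "l = (\<Sum>j\<in>J. (j \<bullet> d) *\<^sub>R w j + (w j \<bullet> d) *\<^sub>R j)"
  define V where "V D = (\<Sum>i\<in>J. \<Sum>j\<in>J. (i \<bullet> D j) * (w i \<bullet> D (w j))
          + (i \<bullet> D (w j)) * (w i \<bullet> D j))" for D :: "'h \<Rightarrow>\<^sub>L 'h"
  have ineq: "s\<^sup>2 \<le> 2 * H * (V R + V R' + l \<bullet> R' l + s\<^sup>2)"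
    using test[of w] unfolding Let_def s_def l_def V_def .
  \<comment> \<open>Both pairings reduce to the trace of the square of the matrix a, the product of
    the compressions of D and G. That trace is at most the sum of the squared entries of a, and
    Bessel on its columns bounds this sum with no factor that depends on J.\<close>
  have V_le: "V D \<le> 2 * M\<^sup>2 * X"
    if D: "self_adjoint D" "\<And>x. norm (D x) \<le> M * norm x" for D
  proof -
    define a where "a i j = i \<bullet> D (w j)" for i j
    have symD: "u \<bullet> D v = v \<bullet> D u" for u v
      using D(1) by (metis inner_commute self_adjointD)
    have t2: "w i \<bullet> D j = a j i" for i j by (simp add: a_def symD)
    have t1: "(\<Sum>i\<in>J. \<Sum>j\<in>J. (i \<bullet> D j) * (w i \<bullet> D (w j))) = (\<Sum>i\<in>J. \<Sum>j\<in>J. a i j * a j i)"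
    proof -
      have "(\<Sum>i\<in>J. \<Sum>j\<in>J. (i \<bullet> D j) * (w i \<bullet> D (w j)))
          = (\<Sum>i\<in>J. \<Sum>j\<in>J. \<Sum>k\<in>J. (i \<bullet> D j) * (k \<bullet> G i) * a k j)"
        by (simp add: w_def inner_sum_left sum_distrib_left a_def mult.assoc)
      also have "\<dots> = (\<Sum>j\<in>J. \<Sum>k\<in>J. \<Sum>i\<in>J. (i \<bullet> D j) * (k \<bullet> G i) * a k j)"
        by (subst sum.swap) (intro sum.cong refl sum.swap)
      also have "\<dots> = (\<Sum>j\<in>J. \<Sum>k\<in>J. a j k * a k j)"
      proof (intro sum.cong refl)
        fix j k
        have "(\<Sum>i\<in>J. (i \<bullet> D j) * (k \<bullet> G i)) = w k \<bullet> D j"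
          by (simp add: w_def inner_sum_left symG[of k] mult.commute)
        then show "(\<Sum>i\<in>J. (i \<bullet> D j) * (k \<bullet> G i) * a k j) = a j k * a k j"
          by (simp add: t2 flip: sum_distrib_right)
      qed
      finally show ?thesis .
    qed
    have "V D = (\<Sum>i\<in>J. \<Sum>j\<in>J. a i j * a j i) + (\<Sum>i\<in>J. \<Sum>j\<in>J. a i j * a j i)"
    proof -
      have "(i \<bullet> D (w j)) * (w i \<bullet> D j) = a i j * a j i" for i j
        using t2[of i j] by (simp add: a_def)
      then show ?thesis unfolding V_def sum.distrib t1 by simp
    qed
    also have "(\<Sum>i\<in>J. \<Sum>j\<in>J. a i j * a j i) \<le> (\<Sum>i\<in>J. \<Sum>j\<in>J. ((a i j)\<^sup>2 + (a j i)\<^sup>2) / 2)"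
    proof (intro sum_mono)
      show "a i j * a j i \<le> ((a i j)\<^sup>2 + (a j i)\<^sup>2) / 2" for i j
        using zero_le_power2[of "a i j - a j i"] by (simp add: power2_eq_square algebra_simps)
    qed
    also have "\<dots> = (\<Sum>i\<in>J. \<Sum>j\<in>J. (a i j)\<^sup>2)"
    proof -
      have "(\<Sum>i\<in>J. \<Sum>j\<in>J. (a j i)\<^sup>2) = (\<Sum>i\<in>J. \<Sum>j\<in>J. (a i j)\<^sup>2)" by (rule sum.swap)
      then show ?thesis by (simp add: sum.distrib add_divide_distrib flip: sum_divide_distrib)
    qed
    also have "\<dots> = (\<Sum>j\<in>J. \<Sum>i\<in>J. (i \<bullet> D (w j))\<^sup>2)"
      unfolding a_def by (rule sum.swap)
    also have "\<dots> \<le> (\<Sum>j\<in>J. (norm (D (w j)))\<^sup>2)"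
      by (intro sum_mono Bessel_inequality[OF E J])
    also have "\<dots> \<le> (\<Sum>j\<in>J. (M * norm (w j))\<^sup>2)"
      using D(2) by (intro sum_mono power_mono) auto
    also have "\<dots> = M\<^sup>2 * X" by (simp add: X power_mult_distrib sum_distrib_left)
    finally show ?thesis by (simp add: mult_ac)
  qed
  have dJ: "(\<Sum>j\<in>J. (j \<bullet> d)\<^sup>2) \<le> (norm d)\<^sup>2" by (rule Bessel_inequality[OF E J])
  define u where "u = (\<Sum>j\<in>J. (j \<bullet> d) *\<^sub>R w j)"
  define u' where "u' = (\<Sum>j\<in>J. (w j \<bullet> d) *\<^sub>R j)"
  define x where "x = sqrt X"
  have x: "x\<^sup>2 = X" "0 \<le> x" using X0 by (auto simp: x_def)
  have "(norm u)\<^sup>2 \<le> (\<Sum>j\<in>J. (j \<bullet> d)\<^sup>2) * X"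
    unfolding u_def X by (rule Cauchy_Schwarz_sum_scaleR)
  also have "\<dots> \<le> (norm d)\<^sup>2 * X" using dJ X0 by (rule mult_right_mono)
  finally have "(norm u)\<^sup>2 \<le> (norm d * x)\<^sup>2" by (simp add: power_mult_distrib x)
  then have nu: "norm u \<le> norm d * x" using x by (auto intro: power2_le_imp_le[OF _ mult_nonneg_nonneg])
  have "(norm u')\<^sup>2 = (\<Sum>j\<in>J. (w j \<bullet> d)\<^sup>2)"
    unfolding u'_def power2_norm_eq_inner orthonormal_sum_inner[OF E J] by (simp add: power2_eq_square)
  also have "\<dots> \<le> (\<Sum>j\<in>J. (norm (w j))\<^sup>2 * (norm d)\<^sup>2)"
    using Cauchy_Schwarz_ineq[of _ d] by (intro sum_mono) (simp add: power2_norm_eq_inner)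
  also have "\<dots> = (norm d * x)\<^sup>2" by (simp add: X power_mult_distrib x sum_distrib_left mult.commute)
  finally have nu': "norm u' \<le> norm d * x" using x by (auto intro: power2_le_imp_le[OF _ mult_nonneg_nonneg])
  have l: "l = u + u'" by (simp add: l_def u_def u'_def sum.distrib)
  have nl: "norm l \<le> 2 * (norm d * x)"
    unfolding l using norm_triangle_ineq[of u u'] nu nu' by linarith
  have "l \<bullet> R' l \<le> norm l * (M * norm l)"
    by (meson M(3) mult_left_mono norm_cauchy_schwarz norm_ge_zero order_trans)
  also have "\<dots> = M * (norm l)\<^sup>2" by (simp add: power2_eq_square)
  also have "\<dots> \<le> M * (2 * (norm d * x))\<^sup>2"
    using nl M(1) by (intro mult_left_mono power_mono) auto
  finally have lR: "l \<bullet> R' l \<le> 4 * M * (norm d)\<^sup>2 * X"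
    by (simp add: power_mult_distrib x)
  \<comment> \<open>X is the contribution of the covariances, \<open>d \<bullet> u\<close> the error
    due to the different means.\<close>
  have s: "s = X + d \<bullet> u"
  proof -
    have "(\<Sum>j\<in>J. j \<bullet> R' (w j) - j \<bullet> R (w j)) = (\<Sum>j\<in>J. w j \<bullet> G j)"
    proof (intro sum.cong refl)
      fix j
      have "j \<bullet> R' (w j) - j \<bullet> R (w j) = j \<bullet> G (w j)"
        by (simp add: G_def blinfun.bilinear_simps inner_diff_right)
      then show "j \<bullet> R' (w j) - j \<bullet> R (w j) = w j \<bullet> G j"
        by (simp add: symG)
    qed
    also have "\<dots> = X"
      by (simp add: X_def w_def inner_sum_left power2_eq_square)
    finally show ?thesis
      by (simp add: s_def u_def sum.distrib inner_sum_right inner_commute[of d])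
  qed
  have "s\<^sup>2 \<le> 2 * H * (4 * M\<^sup>2 * X + 4 * M * (norm d)\<^sup>2 * X + s\<^sup>2)"
  proof (rule order_trans[OF ineq mult_left_mono])
    show "V R + V R' + l \<bullet> R' l + s\<^sup>2 \<le> 4 * M\<^sup>2 * X + 4 * M * (norm d)\<^sup>2 * X + s\<^sup>2"
      using V_le[OF sa(1) M(2)] V_le[OF sa(2) M(3)] lR by linarith
  qed (use H in auto)
  also have "\<dots> = 2 * H * (4 * M\<^sup>2 * X + 4 * M * (norm d)\<^sup>2 * X) + 2 * H * s\<^sup>2"
    by (simp add: algebra_simps)
  also have "2 * H * s\<^sup>2 \<le> s\<^sup>2 / 2"
    using H mult_right_mono[of "2 * H" "1 / 2" "s\<^sup>2"] by simp
  finally have "s\<^sup>2 \<le> 4 * H * (4 * M\<^sup>2 * X + 4 * M * (norm d)\<^sup>2 * X)" by simp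
  also have "\<dots> = 16 * H * M * X * (M + (norm d)\<^sup>2)"
    by (simp add: power2_eq_square algebra_simps)
  also have "\<dots> \<le> 16 * H * M * X * (5 * M)"
  proof (rule mult_left_mono)
    have "16 * H * M \<le> 4 * M" using H M(1) mult_right_mono[of "16 * H" 4 M] by simp
    then show "M + (norm d)\<^sup>2 \<le> 5 * M" using d by linarith
  qed (use H M X0 in auto)
  \<comment> \<open>The collected factor is 16 * 5 = 80, which is below 9^2.\<close>
  also have "\<dots> \<le> (9 * M * sqrt H * x)\<^sup>2"
    using H M(1) X0 by (simp add: power_mult_distrib x power2_eq_square[of M] mult_mono)
  finally have s_le: "s \<le> 9 * M * sqrt H * x"
    using M(1) H x by (auto intro: power2_le_imp_le[OF _ mult_nonneg_nonneg])
  have "X = s - d \<bullet> u" using s by simp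
  also have "\<dots> \<le> 9 * M * sqrt H * x + norm d * norm u"
    using s_le norm_cauchy_schwarz[of "- d" u] by simp
  also have "norm d * norm u \<le> norm d * (norm d * x)" using nu by (intro mult_left_mono) auto
  also have "norm d * (norm d * x) = (norm d)\<^sup>2 * x" by (simp add: power2_eq_square)
  \<comment> \<open>From H \<le> 1/4 follows H \<le> sqrt H / 2, which turns the 16 into an 8; with
    the 9 of the other term this is the 17 of the claim.\<close>
  also have "(norm d)\<^sup>2 * x \<le> (8 * M * sqrt H) * x"
  proof (rule mult_right_mono)
    have "sqrt H \<le> 1 / 2" using H real_sqrt_le_mono[of H "1 / 4"] by (simp add: real_sqrt_divide)
    then have "sqrt H * sqrt H \<le> 1 / 2 * sqrt H" using H by (intro mult_right_mono) auto
    then have "H \<le> sqrt H / 2" using H by simp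
    then have "16 * H * M \<le> 16 * (sqrt H / 2) * M" using M by (intro mult_right_mono mult_left_mono) auto
    then show "(norm d)\<^sup>2 \<le> 8 * M * sqrt H" using d by (simp add: mult_ac)
  qed (rule x)
  finally have "x * x \<le> (17 * M * sqrt H) * x" using x by (simp add: power2_eq_square algebra_simps)
  then have "x \<le> 17 * M * sqrt H"
    using x M(1) H by (cases "x = 0") auto
  then have "x\<^sup>2 \<le> (17 * M * sqrt H)\<^sup>2" using x by (intro power_mono) auto
  then show ?thesis using x H by (simp add: X_def G_def power_mult_distrib)
qed

section \<open>The Cameron--Martin space\<close>

text \<open>Applied to a difference \<delta> of means and L the square root of the covariance: a
  bound by \<open>norm (L f)\<close> characterizes the vectors of the Cameron--Martin space.\<close>

lemma bounded_functional_range: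
  fixes L :: "'h::{real_inner, banach} \<Rightarrow>\<^sub>L 'h"
  assumes L: "self_adjoint L" and dense: "closure (range L) = UNIV"
    and bound: "\<And>f. \<bar>f \<bullet> \<delta>\<bar> \<le> K * norm (L f)"
  obtains d where "\<delta> = L d"
proof -
  text \<open>Project the vertical unit vector onto the graph of the functional \<open>L f \<mapsto> f \<bullet> \<delta>\<close>.\<close>
  define V where "V = range (\<lambda>f. (L f, f \<bullet> \<delta>))"
  have "subspace V"
    unfolding V_def
    by (rule linear_subspace_image[of _ UNIV])
      (auto intro!: linearI simp: blinfun.bilinear_simps inner_add_left)
  then obtain p where p: "p \<in> closure V" "\<And>v. v \<in> V \<Longrightarrow> ((0, 1) - p) \<bullet> v = 0"
    using hilbert_projection[of V "(0, 1) :: 'h \<times> real"] by blast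
  obtain p1 p2 where p12: "p = (p1, p2)" by (cases p)
  have closed: "closed {v :: 'h \<times> real. \<bar>snd v\<bar> \<le> K * norm (fst v)}"
    by (intro closed_Collect_le continuous_intros)
  have "V \<subseteq> {v. \<bar>snd v\<bar> \<le> K * norm (fst v)}"
    using bound by (auto simp: V_def)
  then have "closure V \<subseteq> {v. \<bar>snd v\<bar> \<le> K * norm (fst v)}"
    using closed by (rule closure_minimal)
  then have le: "\<bar>p2\<bar> \<le> K * norm p1" using p(1) p12 by auto
  have orth: "(1 - p2) * (f \<bullet> \<delta>) = p1 \<bullet> L f" for f
    using p(2)[of "(L f, f \<bullet> \<delta>)"] by (simp add: V_def p12 inner_Pair)
  \<comment> \<open>If p2 = 1, density of the range gives p1 = 0, so the closure of the graph
    contains the vertical vector (0, 1), which the bound excludes.\<close>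
  have "p2 \<noteq> 1"
  proof
    assume "p2 = 1"
    then have "p1 \<bullet> v = 0 \<bullet> v" if "v \<in> range L" for v
      using orth that by auto
    then have "p1 = 0" by (rule dense_inner_eq[OF dense])
    then show False using le \<open>p2 = 1\<close> by simp
  qed
  have "\<delta> = L ((1 / (1 - p2)) *\<^sub>R p1)"
  proof (rule inner_eq_imp_eq)
    fix f
    have "f \<bullet> \<delta> = (1 / (1 - p2)) * (p1 \<bullet> L f)"
      using orth[of f] \<open>p2 \<noteq> 1\<close> by (simp add: field_simps)
    then show "f \<bullet> \<delta> = f \<bullet> L ((1 / (1 - p2)) *\<^sub>R p1)"
      using self_adjointD[OF L, of f "(1 / (1 - p2)) *\<^sub>R p1"] by (simp add: inner_commute)
  qed
  then show ?thesis by (rule that)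
qed

lemma dense_norm_le:
  fixes d :: "'h::real_inner"
  assumes "closure D = UNIV" "0 \<le> K" and "\<And>v. v \<in> D \<Longrightarrow> \<bar>d \<bullet> v\<bar> \<le> K * norm v"
  shows "norm d \<le> K"
proof -
  obtain u where u: "\<And>n. u n \<in> D" "u \<longlonglongrightarrow> d"
    using assms(1) closure_sequential[of d D] by auto
  have "\<bar>d \<bullet> d\<bar> \<le> K * norm d"
  proof (rule LIMSEQ_le)
    show "(\<lambda>n. \<bar>d \<bullet> u n\<bar>) \<longlonglongrightarrow> \<bar>d \<bullet> d\<bar>" "(\<lambda>n. K * norm (u n)) \<longlonglongrightarrow> K * norm d"
      by (intro tendsto_intros u(2))+
  qed (use assms(3) u(1) in blast)
  then have "norm d * norm d \<le> K * norm d" by (simp flip: power2_norm_eq_inner add: power2_eq_square)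
  then show ?thesis using assms(2) by (cases "d = 0") auto
qed

locale cameron_martin =
  fixes C0 :: "'h::{real_inner, banach} \<Rightarrow>\<^sub>L 'h"
  assumes C0: "strictly_positive_operator C0" "nonneg_trace_class C0"
begin

definition L :: "'h \<Rightarrow>\<^sub>L 'h" where "L = op_sqrt C0"

lemma C0_nonneg: "nonneg_operator C0"
  using C0(2) unfolding nonneg_trace_class_def by blast

lemma L_nonneg: "nonneg_operator L" and L_square: "L (L x) = C0 x"
  using op_sqrt_props[OF C0_nonneg] unfolding L_def[symmetric]
  by (auto simp flip: blinfun_apply_blinfun_compose)

lemma L_self_adjoint: "self_adjoint L"
  using L_nonneg by (rule nonneg_operator_self_adjoint)

lemma L_sym: "L x \<bullet> y = x \<bullet> L y"
  using L_self_adjoint by (rule self_adjointD)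

lemma L_inj: "L x = 0 \<Longrightarrow> x = 0"
  using C0(1) L_square[of x] unfolding strictly_positive_operator_def
  by (metis blinfun.zero_right inner_zero_right less_irrefl)

lemma L_eq_iff: "L x = L y \<longleftrightarrow> x = y"
  using L_inj[of "x - y"] by (auto simp: blinfun.diff_right)

lemma L_dense: "closure (range L) = UNIV"
  using L_self_adjoint L_inj by (rule closure_range_self_adjoint)

lemma C0_form: "h \<bullet> C0 h = (norm (L h))\<^sup>2"
  by (simp add: power2_norm_eq_inner L_sym L_square)

lemma C0_form_pos: "h \<noteq> 0 \<Longrightarrow> 0 < h \<bullet> C0 h"
  using C0(1) unfolding strictly_positive_operator_def by blast

lemma cm_space_eq: "cm_space C0 = range L"
  by (simp add: cm_space_def L_def)

lemma inv_sqrt_L: "inv_sqrt C0 (L x) = x"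
  unfolding inv_sqrt_def L_def[symmetric] by (rule inv_f_f) (auto intro: injI simp: L_eq_iff)

lemma cm_inner_L: "cm_inner C0 (L x) (L y) = x \<bullet> y"
  by (simp add: cm_inner_def inv_sqrt_L)

lemma cm_norm_L: "cm_norm C0 (L x) = ereal (norm x)"
  by (simp add: cm_norm_def cm_space_eq cm_inner_L norm_eq_sqrt_inner)

lemma L_dense_seq:
  obtains f where "(\<lambda>n. L (f n)) \<longlonglongrightarrow> x"
proof -
  have "x \<in> closure (range L)" using L_dense by simp
  then obtain u where u: "\<And>n. u n \<in> range L" "u \<longlonglongrightarrow> x"
    using closure_sequential by blast
  then have "\<exists>f. u n = L f" for n by blast
  then obtain f where "\<And>n. u n = L (f n)" by metis
  then have "u = (\<lambda>n. L (f n))" by blast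
  then show ?thesis using u(2) that by blast
qed

lemma orthonormal_basis_ex: "\<exists>E :: 'h set. orthonormal_basis E"
  using C0(2) unfolding nonneg_trace_class_def by blast

text \<open>\<open>L u\<close> has Cameron--Martin norm \<open>norm u\<close>, so u \<mapsto>
  \<open>\<Gamma> (L x) (L u)\<close> is bounded on the whole space. Its Riesz vector is the one
  that the definite description in \<open>sqrt_on_dual\<close> selects.\<close>

lemma inner_sqrt_conj:
  assumes "\<Gamma> \<in> cm_hs C0"
  shows "y \<bullet> sqrt_conj C0 \<Gamma> x = \<Gamma> (L x) (L y)"
proof -
  define \<phi> where "\<phi> y = \<Gamma> (L x) (L y)" for y
  have dual: "\<Gamma> (L x) \<in> cm_dual C0"
    using assms by (auto simp: cm_hs_def cm_space_eq)
  have lin: "\<phi> (a *\<^sub>R u + b *\<^sub>R v) = a * \<phi> u + b * \<phi> v" for a b u v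
    using dual unfolding cm_dual_def cm_space_eq \<phi>_def by (simp add: blinfun.bilinear_simps)
  obtain K where K: "\<And>u. \<bar>\<phi> u\<bar> \<le> K * norm u"
    using dual unfolding cm_dual_def cm_space_eq \<phi>_def by (auto simp: cm_inner_L norm_eq_sqrt_inner)
  have "bounded_linear \<phi>"
  proof (rule bounded_linear_intro[where K = K])
    show "\<phi> (u + v) = \<phi> u + \<phi> v" for u v using lin[of 1 u 1 v] by simp
    show "\<phi> (r *\<^sub>R u) = r *\<^sub>R \<phi> u" for r u using lin[of r u 0 0] by simp
    show "norm (\<phi> u) \<le> norm u * K" for u using K[of u] by (simp add: mult.commute)
  qed
  then obtain z where z: "\<And>y. \<phi> y = y \<bullet> z" by (rule riesz_representation) blast
  have "sqrt_conj C0 \<Gamma> x = z"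
    unfolding sqrt_conj_def sqrt_on_dual_def L_def[symmetric] \<phi>_def[symmetric] z
    by (rule the_equality) (auto intro: inner_eq_imp_eq)
  then show ?thesis using z[of y] by (simp add: \<phi>_def)
qed

lemma sqrt_conj_sym:
  assumes "\<Gamma> \<in> cm_hs C0" "cm_symmetric C0 \<Gamma>"
  shows "sqrt_conj C0 \<Gamma> x \<bullet> y = x \<bullet> sqrt_conj C0 \<Gamma> y"
  using inner_sqrt_conj[OF assms(1), of y x] inner_sqrt_conj[OF assms(1), of x y] assms(2)
  by (simp add: inner_commute cm_symmetric_def cm_space_eq)

lemma sqrt_conj_bounded_linear:
  "\<Gamma> \<in> cm_hs C0 \<Longrightarrow> bounded_linear (sqrt_conj C0 \<Gamma>)"
  by (simp add: cm_hs_def hilbert_schmidt_def)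

section \<open>The precision operator in whitened coordinates\<close>

lemma quad_form_L:
  assumes "\<Gamma> \<in> cm_hs C0" "cm_symmetric C0 \<Gamma>"
  shows "quad_form C0 \<Gamma> (L a) (L b) = (a + sqrt_conj C0 \<Gamma> a) \<bullet> b"
  using inner_sqrt_conj[OF assms(1), of a b] sqrt_conj_sym[OF assms, of a b]
  by (simp add: quad_form_def cm_inner_L inner_add_left)

text \<open>The substitution u = L a, v = L b turns the defining identity of the associated operator
  into one that is tested against all b, since
  \<open>f \<bullet> L b = L f \<bullet> b\<close>.\<close>

lemma precision_domain_iff:
  assumes "\<Gamma> \<in> cm_hs C0" "cm_symmetric C0 \<Gamma>"
  shows "u \<in> precision_domain C0 \<Gamma> \<longleftrightarrow>
    (\<exists>a f. u = L a \<and> a + sqrt_conj C0 \<Gamma> a = L f)"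
proof -
  have eq: "(\<forall>b. (a + sqrt_conj C0 \<Gamma> a) \<bullet> b = f \<bullet> L b) \<longleftrightarrow> a + sqrt_conj C0 \<Gamma> a = L f"
    for a f
  proof
    assume "\<forall>b. (a + sqrt_conj C0 \<Gamma> a) \<bullet> b = f \<bullet> L b"
    then have "b \<bullet> (a + sqrt_conj C0 \<Gamma> a) = b \<bullet> L f" for b
      by (simp add: inner_commute[of b] L_sym)
    then show "a + sqrt_conj C0 \<Gamma> a = L f" by (rule inner_eq_imp_eq)
  qed (simp add: L_sym)
  have ball: "(\<forall>v\<in>range L. quad_form C0 \<Gamma> (L a) v = f \<bullet> v)
      \<longleftrightarrow> a + sqrt_conj C0 \<Gamma> a = L f" for a f
    unfolding eq[symmetric] by (simp add: quad_form_L[OF assms])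
  have "u \<in> precision_domain C0 \<Gamma> \<longleftrightarrow> (\<exists>a. u = L a \<and>
      (\<exists>f. \<forall>v\<in>range L. quad_form C0 \<Gamma> (L a) v = f \<bullet> v))"
    unfolding precision_domain_def cm_space_eq by blast
  then show ?thesis unfolding ball by blast
qed

lemma precision_op_L:
  assumes "\<Gamma> \<in> cm_hs C0" "cm_symmetric C0 \<Gamma>" and eq: "a + sqrt_conj C0 \<Gamma> a = L f"
  shows "precision_op C0 \<Gamma> (L a) = f"
  unfolding precision_op_def
proof (rule the_equality)
  have q: "quad_form C0 \<Gamma> (L a) v = f \<bullet> v" if "v \<in> cm_space C0" for v
    using that quad_form_L[OF assms(1,2), of a] by (auto simp: cm_space_eq eq L_sym)
  then show "\<forall>v\<in>cm_space C0. quad_form C0 \<Gamma> (L a) v = f \<bullet> v" by blast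
  fix f' assume "\<forall>v\<in>cm_space C0. quad_form C0 \<Gamma> (L a) v = f' \<bullet> v"
  then show "f' = f"
    using q by (intro dense_inner_eq[OF L_dense]) (auto simp: cm_space_eq)
qed

lemma precision_inverseD:
  assumes "\<Gamma> \<in> cm_hs C0" "cm_symmetric C0 \<Gamma>" and D: "is_precision_inverse C0 \<Gamma> D"
  obtains a where "D f = L a" "a + sqrt_conj C0 \<Gamma> a = L f"
proof -
  have "D f \<in> precision_domain C0 \<Gamma>" and op: "precision_op C0 \<Gamma> (D f) = f"
    using D unfolding is_precision_inverse_def by auto
  then obtain a f' where a: "D f = L a" "a + sqrt_conj C0 \<Gamma> a = L f'"
    using precision_domain_iff[OF assms(1,2)] by blast
  then have "f' = f" using op precision_op_L[OF assms(1,2) a(2)] by simp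
  then show ?thesis using a that by blast
qed

text \<open>\<open>R = (I + C0\<^sup>1\<^sup>/\<^sup>2 \<Gamma> C0\<^sup>1\<^sup>/\<^sup>2)\<^sup>-\<^sup>1\<close>, so that the covariance operator is \<open>D = L R L\<close>. Boundedness
  of R comes from the covariance bound on the dense subspace \<open>range L\<close>.\<close>

lemma precision_whitened_inverse:
  assumes \<Gamma>: "\<Gamma> \<in> cm_hs C0" "cm_symmetric C0 \<Gamma>" and D: "is_precision_inverse C0 \<Gamma> D"
    and nn: "nonneg_operator D" and M: "0 \<le> M"
    and bound: "\<And>f. f \<bullet> D f \<le> M * (norm (L f))\<^sup>2"
  obtains R S where "blinfun_apply S = (\<lambda>x. x + sqrt_conj C0 \<Gamma> x)" "S o\<^sub>L R = id_blinfun" "R o\<^sub>L S = id_blinfun"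
    "self_adjoint S" "nonneg_operator R" "norm R \<le> M" "D = L o\<^sub>L (R o\<^sub>L L)"
proof -
  define S where "S = Blinfun (\<lambda>x. x + sqrt_conj C0 \<Gamma> x)"
  have S: "blinfun_apply S = (\<lambda>x. x + sqrt_conj C0 \<Gamma> x)"
    unfolding S_def by (intro bounded_linear_Blinfun_apply bounded_linear_add bounded_linear_ident
        sqrt_conj_bounded_linear \<Gamma>(1))
  have S_sym: "S x \<bullet> y = x \<bullet> S y" for x y
    using sqrt_conj_sym[OF \<Gamma>] by (simp add: S inner_add_left inner_add_right)
  have "\<exists>a. D f = L a \<and> S a = L f" for f
    using precision_inverseD[OF \<Gamma> D, of f] unfolding S by metis
  then obtain a where a: "\<And>f. D f = L (a f)" "\<And>f. S (a f) = L f"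
    by metis
  have a_diff: "a (f - g) = a f - a g" for f g
  proof -
    have "L (a (f - g)) = L (a f - a g)"
      by (simp add: blinfun.diff_right a(1)[symmetric])
    then show ?thesis by (simp only: L_eq_iff)
  qed
  \<comment> \<open>For v = L g the inner product of \<open>a f\<close> and v equals
    \<open>g \<bullet> D f\<close>, and Cauchy--Schwarz for the form of D applies.\<close>
  have norm_a: "norm (a f) \<le> M * norm (L f)" for f
  proof (rule dense_norm_le[OF L_dense])
    show "0 \<le> M * norm (L f)" using M by simp
    fix v assume "v \<in> range L"
    then obtain g where v: "v = L g" by blast
    have "a f \<bullet> v = g \<bullet> D f"
      unfolding v a(1) using L_sym[of "a f" g] by (metis inner_commute)
    then have "(a f \<bullet> v)\<^sup>2 = (g \<bullet> D f)\<^sup>2" by simp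
    also have "\<dots> \<le> (g \<bullet> D g) * (f \<bullet> D f)"
      by (rule nonneg_operator_Cauchy_Schwarz[OF nn])
    also have "\<dots> \<le> (M * (norm v)\<^sup>2) * (M * (norm (L f))\<^sup>2)"
      unfolding v using bound nonneg_operatorD[OF nn] M by (intro mult_mono) auto
    also have "\<dots> = (M * norm (L f) * norm v)\<^sup>2" by (simp add: power2_eq_square)
    finally show "\<bar>a f \<bullet> v\<bar> \<le> M * norm (L f) * norm v"
      using M by (simp add: abs_le_square_iff[symmetric])
  qed
  \<comment> \<open>Every y is a limit of vectors \<open>L (f n)\<close>, whose preimages
    \<open>a (f n)\<close> under S are Cauchy by the bound on a.\<close>
  have surj: "\<exists>z. S z = y \<and> norm z \<le> M * norm y" for y
  proof -
    obtain f where f: "(\<lambda>n. L (f n)) \<longlonglongrightarrow> y" using L_dense_seq by blast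
    have "Cauchy (\<lambda>n. a (f n))"
    proof (rule metric_CauchyI)
      fix e :: real assume e: "e > 0"
      have "Cauchy (\<lambda>n. L (f n))" using f by (rule LIMSEQ_imp_Cauchy)
      moreover have "e / (M + 1) > 0" using e M by simp
      ultimately obtain N where N: "\<And>m n. m \<ge> N \<Longrightarrow> n \<ge> N \<Longrightarrow> dist (L (f m)) (L (f n)) < e / (M + 1)"
        using metric_CauchyD by metis
      have "dist (a (f m)) (a (f n)) < e" if "m \<ge> N" "n \<ge> N" for m n
      proof -
        have "dist (a (f m)) (a (f n)) \<le> M * dist (L (f m)) (L (f n))"
          using norm_a[of "f m - f n"] by (simp add: dist_norm a_diff blinfun.diff_right)
        also have "\<dots> \<le> (M + 1) * dist (L (f m)) (L (f n))"
          by (intro mult_right_mono) auto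
        also have "\<dots> < e" using N[OF that] M by (simp add: field_simps)
        finally show ?thesis .
      qed
      then show "\<exists>N. \<forall>m\<ge>N. \<forall>n\<ge>N. dist (a (f m)) (a (f n)) < e" by blast
    qed
    then obtain z where z: "(\<lambda>n. a (f n)) \<longlonglongrightarrow> z" using convergent_eq_Cauchy by blast
    have "(\<lambda>n. S (a (f n))) \<longlonglongrightarrow> S z" by (intro tendsto_intros z)
    then have "S z = y" using f unfolding a(2) by (rule LIMSEQ_unique)
    moreover have "norm z \<le> M * norm y"
      by (rule LIMSEQ_le[OF tendsto_norm[OF z] tendsto_mult[OF tendsto_const[of M] tendsto_norm[OF f]]])
        (use norm_a in blast)
    ultimately show ?thesis by blast
  qed
  \<comment> \<open>A symmetric map that is onto is one-to-one.\<close>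
  have S_inj: "x = y" if "S x = S y" for x y
  proof (rule inner_eq_imp_eq)
    fix v
    obtain z where "S z = v" using surj by blast
    then show "v \<bullet> x = v \<bullet> y" using S_sym[of z x] S_sym[of z y] that by simp
  qed
  obtain r where r: "\<And>y. S (r y) = y" "\<And>y. norm (r y) \<le> M * norm y" using surj by metis
  have "bounded_linear r"
  proof (rule bounded_linear_intro[where K = M])
    show "r (x + y) = r x + r y" for x y by (rule S_inj) (simp add: r(1) blinfun.add_right)
    show "r (c *\<^sub>R x) = c *\<^sub>R r x" for c x by (rule S_inj) (simp add: r(1) blinfun.scaleR_right)
    show "norm (r x) \<le> norm x * M" for x using r(2)[of x] by (simp add: mult.commute)
  qed
  define R where "R = Blinfun r"
  have R: "blinfun_apply R = r" unfolding R_def using \<open>bounded_linear r\<close> by (rule bounded_linear_Blinfun_apply)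
  have SR: "S o\<^sub>L R = id_blinfun" by (rule blinfun_eqI) (simp add: R r(1))
  have RS: "R o\<^sub>L S = id_blinfun"
  proof (rule blinfun_eqI)
    show "(R o\<^sub>L S) x = id_blinfun x" for x
      by (rule S_inj) (simp add: R r(1))
  qed
  have saR: "self_adjoint R"
    unfolding self_adjoint_def R by (metis r(1) S_sym)
  have aR: "a f = r (L f)" for f by (rule S_inj) (simp add: a(2) r(1))
  have D_eq: "D = L o\<^sub>L (R o\<^sub>L L)" by (rule blinfun_eqI) (simp add: R a(1) aR)
  have "0 \<le> x \<bullet> R x" for x
  proof -
    obtain f where f: "(\<lambda>n. L (f n)) \<longlonglongrightarrow> x" using L_dense_seq by blast
    have "(\<lambda>n. L (f n) \<bullet> R (L (f n))) \<longlonglongrightarrow> x \<bullet> R x"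
      by (intro tendsto_intros f)
    moreover have "0 \<le> L (f n) \<bullet> R (L (f n))" for n
      using nonneg_operatorD[OF nn, of "f n"] by (simp add: D_eq L_sym)
    ultimately show ?thesis by (intro LIMSEQ_le_const) auto
  qed
  then have "nonneg_operator R" using saR by (simp add: nonneg_operator_def)
  moreover have "norm R \<le> M" using r(2) M by (intro norm_blinfun_bound) (auto simp: R)
  moreover have "self_adjoint S" by (simp add: self_adjoint_def S_sym)
  ultimately show ?thesis using that[OF S SR RS] D_eq by blast
qed

text \<open>The comparison of the Gaussian measures is transported to the whitened operators; the test
  vectors, at first in \<open>range L\<close>, are arbitrary by density.\<close>

lemma gaussian_whitened_close:
  assumes close: "second_moment_close \<nu> \<nu>' H" and H: "0 \<le> H" "H \<le> 1 / 100"
    and G: "is_gaussian \<nu> m (L o\<^sub>L (R o\<^sub>L L))" and G': "is_gaussian \<nu>' m' (L o\<^sub>L (R' o\<^sub>L L))"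
    and sa: "self_adjoint R" "self_adjoint R'" and M: "norm R \<le> M" "norm R' \<le> M"
    and E: "orthonormal_basis E"
  shows "\<exists>d. m' - m = L d \<and> (norm d)\<^sup>2 \<le> 16 * H * M"
    and "hs_bounded E ((R' - R)) ((17 * M)\<^sup>2 * H)"
proof -
  have M0: "0 \<le> M" using M(1) norm_ge_zero[of R] by linarith
  have Mx: "norm (T x) \<le> M * norm x" if "norm T \<le> M" for T :: "'h \<Rightarrow>\<^sub>L 'h" and x
    using norm_blinfun[of T x] that mult_right_mono[of "norm T" M "norm x"] by simp
  have form: "h \<bullet> (L o\<^sub>L (T o\<^sub>L L)) k = L h \<bullet> T (L k)"
    for h k and T :: "'h \<Rightarrow>\<^sub>L 'h" by (simp add: L_sym)
  have var: "h \<bullet> (L o\<^sub>L (T o\<^sub>L L)) h \<le> M * (norm (L h))\<^sup>2" if "norm T \<le> M" for T h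
  proof -
    have "L h \<bullet> T (L h) \<le> norm (L h) * (M * norm (L h))"
      using Mx[OF that] by (meson mult_left_mono norm_cauchy_schwarz norm_ge_zero order_trans)
    then show ?thesis unfolding form by (simp add: power2_eq_square mult_ac)
  qed
  have mean: "\<bar>h \<bullet> (m' - m)\<bar> \<le> sqrt (16 * H * M) * norm (L h)" for h
  proof -
    let ?t = "h \<bullet> (m' - m)" and ?n = "(norm (L h))\<^sup>2"
    have "?t\<^sup>2 \<le> 2 * H * (h \<bullet> (L o\<^sub>L (R o\<^sub>L L)) h + h \<bullet> (L o\<^sub>L (R' o\<^sub>L L)) h + ?t\<^sup>2)"
      by (rule gaussian_mean_close[OF close G G'])
    also have "\<dots> \<le> 2 * H * (M * ?n + M * ?n + ?t\<^sup>2)"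
      using var[OF M(1)] var[OF M(2)] H by (intro mult_left_mono add_mono) auto
    also have "\<dots> = 4 * H * M * ?n + 2 * H * ?t\<^sup>2" by (simp add: algebra_simps)
    also have "2 * H * ?t\<^sup>2 \<le> ?t\<^sup>2 / 2" using H mult_right_mono[of "2 * H" "1 / 2" "?t\<^sup>2"] by simp
    finally have "?t\<^sup>2 \<le> 8 * H * M * ?n" by simp
    also have "\<dots> \<le> 16 * H * M * ?n" using H M0 by (intro mult_right_mono) auto
    also have "\<dots> = (sqrt (16 * H * M) * norm (L h))\<^sup>2"
      using H M0 by (simp add: power_mult_distrib)
    finally show ?thesis using H M0 by (simp add: abs_le_square_iff[symmetric])
  qed
  obtain d where d: "m' - m = L d"
    using bounded_functional_range[OF L_self_adjoint L_dense mean] by blast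
  have "norm d \<le> sqrt (16 * H * M)"
  proof (rule dense_norm_le[OF L_dense])
    fix v assume "v \<in> range L"
    then obtain f where v: "v = L f" by blast
    have "d \<bullet> v = f \<bullet> (m' - m)"
      unfolding v d using L_sym[of d f] by (metis inner_commute)
    then show "\<bar>d \<bullet> v\<bar> \<le> sqrt (16 * H * M) * norm v" using mean[of f] by (simp add: v)
  qed (use H M0 in simp)
  then have "(norm d)\<^sup>2 \<le> (sqrt (16 * H * M))\<^sup>2" by (intro power_mono) auto
  then have d2: "(norm d)\<^sup>2 \<le> 16 * H * M" using H M0 by simp
  with d show "\<exists>d. m' - m = L d \<and> (norm d)\<^sup>2 \<le> 16 * H * M" by blast
  show "hs_bounded E ((R' - R)) ((17 * M)\<^sup>2 * H)"
  proof (rule hs_boundedI_coefficients[OF E])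
    fix J F assume J: "finite J" "J \<subseteq> E" and F: "finite F" "F \<subseteq> E"
    \<comment> \<open>The quadratic test uses one index set for rows and columns.\<close>
    define K where "K = J \<union> F"
    have K: "finite K" "K \<subseteq> E" using J F by (auto simp: K_def)
    have "(\<Sum>f\<in>F. \<Sum>j\<in>J. (j \<bullet> (R' - R) f)\<^sup>2) \<le> (\<Sum>f\<in>F. \<Sum>j\<in>K. (j \<bullet> (R' - R) f)\<^sup>2)"
      using K by (intro sum_mono sum_mono2) (auto simp: K_def)
    also have "\<dots> \<le> (\<Sum>f\<in>K. \<Sum>j\<in>K. (j \<bullet> (R' - R) f)\<^sup>2)"
      using K by (intro sum_mono2) (auto simp: K_def intro: sum_nonneg)
    also have "\<dots> \<le> (17 * M)\<^sup>2 * H"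
    proof (rule quadratic_test_bound[OF E K sa M0 Mx[OF M(1)] Mx[OF M(2)] H(1) _ d2])
      show "H \<le> 1 / 4" using H by simp
      fix w :: "'h \<Rightarrow> 'h"
      have "\<exists>f. (\<lambda>n. L (f n)) \<longlonglongrightarrow> x" for x using L_dense_seq[of x] by metis
      then obtain a where a: "\<And>x. (\<lambda>n. L (a x n)) \<longlonglongrightarrow> x" by metis
      define s where "s u v = (\<Sum>j\<in>K. u j \<bullet> R' (v j) - u j \<bullet> R (v j) + (u j \<bullet> d) * (v j \<bullet> d))"
        for u v :: "'h \<Rightarrow> 'h"
      define l where "l u v = (\<Sum>j\<in>K. (u j \<bullet> d) *\<^sub>R v j + (v j \<bullet> d) *\<^sub>R u j)" for u v :: "'h \<Rightarrow> 'h"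
      define V where "V u v T = (\<Sum>i\<in>K. \<Sum>j\<in>K. (u i \<bullet> T (u j)) * (v i \<bullet> T (v j))
          + (u i \<bullet> T (v j)) * (v i \<bullet> T (u j)))"
        for u v :: "'h \<Rightarrow> 'h" and T :: "'h \<Rightarrow>\<^sub>L 'h"
      have "(s (\<lambda>j. j) w)\<^sup>2 \<le> 2 * H * (V (\<lambda>j. j) w R + V (\<lambda>j. j) w R'
          + l (\<lambda>j. j) w \<bullet> R' (l (\<lambda>j. j) w) + (s (\<lambda>j. j) w)\<^sup>2)"
      proof (rule LIMSEQ_le)
        let ?u = "\<lambda>n j. L (a j n)" and ?v = "\<lambda>n j. L (a (w j) n)"
        have st: "(\<lambda>n. s (?u n) (?v n)) \<longlonglongrightarrow> s (\<lambda>j. j) w"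
          unfolding s_def by (intro tendsto_intros a)
        then show "(\<lambda>n. (s (?u n) (?v n))\<^sup>2) \<longlonglongrightarrow> (s (\<lambda>j. j) w)\<^sup>2" by (intro tendsto_intros)
        have "(\<lambda>n. V (?u n) (?v n) T) \<longlonglongrightarrow> V (\<lambda>j. j) w T" for T
          unfolding V_def by (intro tendsto_intros a)
        moreover have "(\<lambda>n. l (?u n) (?v n)) \<longlonglongrightarrow> l (\<lambda>j. j) w"
          unfolding l_def by (intro tendsto_intros a)
        ultimately show "(\<lambda>n. 2 * H * (V (?u n) (?v n) R + V (?u n) (?v n) R'
            + l (?u n) (?v n) \<bullet> R' (l (?u n) (?v n)) + (s (?u n) (?v n))\<^sup>2))
          \<longlonglongrightarrow> 2 * H * (V (\<lambda>j. j) w R + V (\<lambda>j. j) w R'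
            + l (\<lambda>j. j) w \<bullet> R' (l (\<lambda>j. j) w) + (s (\<lambda>j. j) w)\<^sup>2)"
          using st by (intro tendsto_intros)
        have "(s (?u n) (?v n))\<^sup>2 \<le> 2 * H * (V (?u n) (?v n) R + V (?u n) (?v n) R'
            + l (?u n) (?v n) \<bullet> R' (l (?u n) (?v n)) + (s (?u n) (?v n))\<^sup>2)" for n
        proof -
          have hd: "h \<bullet> (m' - m) = L h \<bullet> d" for h by (simp add: d L_sym)
          have Ll: "L (\<Sum>j\<in>K. (L (a j n) \<bullet> d) *\<^sub>R a (w j) n + (L (a (w j) n) \<bullet> d) *\<^sub>R a j n)
              = l (?u n) (?v n)"
            by (simp add: l_def blinfun.sum_right blinfun.bilinear_simps)
          show ?thesis
            using gaussian_quadratic_close[OF close G G', where J = K and f = "\<lambda>j. a j n" and g = "\<lambda>j. a (w j) n"]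
            unfolding form hd Ll unfolding s_def V_def .
        qed
        then show "\<exists>N. \<forall>n\<ge>N. (s (?u n) (?v n))\<^sup>2 \<le> 2 * H * (V (?u n) (?v n) R + V (?u n) (?v n) R'
            + l (?u n) (?v n) \<bullet> R' (l (?u n) (?v n)) + (s (?u n) (?v n))\<^sup>2)" by blast
      qed
      then show "let s = \<Sum>j\<in>K. j \<bullet> R' (w j) - j \<bullet> R (w j) + (j \<bullet> d) * (w j \<bullet> d);
        l = \<Sum>j\<in>K. (j \<bullet> d) *\<^sub>R w j + (w j \<bullet> d) *\<^sub>R j;
        V = \<lambda>D. \<Sum>i\<in>K. \<Sum>j\<in>K. (i \<bullet> D j) * (w i \<bullet> D (w j))
          + (i \<bullet> D (w j)) * (w i \<bullet> D j)
        in s\<^sup>2 \<le> 2 * H * (V R + V R' + l \<bullet> R' l + s\<^sup>2)"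
        unfolding Let_def s_def l_def V_def .
    qed
    finally show "(\<Sum>f\<in>F. \<Sum>j\<in>J. (j \<bullet> (R' - R) f)\<^sup>2) \<le> (17 * M)\<^sup>2 * H" .
  qed
qed

end

section \<open>Norm bounds for operators and their inverses\<close>

lemma hs_bounded_norm:
  assumes E: "orthonormal_basis E" and T: "hs_bounded E T c" and sym: "\<And>x y. T x \<bullet> y = x \<bullet> T y"
  shows "(norm (T x))\<^sup>2 \<le> c * (norm x)\<^sup>2"
proof (rule field_le_epsilon)
  fix e :: real assume "e > 0"
  then obtain J where J: "finite J" "J \<subseteq> E" "(norm (T x))\<^sup>2 < (\<Sum>j\<in>J. (j \<bullet> T x)\<^sup>2) + e"
    using Parseval_approx[OF E] by blast
  have "(\<Sum>j\<in>J. (j \<bullet> T x)\<^sup>2) \<le> (\<Sum>j\<in>J. (norm (T j))\<^sup>2 * (norm x)\<^sup>2)"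
  proof (intro sum_mono)
    show "(j \<bullet> T x)\<^sup>2 \<le> (norm (T j))\<^sup>2 * (norm x)\<^sup>2" for j
      using Cauchy_Schwarz_ineq[of "T j" x] sym[of j x] by (simp only: power2_norm_eq_inner)
  qed
  also have "\<dots> = (\<Sum>j\<in>J. (norm (T j))\<^sup>2) * (norm x)\<^sup>2" by (simp add: sum_distrib_right)
  also have "\<dots> \<le> c * (norm x)\<^sup>2" using T J by (intro mult_right_mono) (auto simp: hs_bounded_def)
  finally show "(norm (T x))\<^sup>2 \<le> c * (norm x)\<^sup>2 + e" using J(3) by linarith
qed

text \<open>Monotonicity of inversion with an explicit norm bound. For x = S' y and z = R x, so that
  x = S z, Cauchy--Schwarz for the form of S bounds the fourth power of \<open>norm x\<close> by (x
  \<bullet> S x) (z \<bullet> S z). The second factor is x \<bullet> R x \<le> 2 (x \<bullet> R' x)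
  = 2 (x \<bullet> y).\<close>

lemma inverse_norm_bound:
  fixes R S R' S' :: "'h::real_inner \<Rightarrow>\<^sub>L 'h"
  assumes R: "nonneg_operator R" and S: "self_adjoint S" "S o\<^sub>L R = id_blinfun" "R o\<^sub>L S = id_blinfun"
    and S': "R' o\<^sub>L S' = id_blinfun" "S' o\<^sub>L R' = id_blinfun"
    and le: "\<And>x. x \<bullet> R x \<le> 2 * (x \<bullet> R' x)"
  shows "norm (S' y) \<le> 2 * norm S * norm y"
proof -
  have id: "S (R x) = x" "R (S x) = x"
    "R' (S' x) = x" for x
    using S S' by (metis blinfun_apply_blinfun_compose blinfun_apply_id_blinfun id_apply)+
  have nnS: "nonneg_operator S"
    unfolding nonneg_operator_def
  proof (intro conjI allI S(1))
    show "0 \<le> x \<bullet> S x" for x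
      using nonneg_operatorD[OF R, of "S x"] by (simp add: id inner_commute)
  qed
  define x where "x = S' y"
  have y: "y = R' x" by (simp add: x_def id)
  define z where "z = R x"
  have x: "x = S z" by (simp add: z_def id)
  have "((norm x)\<^sup>2)\<^sup>2 \<le> (x \<bullet> S x) * (z \<bullet> S z)"
    using nonneg_operator_Cauchy_Schwarz[OF nnS, of x z] by (simp add: x[symmetric] power2_norm_eq_inner)
  also have "\<dots> \<le> (norm x * (norm S * norm x)) * (x \<bullet> z)"
  proof (rule mult_mono)
    show "x \<bullet> S x \<le> norm x * (norm S * norm x)"
      by (meson mult_left_mono norm_blinfun norm_cauchy_schwarz norm_ge_zero order_trans)
    show "0 \<le> z \<bullet> S z" by (rule nonneg_operatorD[OF nnS])
  qed (auto simp: x[symmetric] inner_commute)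
  also have "\<dots> \<le> (norm x * (norm S * norm x)) * (2 * (norm x * norm y))"
  proof (rule mult_left_mono)
    have "x \<bullet> z \<le> 2 * (x \<bullet> y)" using le[of x] by (simp add: z_def y)
    also have "\<dots> \<le> 2 * (norm x * norm y)" using norm_cauchy_schwarz[of x y] by simp
    finally show "x \<bullet> z \<le> 2 * (norm x * norm y)" .
  qed auto
  finally have "norm x ^ 3 * norm x \<le> norm x ^ 3 * (2 * norm S * norm y)"
    by (simp add: power2_eq_square power3_eq_cube mult_ac)
  then have "norm x \<le> 2 * norm S * norm y"
    by (cases "x = 0") auto
  then show ?thesis by (simp add: x_def)
qed

section \<open>Weak limits of Gaussian measures\<close>

text \<open>Characteristic functions: weak convergence gives the limit of the expectations of cosine
  and sine, and on the Gaussian side the parameters move inside an integral over a fixed standard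
  normal law, where dominated convergence applies.\<close>

lemma weak_limit_gaussian_marginal:
  fixes \<nu>s :: "'h::{real_inner, second_countable_topology} measure"
  assumes G: "\<And>n. is_gaussian (\<nu> n) (m n) (D n)" and weak: "weakly_converges \<nu> \<nu>s"
    and \<nu>s: "prob_space \<nu>s" "sets \<nu>s = sets borel"
    and m: "(\<lambda>n. h \<bullet> m n) \<longlonglongrightarrow> a" and s: "(\<lambda>n. h \<bullet> (D n) h) \<longlonglongrightarrow> v"
  shows "distr \<nu>s borel (\<lambda>x. h \<bullet> x) = distr std_normal_distribution borel (\<lambda>y. a + sqrt v * y)"
proof (rule Levy_uniqueness)
  interpret N: prob_space \<nu>s by fact
  interpret S: real_distribution std_normal_distribution by (rule real_dist_normal_dist)
  note [measurable] = inner_measurable_of_sets[OF \<nu>s(2)]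
  show "real_distribution (distr \<nu>s borel (\<lambda>x. h \<bullet> x))"
    by (intro real_distribution.intro N.prob_space_distr real_distribution_axioms.intro) auto
  show "real_distribution (distr std_normal_distribution borel (\<lambda>y. a + sqrt v * y))"
    by (intro real_distribution.intro S.prob_space_distr real_distribution_axioms.intro) auto
  have trig: "(\<integral>x. F (h \<bullet> x) \<partial>\<nu>s) = (\<integral>y. F (a + sqrt v * y) \<partial>std_normal_distribution)"
    if F: "continuous_on UNIV F" and F1: "\<And>x. \<bar>F x\<bar> \<le> 1" for F :: "real \<Rightarrow> real"
  proof -
    have [measurable]: "F \<in> borel_measurable borel" using F by (rule borel_measurable_continuous_onI)
    have "(\<lambda>n. \<integral>x. F (h \<bullet> x) \<partial>\<nu> n) \<longlonglongrightarrow> (\<integral>x. F (h \<bullet> x) \<partial>\<nu>s)"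
    proof -
      have "continuous_on UNIV (\<lambda>x. F (h \<bullet> x))"
        by (rule continuous_on_compose2[OF F]) (auto intro: continuous_intros)
      moreover have "bounded (range (\<lambda>x. F (h \<bullet> x)))" using F1 by (auto simp: bounded_iff)
      ultimately show ?thesis using weak unfolding weakly_converges_def by blast
    qed
    moreover have "(\<lambda>n. \<integral>x. F (h \<bullet> x) \<partial>\<nu> n) \<longlonglongrightarrow> (\<integral>y. F (a + sqrt v * y) \<partial>std_normal_distribution)"
      unfolding gaussian_integral_marginal[OF G \<open>F \<in> borel_measurable borel\<close>]
    proof (rule integral_dominated_convergence[where w = "\<lambda>_. 1"])
      show "AE y in std_normal_distribution. (\<lambda>n. F (h \<bullet> m n + sqrt (h \<bullet> (D n) h) * y)) \<longlonglongrightarrow> F (a + sqrt v * y)"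
      proof (rule AE_I2)
        fix y
        have "(\<lambda>n. h \<bullet> m n + sqrt (h \<bullet> (D n) h) * y) \<longlonglongrightarrow> a + sqrt v * y"
          by (intro tendsto_intros m s)
        then show "(\<lambda>n. F (h \<bullet> m n + sqrt (h \<bullet> (D n) h) * y)) \<longlonglongrightarrow> F (a + sqrt v * y)"
          using F by (intro continuous_on_tendsto_compose[OF F]) auto
      qed
    qed (use F1 in auto)
    ultimately show ?thesis by (rule LIMSEQ_unique)
  qed
  show "char (distr \<nu>s borel (\<lambda>x. h \<bullet> x)) = char (distr std_normal_distribution borel (\<lambda>y. a + sqrt v * y))"
  proof
    fix t
    \<comment> \<open>Weak convergence is formulated for real test functions, hence the split into
      real and imaginary part.\<close>
    have split: "(CLINT x|M. iexp (t * X x)) = complex_of_real (\<integral>x. cos (t * X x) \<partial>M) + \<i> * complex_of_real (\<integral>x. sin (t * X x) \<partial>M)"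
      if "prob_space M" and [measurable]: "X \<in> borel_measurable M" for M :: "'b measure" and X
    proof -
      interpret prob_space M by fact
      have "integrable M (\<lambda>x. cos (t * X x))" "integrable M (\<lambda>x. sin (t * X x))"
        by (intro integrable_const_bound[where B = 1]; simp)+
      then have "(CLINT x|M. complex_of_real (cos (t * X x)) + \<i> * complex_of_real (sin (t * X x)))
          = complex_of_real (\<integral>x. cos (t * X x) \<partial>M) + \<i> * complex_of_real (\<integral>x. sin (t * X x) \<partial>M)"
        by simp
      moreover have "iexp (t * X x) = complex_of_real (cos (t * X x)) + \<i> * complex_of_real (sin (t * X x))" for x
        using exp_Euler[of "complex_of_real (t * X x)"] by (simp only: cos_of_real sin_of_real)
      ultimately show ?thesis by (simp only:)
    qed
    have "char (distr \<nu>s borel (\<lambda>x. h \<bullet> x)) t = (CLINT x|\<nu>s. iexp (t * (h \<bullet> x)))"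
      unfolding char_def by (subst integral_distr) auto
    also have "\<dots> = (CLINT y|std_normal_distribution. iexp (t * (a + sqrt v * y)))"
      using trig[of "\<lambda>z. cos (t * z)"] trig[of "\<lambda>z. sin (t * z)"] split[OF \<nu>s(1), of "\<lambda>x. h \<bullet> x"]
        split[OF S.prob_space_axioms, of "\<lambda>y. a + sqrt v * y"]
      by (simp add: continuous_intros)
    also have "\<dots> = char (distr std_normal_distribution borel (\<lambda>y. a + sqrt v * y)) t"
      unfolding char_def by (subst integral_distr) auto
    finally show "char (distr \<nu>s borel (\<lambda>x. h \<bullet> x)) t = char (distr std_normal_distribution borel (\<lambda>y. a + sqrt v * y)) t" .
  qed
qed

lemma is_gaussianI_marginals:
  fixes \<nu> :: "'h::real_inner measure"
  assumes \<nu>: "prob_space \<nu>" "sets \<nu> = sets borel" and D: "nonneg_operator D"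
    and marginal: "\<And>h. distr \<nu> borel (\<lambda>x. h \<bullet> x) =
      distr std_normal_distribution borel (\<lambda>y. h \<bullet> m + sqrt (h \<bullet> D h) * y)"
  shows "is_gaussian \<nu> m D"
proof -
  interpret N: prob_space \<nu> by fact
  interpret S: real_distribution std_normal_distribution by (rule real_dist_normal_dist)
  note [measurable] = inner_measurable_of_sets[OF \<nu>(2)]
  have i1: "integrable std_normal_distribution (\<lambda>y. y)" and i2: "integrable std_normal_distribution (\<lambda>y. y^2)"
    using integrable_std_normal_distribution_moment[of 1] integrable_std_normal_distribution_moment[of 2] by simp_all
  have mean: "(\<integral>x. h \<bullet> x \<partial>\<nu>) = h \<bullet> m" for h
  proof -
    have "(\<integral>x. h \<bullet> x \<partial>\<nu>) = (\<integral>y. h \<bullet> m + sqrt (h \<bullet> D h) * y \<partial>std_normal_distribution)"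
      using arg_cong[OF marginal[of h], of "\<lambda>M. integral\<^sup>L M (\<lambda>x. x)"] by (simp add: integral_distr)
    also have "\<dots> = h \<bullet> m" using i1 S.prob_space by (simp add: std_normal_moment_values)
    finally show ?thesis .
  qed
  have var: "has_bochner_integral \<nu> (\<lambda>x. (h \<bullet> (x - m))\<^sup>2) (h \<bullet> D h)" for h
  proof -
    let ?s = "sqrt (h \<bullet> D h)"
    have "integrable std_normal_distribution (\<lambda>y. ?s\<^sup>2 * y\<^sup>2)" using i2 by simp
    then have "integrable (distr std_normal_distribution borel (\<lambda>y. h \<bullet> m + ?s * y)) (\<lambda>x. (x - h \<bullet> m)\<^sup>2)"
      by (subst integrable_distr_eq) (auto simp: power_mult_distrib)
    then have "integrable \<nu> (\<lambda>x. (h \<bullet> x - h \<bullet> m)\<^sup>2)"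
      unfolding marginal[symmetric] by (subst (asm) integrable_distr_eq) auto
    moreover have "(\<integral>x. (h \<bullet> x - h \<bullet> m)\<^sup>2 \<partial>\<nu>) = (\<integral>y. ?s\<^sup>2 * y\<^sup>2 \<partial>std_normal_distribution)"
      using arg_cong[OF marginal[of h], of "\<lambda>M. integral\<^sup>L M (\<lambda>x. (x - h \<bullet> m)\<^sup>2)"]
      by (simp add: integral_distr power_mult_distrib)
    ultimately show ?thesis
      using i2 nonneg_operatorD[OF D, of h] by (simp add: has_bochner_integral_iff std_normal_moment_values inner_diff_right)
  qed
  have cov: "(\<integral>x. (h \<bullet> (x - m)) * (k \<bullet> (x - m)) \<partial>\<nu>) = h \<bullet> D k" for h k
  proof -
    let ?q = "\<lambda>h. h \<bullet> D h"
    have "has_bochner_integral \<nu> (\<lambda>x. (1 / 4) * (((h + k) \<bullet> (x - m))\<^sup>2 - ((h - k) \<bullet> (x - m))\<^sup>2))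
        ((1 / 4) * (?q (h + k) - ?q (h - k)))"
      by (intro has_bochner_integral_diff has_bochner_integral_mult_right var)
    moreover have "(1 / 4) * (((h + k) \<bullet> (x - m))\<^sup>2 - ((h - k) \<bullet> (x - m))\<^sup>2)
        = (h \<bullet> (x - m)) * (k \<bullet> (x - m))" for x
      unfolding inner_add_left inner_diff_left by algebra
    moreover have "(1 / 4) * (?q (h + k) - ?q (h - k)) = h \<bullet> D k"
      using self_adjointD[OF nonneg_operator_self_adjoint[OF D], of h k]
      by (simp add: blinfun.bilinear_simps inner_add_left inner_add_right inner_diff_left inner_diff_right inner_commute)
    ultimately show ?thesis by (simp add: has_bochner_integral_iff)
  qed
  have "\<exists>a s. 0 \<le> s \<and> distr \<nu> borel (\<lambda>x. h \<bullet> x) = normal_law a s" for h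
    using marginal[of h] normal_law_eq_distr[of "sqrt (h \<bullet> D h)" "h \<bullet> m"] nonneg_operatorD[OF D, of h]
    by (metis real_sqrt_ge_zero)
  then show ?thesis
    using \<nu> mean cov by (simp add: is_gaussian_def gaussian_measure_def)
qed

section \<open>Convergence of means and precisions\<close>

lemma Cauchy_of_square_bound:
  fixes x :: "nat \<Rightarrow> 'v::real_normed_vector"
  assumes A: "0 \<le> A" and bound: "\<And>n k. (norm (x n - x k))\<^sup>2 \<le> A * H n k"
    and H: "\<And>e. e > 0 \<Longrightarrow> \<exists>N. \<forall>n\<ge>N. \<forall>k\<ge>N. H n k < e"
  shows "Cauchy x"
proof (rule metric_CauchyI)
  fix e :: real assume e: "e > 0"
  then have "e\<^sup>2 / (A + 1) > 0" using A by simp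
  then obtain N where N: "\<And>n k. n \<ge> N \<Longrightarrow> k \<ge> N \<Longrightarrow> H n k < e\<^sup>2 / (A + 1)" using H by meson
  have "dist (x n) (x k) < e" if "n \<ge> N" "k \<ge> N" for n k
  proof -
    have "(norm (x n - x k))\<^sup>2 \<le> A * (e\<^sup>2 / (A + 1))"
      using bound[of n k] N[OF that] A mult_left_mono[of "H n k" "e\<^sup>2 / (A + 1)" A] by linarith
    also have "\<dots> < e\<^sup>2" using A e by (simp add: field_simps)
    finally show ?thesis using e by (simp add: dist_norm power2_less_imp_less)
  qed
  then show "\<exists>N. \<forall>n\<ge>N. \<forall>k\<ge>N. dist (x n) (x k) < e" by blast
qed

section \<open>Construction of the limiting parameters\<close>

context cameron_martin
begin

lemma sqrt_conj_eqI:
  assumes "\<And>y. y \<bullet> z = \<Gamma> (L x) (L y)"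
  shows "sqrt_conj C0 \<Gamma> x = z"
  unfolding sqrt_conj_def sqrt_on_dual_def L_def[symmetric] assms[symmetric]
  by (rule the_equality) (auto intro: inner_eq_imp_eq)

text \<open>The element of \<open>HS(H\<^sup>1, H\<^sup>-\<^sup>1)\<close> whose conjugate by \<open>C0\<^sup>1\<^sup>/\<^sup>2\<close> is T.\<close>

definition conj_inverse :: "('h \<Rightarrow>\<^sub>L 'h) \<Rightarrow> 'h \<Rightarrow> 'h \<Rightarrow> real" where
  "conj_inverse T v u = inv_sqrt C0 u \<bullet> T (inv_sqrt C0 v)"

lemma sqrt_conj_conj_inverse: "sqrt_conj C0 (conj_inverse T) = blinfun_apply T"
proof
  show "sqrt_conj C0 (conj_inverse T) x = T x" for x
    by (rule sqrt_conj_eqI) (simp add: conj_inverse_def inv_sqrt_L)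
qed

lemma inv_sqrt_linear:
  assumes "u \<in> cm_space C0" "v \<in> cm_space C0"
  shows "inv_sqrt C0 (a *\<^sub>R u + b *\<^sub>R v) = a *\<^sub>R inv_sqrt C0 u + b *\<^sub>R inv_sqrt C0 v"
proof -
  obtain x y where "u = L x" "v = L y"
    using assms by (auto simp: cm_space_eq)
  then have "a *\<^sub>R u + b *\<^sub>R v = L (a *\<^sub>R x + b *\<^sub>R y)"
    by (simp add: blinfun.bilinear_simps)
  then show ?thesis using \<open>u = _\<close> \<open>v = _\<close> by (simp add: inv_sqrt_L)
qed

lemma conj_inverse_cm_hs:
  fixes T :: "'h \<Rightarrow>\<^sub>L 'h"
  assumes "hilbert_schmidt T"
  shows "conj_inverse T \<in> cm_hs C0"
proof -
  have "conj_inverse T v \<in> cm_dual C0" for v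
    unfolding cm_dual_def
  proof (intro CollectI conjI ballI allI exI)
    fix u w a b assume "u \<in> cm_space C0" "w \<in> cm_space C0"
    then show "conj_inverse T v (a *\<^sub>R u + b *\<^sub>R w) = a * conj_inverse T v u + b * conj_inverse T v w"
      by (simp add: conj_inverse_def inv_sqrt_linear inner_add_left)
  next
    fix u
    show "\<bar>conj_inverse T v u\<bar> \<le> norm (T (inv_sqrt C0 v)) * sqrt (cm_inner C0 u u)"
      using Cauchy_Schwarz_ineq2[of "inv_sqrt C0 u" "T (inv_sqrt C0 v)"]
      by (simp add: conj_inverse_def cm_inner_def norm_eq_sqrt_inner[symmetric] mult.commute)
  qed
  then show ?thesis
    using assms unfolding cm_hs_def
    by (auto simp: sqrt_conj_conj_inverse)
      (simp add: conj_inverse_def inv_sqrt_linear blinfun.bilinear_simps inner_add_right)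
qed

lemma conj_inverse_cm_symmetric: "self_adjoint T \<Longrightarrow> cm_symmetric C0 (conj_inverse T)"
  unfolding cm_symmetric_def conj_inverse_def by (metis inner_commute self_adjointD)

text \<open>The converse of the whitening, which produces the limiting \<Gamma> from a limit of
  operators. Strict positivity comes from invertibility: where the nonnegative form of S vanishes, S
  itself vanishes.\<close>

lemma precision_inverse_conj_inverse:
  assumes S: "self_adjoint S" "\<And>x. 0 \<le> x \<bullet> S x" and hs: "hilbert_schmidt ((S - id_blinfun))"
    and inv: "S o\<^sub>L R = id_blinfun" "R o\<^sub>L S = id_blinfun"
  shows "precision_strictly_positive C0 (conj_inverse (S - id_blinfun))"
    and "is_precision_inverse C0 (conj_inverse (S - id_blinfun)) (L o\<^sub>L (R o\<^sub>L L))"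
proof -
  let ?G = "conj_inverse (S - id_blinfun)"
  have sa: "self_adjoint (S - id_blinfun)"
    using S(1) by (simp add: self_adjoint_def blinfun.diff_left inner_diff_left inner_diff_right)
  note G = conj_inverse_cm_hs[OF hs] conj_inverse_cm_symmetric[OF sa]
  have SG: "x + sqrt_conj C0 ?G x = S x" for x
    by (simp add: sqrt_conj_conj_inverse blinfun.diff_left)
  have id: "S (R x) = x" "R (S x) = x" for x
    using inv by (metis blinfun_apply_blinfun_compose blinfun_apply_id_blinfun id_apply)+
  have dom: "\<exists>a f. u = L a \<and> S a = L f \<and> precision_op C0 ?G u = f"
    if u: "u \<in> precision_domain C0 ?G" for u
  proof -
    obtain a f where a: "u = L a" "a + sqrt_conj C0 ?G a = L f"
      using u precision_domain_iff[OF G] by blast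
    then show ?thesis using precision_op_L[OF G a(2)] SG by metis
  qed
  show "precision_strictly_positive C0 ?G"
    unfolding precision_strictly_positive_def
  proof (intro ballI impI)
    fix u assume u: "u \<in> precision_domain C0 ?G" "u \<noteq> 0"
    obtain a f where a: "u = L a" "S a = L f" "precision_op C0 ?G u = f"
      using dom[OF u(1)] by blast
    have "u \<bullet> f = a \<bullet> S a" by (simp add: a L_sym)
    moreover have "a \<bullet> S a \<noteq> 0"
    proof
      assume "a \<bullet> S a = 0"
      then have "S a = 0"
        using S by (intro nonneg_operator_form_zero) (auto simp: nonneg_operator_def)
      then have "a = 0" using id(2)[of a] by (simp add: blinfun.zero_right)
      then show False using u(2) a(1) by (simp add: blinfun.zero_right)
    qed
    ultimately show "0 < u \<bullet> precision_op C0 ?G u" using S(2)[of a] a(3) by simp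
  qed
  show "is_precision_inverse C0 ?G (L o\<^sub>L (R o\<^sub>L L))"
    unfolding is_precision_inverse_def
  proof (intro conjI allI ballI)
    fix f
    let ?a = "R (L f)"
    have eq: "?a + sqrt_conj C0 ?G ?a = L f" by (simp only: SG id)
    then show "(L o\<^sub>L (R o\<^sub>L L)) f \<in> precision_domain C0 ?G"
      unfolding precision_domain_iff[OF G] by auto
    show "precision_op C0 ?G ((L o\<^sub>L (R o\<^sub>L L)) f) = f"
      using precision_op_L[OF G eq] by simp
  next
    fix u assume "u \<in> precision_domain C0 ?G"
    then obtain a f where a: "u = L a" "S a = L f" "precision_op C0 ?G u = f"
      using dom by blast
    have "(L o\<^sub>L (R o\<^sub>L L)) f = L (R (S a))"
      by (simp add: a(2))
    then show "(L o\<^sub>L (R o\<^sub>L L)) (precision_op C0 ?G u) = u"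
      unfolding a(3) by (simp add: a(1) id)
  qed
qed

text \<open>Closeness controls the inverses R, while \<Gamma> is read off from S; the passage from R
  to S needs a bound of S that is uniform in n, and index 0 serves as the reference for it.\<close>

lemma whitened_gaussian_limit:
  assumes \<Gamma>: "\<And>n. \<Gamma> n \<in> cm_hs C0" "\<And>n. cm_symmetric C0 (\<Gamma> n)"
    and S: "\<And>n. blinfun_apply (S n) = (\<lambda>x. x + sqrt_conj C0 (\<Gamma> n) x)" "\<And>n. self_adjoint (S n)"
    and inv: "\<And>n. S n o\<^sub>L R n = id_blinfun" "\<And>n. R n o\<^sub>L S n = id_blinfun"
    and R: "\<And>n. nonneg_operator (R n)" "\<And>n. norm (R n) \<le> M"
    and G: "\<And>n. is_gaussian (\<nu> n) (m n) (L o\<^sub>L (R n o\<^sub>L L))"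
    and close: "\<And>n k. second_moment_close (\<nu> n) (\<nu> k) (H n k)"
    and H: "\<And>n k. 0 \<le> H n k" "\<And>n k. H n k \<le> 1 / 100"
      "\<And>e. e > 0 \<Longrightarrow> \<exists>N. \<forall>n\<ge>N. \<forall>k\<ge>N. H n k < e"
  obtains ms Rs \<Gamma>s where "\<Gamma>s \<in> cm_hs C0" "cm_symmetric C0 \<Gamma>s" "precision_strictly_positive C0 \<Gamma>s"
    "is_precision_inverse C0 \<Gamma>s (L o\<^sub>L (Rs o\<^sub>L L))" "nonneg_operator Rs" "m \<longlonglongrightarrow> ms" "R \<longlonglongrightarrow> Rs"
    "(\<lambda>n. cm_norm C0 (m n - ms) + ereal (cm_hs_norm C0 (\<lambda>v u. \<Gamma> n v u - \<Gamma>s v u))) \<longlonglongrightarrow> 0"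
proof -
  obtain E :: "'h set" where E: "orthonormal_basis E" using orthonormal_basis_ex by blast
  have M0: "0 \<le> M" using R(2)[of 0] norm_ge_zero[of "R 0"] by linarith
  have saR: "self_adjoint (R n)" for n using R(1) by (rule nonneg_operator_self_adjoint)
  have R_sym: "(R n) x \<bullet> y = x \<bullet> (R n) y" for n x y
    using saR by (rule self_adjointD)
  have S_sym: "(S n) x \<bullet> y = x \<bullet> (S n) y" for n x y
    using S(2) by (rule self_adjointD)
  have id: "(S n) ((R n) x) = x" "(R n) ((S n) x) = x" for n x
    using inv by (metis blinfun_apply_blinfun_compose blinfun_apply_id_blinfun id_apply)+
  have R_hs: "hs_bounded E ((R k - R n)) ((17 * M)\<^sup>2 * H n k)" for n k
    by (rule gaussian_whitened_close(2)[OF close H(1,2) G G saR saR R(2) R(2) E])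
  \<comment> \<open>The variance comparison from n to 0. It bounds R n from below and thereby its
    inverse S n from above.\<close>
  have lower: "x \<bullet> (R 0) x \<le> 2 * (x \<bullet> (R n) x)" for n x
  proof -
    obtain f where f: "(\<lambda>i. L (f i)) \<longlonglongrightarrow> x" using L_dense_seq by blast
    show ?thesis
    proof (rule LIMSEQ_le)
      show "(\<lambda>i. L (f i) \<bullet> (R 0) (L (f i))) \<longlonglongrightarrow> x \<bullet> (R 0) x"
        by (intro tendsto_intros f)
      show "(\<lambda>i. 2 * (L (f i) \<bullet> (R n) (L (f i)))) \<longlonglongrightarrow> 2 * (x \<bullet> (R n) x)"
        by (intro tendsto_intros f)
      have "L h \<bullet> (R 0) (L h) \<le> 2 * (L h \<bullet> (R n) (L h))" for h
        using gaussian_variance_close[OF close[of n 0] H(2) G G, where h = h] by (simp add: L_sym)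
      then show "\<exists>N. \<forall>i\<ge>N. L (f i) \<bullet> (R 0) (L (f i))
          \<le> 2 * (L (f i) \<bullet> (R n) (L (f i)))" by blast
    qed
  qed
  define s where "s = 2 * norm (S 0)"
  have s0: "0 \<le> s" by (simp add: s_def)
  have S_bound: "norm ((S n) x) \<le> s * norm x" for n x
    unfolding s_def by (rule inverse_norm_bound[OF R(1) S(2) inv(1) inv(2) inv(2) inv(1) lower])
  define A where "A = s\<^sup>2 * (s\<^sup>2 * (17 * M)\<^sup>2)"
  have A0: "0 \<le> A" by (simp add: A_def)
  \<comment> \<open>Here S n - S k = S n (R k - R n) S k. As \<open>hs_bounded_compose\<close>
    multiplies from the left only, the second factor is brought in by passing to adjoints.\<close>
  have S_hs: "hs_bounded E ((S n - S k)) (A * H n k)" for n k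
  proof -
    let ?G = "(R k - R n)"
    have G_sym: "?G x \<bullet> y = x \<bullet> ?G y" for x y
      by (simp add: blinfun.diff_left inner_diff_left inner_diff_right R_sym)
    have "hs_bounded E (\<lambda>x. (S n) (?G x)) (s\<^sup>2 * ((17 * M)\<^sup>2 * H n k))"
      by (rule hs_bounded_compose[OF R_hs s0 S_bound])
    then have "hs_bounded E (\<lambda>x. ?G ((S n) x)) (s\<^sup>2 * ((17 * M)\<^sup>2 * H n k))"
      by (rule hs_bounded_adjoint[OF E E]) (simp add: S_sym G_sym)
    then have "hs_bounded E (\<lambda>x. (S k) (?G ((S n) x))) (s\<^sup>2 * (s\<^sup>2 * ((17 * M)\<^sup>2 * H n k)))"
      by (rule hs_bounded_compose[OF _ s0 S_bound])
    then have "hs_bounded E (\<lambda>x. (S n) (?G ((S k) x))) (s\<^sup>2 * (s\<^sup>2 * ((17 * M)\<^sup>2 * H n k)))"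
      by (rule hs_bounded_adjoint[OF E E]) (simp add: S_sym G_sym)
    moreover have "(S n) (?G ((S k) x)) = (S n - S k) x" for x
      by (simp add: blinfun.diff_left blinfun.diff_right id)
    ultimately show ?thesis by (simp add: A_def mult.assoc)
  qed
  have diff_sym: "(T - T') x \<bullet> y = x \<bullet> (T - T') y"
    if "self_adjoint T" "self_adjoint T'" for T T' :: "'h \<Rightarrow>\<^sub>L 'h" and x y
    using self_adjointD[OF that(1)] self_adjointD[OF that(2)]
    by (simp add: blinfun.diff_left inner_diff_left inner_diff_right)
  have norm_hs: "(norm T)\<^sup>2 \<le> c" if T: "hs_bounded E T c" and c: "0 \<le> c"
    and sym: "\<And>x y. T x \<bullet> y = x \<bullet> T y" for T :: "'h \<Rightarrow>\<^sub>L 'h" and c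
  proof -
    have "norm (T x) \<le> sqrt c * norm x" for x
    proof (rule power2_le_imp_le)
      show "(norm (T x))\<^sup>2 \<le> (sqrt c * norm x)\<^sup>2"
        using hs_bounded_norm[OF E T sym] c by (simp add: power_mult_distrib)
    qed (use c in simp)
    then have "norm T \<le> sqrt c" using c by (intro norm_blinfun_bound) auto
    then have "(norm T)\<^sup>2 \<le> (sqrt c)\<^sup>2" by (intro power_mono) auto
    then show ?thesis using c by simp
  qed
  have "Cauchy S"
    by (rule Cauchy_of_square_bound[OF A0 _ H(3)], rule norm_hs[OF S_hs])
      (use A0 H(1) diff_sym S(2) in auto)
  then obtain Ss where Ss: "S \<longlonglongrightarrow> Ss" using convergent_eq_Cauchy by blast
  have "Cauchy R"
  proof (rule Cauchy_of_square_bound[OF _ _ H(3)])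
    show "0 \<le> (17 * M)\<^sup>2" by simp
    show "(norm (R n - R k))\<^sup>2 \<le> (17 * M)\<^sup>2 * H n k" for n k
      using norm_hs[OF R_hs[of k n]] H(1)[of n k] diff_sym[OF saR saR] by (simp add: norm_minus_commute)
  qed
  then obtain Rs where Rs: "R \<longlonglongrightarrow> Rs" using convergent_eq_Cauchy by blast
  have mean: "\<exists>d. m k - m n = L d \<and> (norm d)\<^sup>2 \<le> 16 * H n k * M" for n k
    by (rule gaussian_whitened_close(1)[OF close H(1,2) G G saR saR R(2) R(2) E])
  \<comment> \<open>The means themselves may lie outside the Cameron--Martin space. Their
    differences lie inside, so they are measured from \<open>m 0\<close>.\<close>
  have "\<exists>d. m k - m 0 = L d" for k using mean[of k 0] by blast
  then obtain d where d: "\<And>k. m k - m 0 = L (d k)" by metis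
  have d_diff: "m k - m n = L (d k - d n)" for k n
  proof -
    have "m k - m n = (m k - m 0) - (m n - m 0)" by simp
    then show ?thesis unfolding d blinfun.diff_right .
  qed
  have "Cauchy d"
  proof (rule Cauchy_of_square_bound[OF _ _ H(3)])
    show "0 \<le> 16 * M" using M0 by simp
    show "(norm (d n - d k))\<^sup>2 \<le> 16 * M * H n k" for n k
    proof -
      obtain d' where d': "m k - m n = L d'" "(norm d')\<^sup>2 \<le> 16 * H n k * M" using mean[of k n] by blast
      then have "d' = d k - d n" using d_diff L_eq_iff by metis
      then show ?thesis using d'(2) by (simp add: norm_minus_commute mult_ac)
    qed
  qed
  then obtain ds where ds: "d \<longlonglongrightarrow> ds" using convergent_eq_Cauchy by blast
  define ms where "ms = m 0 + L ds"
  have m_diff: "m n - ms = L (d n - ds)" for n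
    using d[of n] by (simp add: ms_def blinfun.diff_right algebra_simps)
  have m_lim: "m \<longlonglongrightarrow> ms"
  proof -
    have "(\<lambda>n. m 0 + L (d n)) \<longlonglongrightarrow> ms"
      unfolding ms_def by (intro tendsto_intros ds)
    moreover have "m 0 + L (d n) = m n" for n using d[of n] by (simp add: algebra_simps)
    ultimately show ?thesis by simp
  qed
  note compose_lim = bounded_bilinear.tendsto[OF bounded_bilinear_blinfun_compose]
  have inv_s: "Ss o\<^sub>L Rs = id_blinfun" "Rs o\<^sub>L Ss = id_blinfun"
    using compose_lim[OF Ss Rs] compose_lim[OF Rs Ss] unfolding inv
    by (simp_all add: LIMSEQ_const_iff)
  have sa_s: "self_adjoint Ss" by (rule self_adjoint_limit[OF S(2) Ss])
  have nn_S: "0 \<le> x \<bullet> (S n) x" for n x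
    using nonneg_operatorD[OF R(1)[of n], of "(S n) x"] by (simp add: id inner_commute)
  have nn_s: "0 \<le> x \<bullet> Ss x" for x
  proof (rule LIMSEQ_le_const)
    show "(\<lambda>n. x \<bullet> (S n) x) \<longlonglongrightarrow> x \<bullet> Ss x" by (intro tendsto_intros Ss)
  qed (use nn_S in blast)
  have nn_R: "nonneg_operator Rs"
    unfolding nonneg_operator_def
  proof (intro conjI allI self_adjoint_limit[OF saR Rs])
    fix x
    show "0 \<le> x \<bullet> Rs x"
    proof (rule LIMSEQ_le_const)
      show "(\<lambda>n. x \<bullet> (R n) x) \<longlonglongrightarrow> x \<bullet> Rs x" by (intro tendsto_intros Rs)
    qed (use nonneg_operatorD[OF R(1)] in blast)
  qed
  have S_limit_hs: "hs_bounded E ((S n - Ss)) (A * e)"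
    if "\<And>k. k \<ge> N \<Longrightarrow> H n k \<le> e" for n N e
  proof (rule hs_bounded_limit)
    show "hs_bounded E ((S n - S k)) (A * e)" if "k \<ge> N" for k
      using S_hs[of n k] mult_left_mono[OF \<open>k \<ge> N \<Longrightarrow> H n k \<le> e\<close>[OF that] A0]
      unfolding hs_bounded_def by (meson order_trans)
    show "(\<lambda>k. (S n - S k) x) \<longlonglongrightarrow> (S n - Ss) x" for x
      by (intro tendsto_intros Ss)
  qed
  have id_sa: "self_adjoint (id_blinfun :: 'h \<Rightarrow>\<^sub>L 'h)" by (simp add: self_adjoint_def)
  define K where "K = Ss - id_blinfun"
  have K_sym: "K x \<bullet> y = x \<bullet> K y" for x y
    unfolding K_def by (rule diff_sym[OF sa_s id_sa])
  \<comment> \<open>K is the sum of the whitened \<Gamma> 0 and the limit difference Ss - S 0, both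
    Hilbert--Schmidt; for the latter \<open>H 0 k \<le> 1 / 100\<close> gives an explicit
    bound.\<close>
  have hs: "hilbert_schmidt K"
  proof -
    have "hilbert_schmidt (sqrt_conj C0 (\<Gamma> 0))" using \<Gamma>(1)[of 0] by (simp add: cm_hs_def)
    then obtain c where c: "hs_bounded E (sqrt_conj C0 (\<Gamma> 0)) c"
      using hilbert_schmidt_iff_hs_bounded[OF E sqrt_conj_sym[OF \<Gamma>]] by blast
    have "hs_bounded E (\<lambda>x. - (S 0 - Ss) x) (A * (1 / 100))"
      using S_limit_hs[of 0 0 "1 / 100"] H(2) by (simp add: hs_bounded_def)
    moreover have "(\<lambda>x. sqrt_conj C0 (\<Gamma> 0) x + - (S 0 - Ss) x) = K"
      by (auto simp: K_def blinfun.diff_left S(1))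
    ultimately have "hs_bounded E K (2 * c + 2 * (A * (1 / 100)))"
      using hs_bounded_add[OF c] by metis
    then show ?thesis
      using hilbert_schmidt_iff_hs_bounded[OF E K_sym] blinfun.bounded_linear_right by blast
  qed
  have conj_diff: "sqrt_conj C0 (\<lambda>v u. \<Gamma> n v u - conj_inverse K v u) = blinfun_apply (S n - Ss)" for n
  proof
    fix x
    show "sqrt_conj C0 (\<lambda>v u. \<Gamma> n v u - conj_inverse K v u) x = (S n - Ss) x"
    proof (rule sqrt_conj_eqI)
      fix y
      show "y \<bullet> (S n - Ss) x = \<Gamma> n (L x) (L y) - conj_inverse K (L x) (L y)"
        using inner_sqrt_conj[OF \<Gamma>(1), of y n x]
        by (simp add: conj_inverse_def inv_sqrt_L K_def blinfun.diff_left S(1) inner_diff_right inner_add_right)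
    qed
  qed
  have hs_lim: "(\<lambda>n. hs_norm ((S n - Ss))) \<longlonglongrightarrow> 0"
  proof (rule LIMSEQ_I)
    fix e :: real assume e: "e > 0"
    \<comment> \<open>Half of e, to end with a strict inequality after the passage to the
      limit.\<close>
    then have "(e / 2)\<^sup>2 / (A + 1) > 0" using A0 by simp
    then obtain N where N: "\<And>n k. n \<ge> N \<Longrightarrow> k \<ge> N \<Longrightarrow> H n k < (e / 2)\<^sup>2 / (A + 1)" using H(3) by meson
    have "norm (hs_norm ((S n - Ss)) - 0) < e" if n: "n \<ge> N" for n
    proof -
      have "hs_bounded E ((S n - Ss)) (A * ((e / 2)\<^sup>2 / (A + 1)))"
        using N[OF n] by (intro S_limit_hs[of N]) (auto intro: less_imp_le)
      then have "hs_norm ((S n - Ss)) \<le> sqrt (A * ((e / 2)\<^sup>2 / (A + 1)))"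
        using diff_sym[OF S(2) sa_s] by (intro hs_norm_le[OF E])
      also have "\<dots> \<le> sqrt ((e / 2)\<^sup>2)"
        using A0 by (intro real_sqrt_le_mono) (simp add: field_simps)
      also have "\<dots> < e" using e by simp
      finally show ?thesis using hs_norm_nonneg[of "(S n - Ss)"] by simp
    qed
    then show "\<exists>N. \<forall>n\<ge>N. norm (hs_norm ((S n - Ss)) - 0) < e" by blast
  qed
  show ?thesis
  proof (rule that[of "conj_inverse K" Rs ms])
    show "conj_inverse K \<in> cm_hs C0" using hs by (rule conj_inverse_cm_hs)
    show "cm_symmetric C0 (conj_inverse K)"
      using K_sym by (intro conj_inverse_cm_symmetric) (simp add: self_adjoint_def)
    show "precision_strictly_positive C0 (conj_inverse K)"
      "is_precision_inverse C0 (conj_inverse K) (L o\<^sub>L (Rs o\<^sub>L L))"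
      using precision_inverse_conj_inverse[OF sa_s nn_s hs[unfolded K_def] inv_s] by (auto simp: K_def)
    have "(\<lambda>n. norm (d n - ds) + hs_norm ((S n - Ss))) \<longlonglongrightarrow> norm (ds - ds) + 0"
      by (intro tendsto_intros ds hs_lim)
    then have "(\<lambda>n. ereal (norm (d n - ds) + hs_norm ((S n - Ss)))) \<longlonglongrightarrow> ereal 0"
      by (intro tendsto_intros) simp
    then show "(\<lambda>n. cm_norm C0 (m n - ms) + ereal (cm_hs_norm C0 (\<lambda>v u. \<Gamma> n v u - conj_inverse K v u))) \<longlonglongrightarrow> 0"
      by (simp add: m_diff cm_norm_L cm_hs_norm_def conj_diff zero_ereal_def)
  qed (fact nn_R m_lim Rs)+
qed

end

section \<open>Exclusion of Dirac measures and conclusion\<close>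

lemma absolutely_continuous_trans:
  "absolutely_continuous M N \<Longrightarrow> absolutely_continuous N K \<Longrightarrow> absolutely_continuous M K"
  unfolding absolutely_continuous_def by blast

text \<open>The hyperplane orthogonal to h through a is a null set of \<mu>0, by anticoncentration
  at radius 0, yet it carries the whole Dirac mass.\<close>

lemma (in cameron_martin) Dirac_not_absolutely_continuous:
  fixes h a :: 'h
  assumes G: "is_gaussian \<mu>0 m0 C0" and h: "h \<noteq> 0"
  shows "\<not> absolutely_continuous \<mu>0 (return borel a)"
proof
  assume ac: "absolutely_continuous \<mu>0 (return borel a)"
  interpret prob_space \<mu>0 by (rule is_gaussianD(1)[OF G])
  note sets = is_gaussianD(2)[OF G]
  note [measurable] = inner_measurable_of_sets[OF sets]
  let ?A = "{x\<in>space \<mu>0. \<bar>h \<bullet> x - h \<bullet> a\<bar> \<le> 0}"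
  have "measure \<mu>0 ?A \<le> 0 / sqrt (h \<bullet> C0 h)"
    by (rule gaussian_anticoncentration[OF G C0_form_pos[OF h]]) simp
  then have "measure \<mu>0 ?A = 0" by (simp add: measure_le_0_iff)
  moreover have "?A \<in> sets \<mu>0" by measurable
  ultimately have "?A \<in> null_sets \<mu>0" by (simp add: null_sets_def emeasure_eq_measure)
  then have "?A \<in> null_sets (return borel a)" using ac unfolding absolutely_continuous_def by blast
  then show False
    using sets_eq_imp_space_eq[OF sets] by (auto simp: null_sets_def)
qed

theorem theorem3p5:
  fixes \<mu>0 \<mu> \<nu>s :: "'h::{real_inner, banach, second_countable_topology} measure"
    and m0 :: 'h and C0 :: "'h \<Rightarrow>\<^sub>L 'h"
    and \<iota> :: "'x::{banach, second_countable_topology} \<Rightarrow> 'h" and \<Phi> :: "'x \<Rightarrow> real" and Z :: real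
    and \<nu> :: "nat \<Rightarrow> 'h measure" and m :: "nat \<Rightarrow> 'h" and \<Gamma> :: "nat \<Rightarrow> 'h \<Rightarrow> 'h \<Rightarrow> real"
  assumes "strictly_positive_operator C0" and "nonneg_trace_class C0"
    and "is_gaussian \<mu>0 m0 C0"
    and "bounded_linear \<iota>" and "inj \<iota>"
    and "range \<iota> \<in> sets borel" and "emeasure \<mu>0 (range \<iota>) = 1"
    and "continuous_on UNIV \<Phi>"
    and "integrable \<mu>0 (exp_neg \<iota> \<Phi>)" and "Z = (\<integral>h. exp_neg \<iota> \<Phi> h \<partial>\<mu>0)"
    and "\<mu> = density \<mu>0 (\<lambda>h. ennreal (1 / Z * exp_neg \<iota> \<Phi> h))"
    and "\<And>n. \<Gamma> n \<in> cm_hs C0" and "\<And>n. cm_symmetric C0 (\<Gamma> n)"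
    and "\<And>n. is_NP0 C0 (\<nu> n) (m n) (\<Gamma> n)"
    and "prob_space \<nu>s" and "sets \<nu>s = sets borel"
    and "weakly_converges \<nu> \<nu>s"
    and "(\<lambda>n. D_KL (\<nu> n) \<mu>) \<longlonglongrightarrow> D_KL \<nu>s \<mu>" and "D_KL \<nu>s \<mu> < \<infinity>"
  shows "\<exists>ms \<Gamma>s. \<Gamma>s \<in> cm_hs C0 \<and> cm_symmetric C0 \<Gamma>s \<and> is_NP0 C0 \<nu>s ms \<Gamma>s \<and>
           (\<lambda>n. cm_norm C0 (m n - ms) + ereal (cm_hs_norm C0 (\<lambda>v u. \<Gamma> n v u - \<Gamma>s v u)))
             \<longlonglongrightarrow> 0"
proof -
  interpret cameron_martin C0 by (rule cameron_martin.intro) fact+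
  note G0 = \<open>is_gaussian \<mu>0 m0 C0\<close> and \<Gamma> = assms(12,13) and NP = assms(14)
    and weak = \<open>weakly_converges \<nu> \<nu>s\<close> and \<nu>s = \<open>prob_space \<nu>s\<close> \<open>sets \<nu>s = sets borel\<close>
  interpret M0: prob_space \<mu>0 by (rule is_gaussianD(1)[OF G0])
  note sets0 = is_gaussianD(2)[OF G0]
  have sets_\<mu>: "sets \<mu> = sets borel" using assms(11) sets0 by simp
  have e_meas: "(\<lambda>h. ennreal (1 / Z * exp_neg \<iota> \<Phi> h)) \<in> borel_measurable \<mu>0"
    using assms(9) by measurable
  have ac_\<mu>: "absolutely_continuous \<mu>0 \<mu>"
    unfolding assms(11) using e_meas by (rule absolutely_continuousI_density)
  have fin_\<mu>: "finite_measure \<mu>"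
  proof (rule finite_measureI)
    have nn: "0 \<le> exp_neg \<iota> \<Phi> h" for h by (simp add: exp_neg_def)
    have "0 \<le> Z" unfolding assms(10) using nn by simp
    have "emeasure \<mu> (space \<mu>) = (\<integral>\<^sup>+h. ennreal (1 / Z * exp_neg \<iota> \<Phi> h) \<partial>\<mu>0)"
      unfolding assms(11) using e_meas by (simp add: emeasure_density cong: nn_integral_cong)
    also have "\<dots> = ennreal (\<integral>h. 1 / Z * exp_neg \<iota> \<Phi> h \<partial>\<mu>0)"
      using assms(9) nn \<open>0 \<le> Z\<close> by (intro nn_integral_eq_integral) (auto intro!: AE_I2 divide_nonneg_nonneg)
    finally show "emeasure \<mu> (space \<mu>) \<noteq> \<infinity>" by simp
  qed
  have prob: "prob_space (\<nu> n)" "sets (\<nu> n) = sets borel" for n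
  proof -
    have "prob_space (\<nu> n) \<and> sets (\<nu> n) = sets borel"
    proof (cases "precision_strictly_positive C0 (\<Gamma> n)")
      case True
      then obtain D where "is_gaussian (\<nu> n) (m n) D" using NP[of n] unfolding is_NP0_def by auto
      then show ?thesis using is_gaussianD(1,2) by blast
    next
      case False
      then have "\<nu> n = return borel (m n)" using NP[of n] unfolding is_NP0_def by simp
      then show ?thesis by (simp add: prob_space_return)
    qed
    then show "prob_space (\<nu> n)" "sets (\<nu> n) = sets borel" by blast+
  qed
  obtain q where q: "q \<in> borel_measurable \<mu>" "\<And>x. 0 \<le> q x" "\<nu>s = density \<mu> (\<lambda>x. ennreal (q x))"
    "integrable \<mu> q" "integrable \<mu> (\<lambda>x. q x * ln (q x))" "D_KL \<nu>s \<mu> = ereal (\<integral>x. q x * ln (q x) \<partial>\<mu>)"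
  proof (rule D_KL_density_obtain[OF fin_\<mu> \<nu>s(1) _ assms(19)])
    show "sets \<nu>s = sets \<mu>" by (simp add: \<nu>s(2) sets_\<mu>)
  qed blast
  \<comment> \<open>The limit of the entropies is finite, so they are finite from some N0 on;
    densities are available for that tail.\<close>
  have "eventually (\<lambda>n. D_KL (\<nu> n) \<mu> < \<infinity>) sequentially"
    using assms(18,19) by (rule order_tendstoD(2))
  then obtain N0 where N0: "\<And>n. n \<ge> N0 \<Longrightarrow> D_KL (\<nu> n) \<mu> < \<infinity>" by (auto simp: eventually_sequentially)
  have "\<forall>n. \<exists>p. p \<in> borel_measurable \<mu> \<and> (\<forall>x. 0 \<le> p x) \<and> \<nu> (n + N0) = density \<mu> (\<lambda>x. ennreal (p x)) \<and>
    integrable \<mu> p \<and> integrable \<mu> (\<lambda>x. p x * ln (p x)) \<and> D_KL (\<nu> (n + N0)) \<mu> = ereal (\<integral>x. p x * ln (p x) \<partial>\<mu>)"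
  proof
    fix n
    have "sets (\<nu> (n + N0)) = sets \<mu>" by (simp add: prob(2) sets_\<mu>)
    moreover have "D_KL (\<nu> (n + N0)) \<mu> < \<infinity>" by (rule N0) simp
    ultimately obtain p where "p \<in> borel_measurable \<mu>" "\<And>x. 0 \<le> p x" "\<nu> (n + N0) = density \<mu> (\<lambda>x. ennreal (p x))"
      "integrable \<mu> p" "integrable \<mu> (\<lambda>x. p x * ln (p x))" "D_KL (\<nu> (n + N0)) \<mu> = ereal (\<integral>x. p x * ln (p x) \<partial>\<mu>)"
      by (rule D_KL_density_obtain[OF fin_\<mu> prob(1)]) blast
    then show "\<exists>p. p \<in> borel_measurable \<mu> \<and> (\<forall>x. 0 \<le> p x) \<and> \<nu> (n + N0) = density \<mu> (\<lambda>x. ennreal (p x)) \<and>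
      integrable \<mu> p \<and> integrable \<mu> (\<lambda>x. p x * ln (p x)) \<and> D_KL (\<nu> (n + N0)) \<mu> = ereal (\<integral>x. p x * ln (p x) \<partial>\<mu>)"
      by blast
  qed
  from choice[OF this] obtain p where "\<forall>n. p n \<in> borel_measurable \<mu> \<and> (\<forall>x. 0 \<le> p n x) \<and>
    \<nu> (n + N0) = density \<mu> (\<lambda>x. ennreal (p n x)) \<and> integrable \<mu> (p n) \<and> integrable \<mu> (\<lambda>x. p n x * ln (p n x)) \<and>
    D_KL (\<nu> (n + N0)) \<mu> = ereal (\<integral>x. p n x * ln (p n x) \<partial>\<mu>)" ..
  then have p: "\<And>n. p n \<in> borel_measurable \<mu>" "\<And>n x. 0 \<le> p n x"
    "\<And>n. \<nu> (n + N0) = density \<mu> (\<lambda>x. ennreal (p n x))"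
    "\<And>n. integrable \<mu> (p n)" "\<And>n. integrable \<mu> (\<lambda>x. p n x * ln (p n x))"
    "\<And>n. D_KL (\<nu> (n + N0)) \<mu> = ereal (\<integral>x. p n x * ln (p n x) \<partial>\<mu>)"
    by blast+
  have weak': "weakly_converges (\<lambda>n. \<nu> (n + k)) \<nu>s" for k
    using weak unfolding weakly_converges_def by (auto intro: LIMSEQ_ignore_initial_segment)
  have "(\<lambda>n. D_KL (\<nu> (n + N0)) \<mu>) \<longlonglongrightarrow> D_KL \<nu>s \<mu>"
    using assms(18) by (rule LIMSEQ_ignore_initial_segment)
  then have ent: "(\<lambda>n. \<integral>x. p n x * ln (p n x) \<partial>\<mu>) \<longlonglongrightarrow> (\<integral>x. q x * ln (q x) \<partial>\<mu>)"
    unfolding p(6) q(6) by simp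
  have Hellinger: "\<exists>N. \<forall>n\<ge>N. \<forall>k\<ge>N. (\<integral>x. (sqrt (p n x) - sqrt (p k x))\<^sup>2 \<partial>\<mu>) < e" if e: "e > 0" for e
    using weak_entropy_convergence_imp_Hellinger_Cauchy[OF fin_\<mu> sets_\<mu> p(1,2,4,5,3) q(1,2,4,5,3) prob(1) \<nu>s(1) weak' ent e]
    by metis
  obtain N1 where N1: "\<And>n k. n \<ge> N1 \<Longrightarrow> k \<ge> N1 \<Longrightarrow> (\<integral>x. (sqrt (p n x) - sqrt (p k x))\<^sup>2 \<partial>\<mu>) < 1 / 100"
    using Hellinger[of "1 / 100"] by auto
  \<comment> \<open>From N0 on densities exist, and N1 further terms bring the squared Hellinger
    distances below 1/100, the threshold of the Gaussian comparison.\<close>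
  define N where "N = N1 + N0"
  define H where "H n k = (\<integral>x. (sqrt (p (n + N1) x) - sqrt (p (k + N1) x))\<^sup>2 \<partial>\<mu>)" for n k
  have \<nu>_eq: "\<nu> (n + N) = density \<mu> (\<lambda>x. ennreal (p (n + N1) x))" for n
    using p(3)[of "n + N1"] by (simp add: N_def add.assoc)
  have H: "0 \<le> H n k" "H n k \<le> 1 / 100" for n k
    using N1[of "n + N1" "k + N1"] by (auto simp: H_def)
  have H_Cauchy: "\<exists>N. \<forall>n\<ge>N. \<forall>k\<ge>N. H n k < e" if "e > 0" for e
    using Hellinger[OF that] unfolding H_def by (meson trans_le_add1)
  have close: "second_moment_close (\<nu> (n + N)) (\<nu> (k + N)) (H n k)" for n k
    unfolding \<nu>_eq H_def by (intro second_moment_close_Hellinger p)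
  have ac: "absolutely_continuous \<mu>0 (\<nu> (n + N))" for n
    using ac_\<mu> unfolding \<nu>_eq
    by (rule absolutely_continuous_trans) (intro absolutely_continuousI_density measurable_compose[OF p(1)] measurable_ennreal)
  have "\<exists>D. is_precision_inverse C0 (\<Gamma> (n + N)) D \<and> is_gaussian (\<nu> (n + N)) (m (n + N)) D" for n
  proof (cases "precision_strictly_positive C0 (\<Gamma> (n + N))")
    case True
    then show ?thesis using NP[of "n + N"] by (simp add: is_NP0_def)
  next
    case False
    \<comment> \<open>The failure of strict positivity exhibits a nonzero vector, which provides the
      direction that the exclusion of the Dirac branch asks for.\<close>
    then obtain u :: 'h where "u \<noteq> 0" unfolding precision_strictly_positive_def by blast
    moreover have "\<nu> (n + N) = return borel (m (n + N))" using False NP[of "n + N"] by (simp add: is_NP0_def)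
    ultimately show ?thesis using Dirac_not_absolutely_continuous[OF G0] ac[of n] by metis
  qed
  then obtain D where D: "\<And>n. is_precision_inverse C0 (\<Gamma> (n + N)) (D n)"
    "\<And>n. is_gaussian (\<nu> (n + N)) (m (n + N)) (D n)" by metis
  \<comment> \<open>Absolute continuity gives a covariance bound for a single measure; closeness to
    it makes the bound, doubled, uniform over the tail.\<close>
  obtain M where M: "M > 0" "\<And>h. h \<bullet> (D 0) h \<le> M * (h \<bullet> C0 h)"
    using gaussian_covariance_bounded[OF G0 D(2) ac C0_form_pos] by blast
  have bound: "h \<bullet> (D n) h \<le> (2 * M) * (norm (L h))\<^sup>2" for n h
    using gaussian_variance_close[OF close[of 0 n] H(2) D(2) D(2), where h = h] M(2)[of h] by (simp add: C0_form)
  have "\<forall>n. \<exists>T. blinfun_apply (snd T) = (\<lambda>x. x + sqrt_conj C0 (\<Gamma> (n + N)) x) \<and> snd T o\<^sub>L fst T = id_blinfun \<and>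
    fst T o\<^sub>L snd T = id_blinfun \<and> self_adjoint (snd T) \<and> nonneg_operator (fst T) \<and> norm (fst T) \<le> 2 * M \<and>
    D n = L o\<^sub>L (fst T o\<^sub>L L)"
  proof
    fix n
    have "0 \<le> 2 * M" using M(1) by simp
    then obtain R S where "blinfun_apply S = (\<lambda>x. x + sqrt_conj C0 (\<Gamma> (n + N)) x)" "S o\<^sub>L R = id_blinfun" "R o\<^sub>L S = id_blinfun"
      "self_adjoint S" "nonneg_operator R" "norm R \<le> 2 * M" "D n = L o\<^sub>L (R o\<^sub>L L)"
      by (rule precision_whitened_inverse[OF \<Gamma> D(1) gaussian_covariance_nonneg[OF D(2)] _ bound])
    then show "\<exists>T. blinfun_apply (snd T) = (\<lambda>x. x + sqrt_conj C0 (\<Gamma> (n + N)) x) \<and> snd T o\<^sub>L fst T = id_blinfun \<and>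
      fst T o\<^sub>L snd T = id_blinfun \<and> self_adjoint (snd T) \<and> nonneg_operator (fst T) \<and> norm (fst T) \<le> 2 * M \<and>
      D n = L o\<^sub>L (fst T o\<^sub>L L)"
      by (intro exI[of _ "(R, S)"]) simp
  qed
  from choice[OF this] obtain T :: "nat \<Rightarrow> ('h \<Rightarrow>\<^sub>L 'h) \<times> ('h \<Rightarrow>\<^sub>L 'h)" where T: "\<forall>n. blinfun_apply (snd (T n)) = (\<lambda>x. x + sqrt_conj C0 (\<Gamma> (n + N)) x) \<and>
    snd (T n) o\<^sub>L fst (T n) = id_blinfun \<and> fst (T n) o\<^sub>L snd (T n) = id_blinfun \<and> self_adjoint (snd (T n)) \<and>
    nonneg_operator (fst (T n)) \<and> norm (fst (T n)) \<le> 2 * M \<and> D n = L o\<^sub>L (fst (T n) o\<^sub>L L)" ..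
  define R where "R n = fst (T n)" for n
  define S where "S n = snd (T n)" for n
  have RS: "\<And>n. blinfun_apply (S n) = (\<lambda>x. x + sqrt_conj C0 (\<Gamma> (n + N)) x)"
    "\<And>n. S n o\<^sub>L R n = id_blinfun" "\<And>n. R n o\<^sub>L S n = id_blinfun" "\<And>n. self_adjoint (S n)"
    "\<And>n. nonneg_operator (R n)" "\<And>n. norm (R n) \<le> 2 * M" "\<And>n. D n = L o\<^sub>L (R n o\<^sub>L L)"
    unfolding R_def S_def using T by blast+
  have G: "is_gaussian (\<nu> (n + N)) (m (n + N)) (L o\<^sub>L (R n o\<^sub>L L))" for n
    using D(2)[of n] by (simp only: RS(7))
  obtain ms Rs \<Gamma>s where lim: "\<Gamma>s \<in> cm_hs C0" "cm_symmetric C0 \<Gamma>s" "precision_strictly_positive C0 \<Gamma>s"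
    "is_precision_inverse C0 \<Gamma>s (L o\<^sub>L (Rs o\<^sub>L L))" "nonneg_operator Rs" "(\<lambda>n. m (n + N)) \<longlonglongrightarrow> ms" "R \<longlonglongrightarrow> Rs"
    "(\<lambda>n. cm_norm C0 (m (n + N) - ms) + ereal (cm_hs_norm C0 (\<lambda>v u. \<Gamma> (n + N) v u - \<Gamma>s v u))) \<longlonglongrightarrow> 0"
    by (rule whitened_gaussian_limit[OF \<Gamma> RS(1,4,2,3,5,6) G close H H_Cauchy])
  have "is_gaussian \<nu>s ms (L o\<^sub>L (Rs o\<^sub>L L))"
  proof (rule is_gaussianI_marginals[OF \<nu>s])
    show "nonneg_operator (L o\<^sub>L (Rs o\<^sub>L L))"
      unfolding nonneg_operator_def
    proof (intro conjI allI)
      show "self_adjoint (L o\<^sub>L (Rs o\<^sub>L L))"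
        using self_adjointD[OF nonneg_operator_self_adjoint[OF lim(5)]] by (simp add: self_adjoint_def L_sym)
      show "0 \<le> x \<bullet> (L o\<^sub>L (Rs o\<^sub>L L)) x" for x
        using nonneg_operatorD[OF lim(5), of "L x"] by (simp add: L_sym)
    qed
    fix h
    show "distr \<nu>s borel (\<lambda>x. h \<bullet> x) = distr std_normal_distribution borel
        (\<lambda>y. h \<bullet> ms + sqrt (h \<bullet> (L o\<^sub>L (Rs o\<^sub>L L)) h) * y)"
    proof (rule weak_limit_gaussian_marginal[OF G weak' \<nu>s])
      show "(\<lambda>n. h \<bullet> m (n + N)) \<longlonglongrightarrow> h \<bullet> ms" by (intro tendsto_intros lim(6))
      show "(\<lambda>n. h \<bullet> (L o\<^sub>L (R n o\<^sub>L L)) h) \<longlonglongrightarrow> h \<bullet> (L o\<^sub>L (Rs o\<^sub>L L)) h"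
        unfolding blinfun_apply_blinfun_compose by (intro tendsto_intros lim(7))
    qed
  qed
  then have "is_NP0 C0 \<nu>s ms \<Gamma>s" using lim(3,4) by (auto simp: is_NP0_def)
  moreover have "(\<lambda>n. cm_norm C0 (m n - ms) + ereal (cm_hs_norm C0 (\<lambda>v u. \<Gamma> n v u - \<Gamma>s v u))) \<longlonglongrightarrow> 0"
    using lim(8) by (rule LIMSEQ_offset)
  ultimately show ?thesis using lim(1,2) by blast
qed

end
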